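(* Let $M$ be a compact surface with boundary, let $f:M\to M$ be a homeomorphism, and let $T=(T^P,T^V,T^U,T^S)$ be a transverse trellis for $f$ such that $T^P$ consists of hyperbolic periodic points of $f$. Let $\mathcal{C}f:(X_T,Y_T)\to(X_T,Y_T)$ be the map of pairs obtained from $f$ by cutting $M$ along $T^U$, and let $\mathbf{R}$ be a set of mutually disjoint regions of $(X_T,Y_T)$. Then $$h_{\mathrm{top}}(f)\ \ge\ N_\infty(\mathcal{C}f),$$ where $N_\infty(\mathcal{C}f)$ is the asymptotic Nielsen number of $\mathcal{C}f$ on $(X_T,Y_T;\mathbf{R})$.
   Context: Topological pairs. A topological pair $(X,Y)$ is a space $X$ with a closed subset $Y$; all spaces are compact absolute neighbourhood retracts. A map of pairs $g:(X_1,Y_1)\to(X_2,Y_2)$ is a continuous map $X_1\to X_2$ with $g(Y_1)\subset Y_2$; it is exact if also $g^{-1}(Y_2)\subset Y_1$. A homotopy of maps of pairs is a homotopy through maps of pairs. A region of $(X,Y)$ is an open subset $R$ of $X\setminus Y$ such that $R\cup Y$ is closed in $X$. A regional space $(X,Y;\mathbf{R})$ is a pair $(X,Y)$ with a set $\mathbf{R}$ of mutually disjoint regions (not required to cover $X\setminus Y$). Trellises. A trellis in $M$ is a collection $T=(T^P,T^V,T^U,T^S)$ of subsets of $M\setminus\partial M$ such that $T^P$ is finite; $T^U$ and $T^S$ are embedded copies of $T^P\times I$ ($I=[0,1]$) such that each component of $T^U$ and of $T^S$ contains exactly one point of $T^P$; and $T^V=T^U\cap T^S$ is finite. $T$ is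 transverse if the intersections of $T^S$ and $T^U$ are topologically transverse. $T$ is a trellis for $f:M\to M$ if $f$ maps $T^P$ bijectively to $T^P$, $f(T^S)\subset T^S$ and $f^{-1}(T^U)\subset T^U$. A periodic point $p$ of period $n$ is hyperbolic if no eigenvalue of $D(f^n)(p)$ has modulus $1$. Cutting. Cutting $M$ along the finite disjoint union of arcs $T^U$ gives a surface $X_T$ and a quotient (gluing) map $q:X_T\to M$: for each arc $\alpha:I\to M$ of $T^U$ there are two curves $\alpha_1,\alpha_2:I\to\partial X_T$, disjoint except that $\alpha_1(0)=\alpha_2(0)$ and $\alpha_1(1)=\alpha_2(1)$ (as the endpoints of $\alpha$ are interior to $M$), and $q$ is the quotient map for the relation $\alpha_1(t)\sim\alpha_2(t)$, with $q(\alpha_1(t))=q(\alpha_2(t))=\alpha(t)$. Put $Y_T=q^{-1}(T^S)$. Since $f^{-1}(T^U)\subset T^U$ and $f(T^S)\subset T^S$, there is a map of pairs $\mathcal{C}f:(X_T,Y_T)\to(X_T,Y_T)$ with $q\circ\mathcal{C}f=f\circ q$. Relative Nielsen theory. Let $g$ be a self-map of $(X,Y)$, with regional space $(X,Y;\mathbf{R})$. $\mathrm{Per}_n(g)$ is the set of fixed points of $g^n$. A word $R_0R_1\ldots R_{n-1}$ on $\mathbf{R}$ is a code for $x\in\mathrm{Per}_n(g)$ if $g^i(x)\in R_i$ for $0\le i<n$. Points $x_1,x_2\in\mathrm{Per}_n(g)$ are Nielsen equivalent if there are a subset $J\subset I$ and exact curves $\alpha_j:(I,J)\to(X,Y)$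 from $g^j(x_1)$ to $g^j(x_2)$, $j=0,\ldots,n-1$, such that $\alpha_{j+1\bmod n}$ is homotopic to $g\circ\alpha_j$ for all $j$ (homotopy of maps of pairs $(I,J)\to(X,Y)$ relative to endpoints); $(\alpha_j)$ is called a relating family. This is an equivalence relation, whose classes are the $n$-Nielsen classes. A point $x\in\mathrm{Per}_n(g)$ is Nielsen related to $Y$ if there is a relating family from $x$ to itself with $J\ne\emptyset$, and Nielsen separated from $Y$ otherwise; this depends only on the Nielsen class of $x$, and if one point of a class separated from $Y$ has a code $\mathcal{R}$ then all points of that class have code $\mathcal{R}$. Each Nielsen class $Q$ is open in $\mathrm{Per}_n(g)$; its index is the fixed point (Lefschetz) index of $g^n$ on an open neighbourhood of $Q$ whose closure contains no other fixed points of $g^n$, and $Q$ is essential if its index is nonzero. $N_n(g)$ is the number of essential $n$-Nielsen classes separated from $Y$ having a code which is a word of length $n$ on $\mathbf{R}$. The asymptotic Nielsen number is $N_\infty(g)=\limsup_{n\to\infty}\frac{\log N_n(g)}{n}$. $h_{\mathrm{top}}$ denotes topological entropy. *)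

theory Defs
  imports "HOL-Analysis.Analysis" "HOL-Homology.Homology"
begin

section \<open>Surfaces\<close>

definition half_plane :: "(real^2) set" where
  "half_plane = {z. 0 \<le> z $ 2}"

text \<open>Surfaces may have empty boundary and need not be connected. Second countability follows from
  compactness.\<close>

definition compact_surface :: "'a topology \<Rightarrow> bool" where
  "compact_surface M \<longleftrightarrow> compact_space M \<and> Hausdorff_space M \<and>
     (\<forall>x\<in>topspace M. \<exists>U V. openin M U \<and> x \<in> U \<and> openin (top_of_set half_plane) V \<and>
        subtopology M U homeomorphic_space top_of_set V)"

definition surface_interior :: "'a topology \<Rightarrow> 'a set" where
  "surface_interior M = {x \<in> topspace M. \<exists>U (V :: (real^2) set).
     openin M U \<and> x \<in> U \<and> open V \<and> subtopology M U homeomorphic_space top_of_set V}"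

definition surface_boundary :: "'a topology \<Rightarrow> 'a set" where
  "surface_boundary M = topspace M - surface_interior M"

text \<open>The eigenvalues of \<open>D(f^n)(p)\<close> only make sense relative to a differentiable structure. It is
  given by an atlas whose transition maps are continuously differentiable (one-sidedly at boundary
  points).\<close>

definition C1_on :: "(real^2) set \<Rightarrow> (real^2 \<Rightarrow> real^2) \<Rightarrow> bool" where
  "C1_on S h \<longleftrightarrow> (\<exists>D :: real^2 \<Rightarrow> (real^2) \<Rightarrow>\<^sub>L (real^2).
     continuous_on S D \<and> (\<forall>x\<in>S. (h has_derivative blinfun_apply (D x)) (at x within S)))"

type_synonym 'a atlas = "('a set \<times> ('a \<Rightarrow> real^2)) set"

definition C1_atlas :: "'a topology \<Rightarrow> 'a atlas \<Rightarrow> bool" where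
  "C1_atlas M A \<longleftrightarrow>
     (\<forall>(U, \<phi>)\<in>A. openin M U \<and> openin (top_of_set half_plane) (\<phi> ` U) \<and>
        homeomorphic_map (subtopology M U) (top_of_set (\<phi> ` U)) \<phi>) \<and>
     \<Union>(fst ` A) = topspace M \<and>
     (\<forall>(U, \<phi>)\<in>A. \<forall>(U', \<phi>')\<in>A. C1_on (\<phi> ` (U \<inter> U')) (\<phi>' \<circ> inv_into U \<phi>))"

definition complex_eigenvalue :: "real^2^2 \<Rightarrow> complex \<Rightarrow> bool" where
  "complex_eigenvalue B \<mu> \<longleftrightarrow>
     (\<exists>v :: complex^2. v \<noteq> 0 \<and> (\<chi> i j. complex_of_real (B $ i $ j)) *v v = \<mu> *s v)"

definition is_period :: "('a \<Rightarrow> 'a) \<Rightarrow> 'a \<Rightarrow> nat \<Rightarrow> bool" where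
  "is_period f p n \<longleftrightarrow> 0 < n \<and> (f ^^ n) p = p \<and> (\<forall>m. 0 < m \<and> m < n \<longrightarrow> (f ^^ m) p \<noteq> p)"

text \<open>\<open>B\<close> is the matrix of \<open>D(f^n)(p)\<close> in a chart at \<open>p\<close>. Changing the chart conjugates \<open>B\<close>, so
  the choice of chart is irrelevant.\<close>

definition hyperbolic_periodic_point ::
    "'a topology \<Rightarrow> 'a atlas \<Rightarrow> ('a \<Rightarrow> 'a) \<Rightarrow> 'a \<Rightarrow> bool" where
  "hyperbolic_periodic_point M A f p \<longleftrightarrow> p \<in> topspace M \<and>
     (\<exists>n U \<phi> B. is_period f p n \<and> (U, \<phi>) \<in> A \<and> p \<in> U \<and>
        ((\<phi> \<circ> (f ^^ n) \<circ> inv_into U \<phi>) has_derivative (\<lambda>v. B *v v)) (at (\<phi> p) within \<phi> ` U) \<and>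
        (\<forall>\<mu>. complex_eigenvalue B \<mu> \<longrightarrow> cmod \<mu> \<noteq> 1))"

section \<open>Trellises\<close>

record 'a trellis =
  TP :: "'a set"
  TV :: "'a set"
  TU :: "'a set"
  TS :: "'a set"

definition embedded_branches :: "'a topology \<Rightarrow> 'a set \<Rightarrow> 'a set \<Rightarrow> bool" where
  "embedded_branches M P B \<longleftrightarrow>
     (\<exists>\<phi>. embedding_map (prod_topology (discrete_topology P) (top_of_set {0..1::real})) M \<phi> \<and>
          \<phi> ` (P \<times> {0..1}) = B) \<and>
     (\<forall>C\<in>connected_components_of (subtopology M B). \<exists>!p. p \<in> C \<and> p \<in> P)"

definition trellis :: "'a topology \<Rightarrow> 'a trellis \<Rightarrow> bool" where
  "trellis M T \<longleftrightarrow>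
     TP T \<subseteq> surface_interior M \<and> TV T \<subseteq> surface_interior M \<and>
     TU T \<subseteq> surface_interior M \<and> TS T \<subseteq> surface_interior M \<and>
     finite (TP T) \<and>
     embedded_branches M (TP T) (TU T) \<and> embedded_branches M (TP T) (TS T) \<and>
     TV T = TU T \<inter> TS T \<and> finite (TV T)"

text \<open>Topological transversality: near each intersection point the two curves lie along the two
  coordinate axes of a topological chart. Inclusion rather than equality is required because the
  intersection point may be an endpoint of one of the arcs.\<close>

definition transverse_trellis :: "'a topology \<Rightarrow> 'a trellis \<Rightarrow> bool" where
  "transverse_trellis M T \<longleftrightarrow>
     (\<forall>v\<in>TV T. \<exists>W (h :: 'a \<Rightarrow> real^2). openin M W \<and> v \<in> W \<and>
        homeomorphic_map (subtopology M W) euclidean h \<and> h v = 0 \<and>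
        h ` (TU T \<inter> W) \<subseteq> {z. z $ 1 = 0} \<and> h ` (TS T \<inter> W) \<subseteq> {z. z $ 2 = 0})"

definition trellis_for :: "'a topology \<Rightarrow> 'a trellis \<Rightarrow> ('a \<Rightarrow> 'a) \<Rightarrow> bool" where
  "trellis_for M T f \<longleftrightarrow> trellis M T \<and> bij_betw f (TP T) (TP T) \<and> f ` TS T \<subseteq> TS T \<and>
     {x \<in> topspace M. f x \<in> TU T} \<subseteq> TU T"

section \<open>Pairs and regions\<close>

definition map_of_pairs ::
    "'a topology \<Rightarrow> 'a set \<Rightarrow> 'b topology \<Rightarrow> 'b set \<Rightarrow> ('a \<Rightarrow> 'b) \<Rightarrow> bool" where
  "map_of_pairs X1 Y1 X2 Y2 g \<longleftrightarrow> continuous_map X1 X2 g \<and> g ` Y1 \<subseteq> Y2"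

definition exact_map_of_pairs ::
    "'a topology \<Rightarrow> 'a set \<Rightarrow> 'b topology \<Rightarrow> 'b set \<Rightarrow> ('a \<Rightarrow> 'b) \<Rightarrow> bool" where
  "exact_map_of_pairs X1 Y1 X2 Y2 g \<longleftrightarrow>
     map_of_pairs X1 Y1 X2 Y2 g \<and> {x \<in> topspace X1. g x \<in> Y2} \<subseteq> Y1"

definition region :: "'a topology \<Rightarrow> 'a set \<Rightarrow> 'a set \<Rightarrow> bool" where
  "region X Y R \<longleftrightarrow> openin (subtopology X (topspace X - Y)) R \<and> closedin X (R \<union> Y)"

section \<open>Cutting\<close>

text \<open>\<open>q : X \<rightarrow> M\<close> is the gluing map of the surface obtained by cutting \<open>M\<close> along \<open>B\<close>, a finite
  disjoint union of arcs. The arcs are indexed by the components \<open>C\<close> of \<open>B\<close>: \<open>\<alpha> C\<close> parametrises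
  \<open>C\<close>, and \<open>\<alpha>1 C\<close>, \<open>\<alpha>2 C\<close> are its two copies in the boundary of \<open>X\<close>.\<close>

definition cut_surface ::
    "'a topology \<Rightarrow> 'a set \<Rightarrow> 'b topology \<Rightarrow> ('b \<Rightarrow> 'a) \<Rightarrow> bool" where
  "cut_surface M B X q \<longleftrightarrow> compact_surface X \<and> quotient_map X M q \<and>
     (\<exists>(\<alpha> :: 'a set \<Rightarrow> real \<Rightarrow> 'a) (\<alpha>1 :: 'a set \<Rightarrow> real \<Rightarrow> 'b) (\<alpha>2 :: 'a set \<Rightarrow> real \<Rightarrow> 'b).
        (\<forall>C\<in>connected_components_of (subtopology M B).
           embedding_map (top_of_set {0..1}) M (\<alpha> C) \<and> \<alpha> C ` {0..1} = C \<and>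
           pathin X (\<alpha>1 C) \<and> \<alpha>1 C ` {0..1} \<subseteq> surface_boundary X \<and>
           pathin X (\<alpha>2 C) \<and> \<alpha>2 C ` {0..1} \<subseteq> surface_boundary X \<and>
           (\<forall>t\<in>{0..1}. q (\<alpha>1 C t) = \<alpha> C t \<and> q (\<alpha>2 C t) = \<alpha> C t) \<and>
           \<alpha>1 C 0 = \<alpha>2 C 0 \<and> \<alpha>1 C 1 = \<alpha>2 C 1 \<and>
           \<alpha>1 C ` {0..1} \<inter> \<alpha>2 C ` {0..1} = {\<alpha>1 C 0, \<alpha>1 C 1}) \<and>
        (\<forall>x\<in>topspace X. \<forall>y\<in>topspace X. q x = q y \<longleftrightarrow>
           x = y \<or> (\<exists>C\<in>connected_components_of (subtopology M B). \<exists>t\<in>{0..1}.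
                      {x, y} = {\<alpha>1 C t, \<alpha>2 C t})))"

definition cut_stable :: "'a trellis \<Rightarrow> 'b topology \<Rightarrow> ('b \<Rightarrow> 'a) \<Rightarrow> 'b set" where
  "cut_stable T X q = {x \<in> topspace X. q x \<in> TS T}"

text \<open>These conditions determine \<open>g\<close> on \<open>X\<close>: \<open>q\<close> is injective off \<open>q\<^sup>-\<^sup>1(TU T)\<close>, whose complement is
  dense and is mapped by \<open>f \<circ> q\<close> into the complement of \<open>TU T\<close>.\<close>

definition is_cut_map ::
    "'a trellis \<Rightarrow> ('a \<Rightarrow> 'a) \<Rightarrow> 'b topology \<Rightarrow> ('b \<Rightarrow> 'a) \<Rightarrow> ('b \<Rightarrow> 'b) \<Rightarrow> bool" where
  "is_cut_map T f X q g \<longleftrightarrow> map_of_pairs X (cut_stable T X q) X (cut_stable T X q) g \<and>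
     (\<forall>x\<in>topspace X. q (g x) = f (q x))"

section \<open>The fixed point index\<close>

text \<open>Dold's definition. Let \<open>F : W \<rightarrow> \<real>\<^sup>n\<close> be continuous with \<open>W\<close> open in \<open>\<real>\<^sup>n\<close> and compact fixed
  point set \<open>K\<close>, let \<open>D\<close> be a closed ball about \<open>0\<close> containing \<open>K\<close>, and let \<open>z\<close> generate
  \<open>H\<^sub>n(\<real>\<^sup>n, \<real>\<^sup>n - D)\<close>. By excision the image of \<open>z\<close> in \<open>H\<^sub>n(\<real>\<^sup>n, \<real>\<^sup>n - K)\<close> is the image of a unique
  \<open>w\<close> in \<open>H\<^sub>n(W, W - K)\<close>, and \<open>id - F\<close> sends \<open>w\<close> to the index times the image of \<open>z\<close> in
  \<open>H\<^sub>n(\<real>\<^sup>n, \<real>\<^sup>n - 0)\<close>. The homology groups are written multiplicatively, so this multiple is a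
  power.\<close>

definition Euclidean_ball :: "nat \<Rightarrow> real \<Rightarrow> (nat \<Rightarrow> real) set" where
  "Euclidean_ball n r = {x \<in> topspace (Euclidean_space n). (\<Sum>i<n. (x i)\<^sup>2) \<le> r\<^sup>2}"

definition has_Euclidean_index ::
    "nat \<Rightarrow> (nat \<Rightarrow> real) set \<Rightarrow> ((nat \<Rightarrow> real) \<Rightarrow> nat \<Rightarrow> real) \<Rightarrow> int \<Rightarrow> bool" where
  "has_Euclidean_index n W F k \<longleftrightarrow>
     (let E = Euclidean_space n; K = {x \<in> W. F x = x} in
      openin E W \<and> continuous_map (subtopology E W) E F \<and> compactin E K \<and>
      (\<exists>r z w.
         let D = Euclidean_ball n r;
             HD = relative_homology_group (int n) E (topspace E - D);
             HK = relative_homology_group (int n) (subtopology E W) (W - K);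
             H0 = relative_homology_group (int n) E (topspace E - {\<lambda>i. 0})
         in K \<subseteq> D \<and> z \<in> carrier HD \<and> carrier HD = range (\<lambda>m::int. z [^]\<^bsub>HD\<^esub> m) \<and>
            w \<in> carrier HK \<and>
            hom_induced (int n) (subtopology E W) (W - K) E (topspace E - K) id w =
              hom_induced (int n) E (topspace E - D) E (topspace E - K) id z \<and>
            hom_induced (int n) (subtopology E W) (W - K) E (topspace E - {\<lambda>i. 0})
                (\<lambda>x i. x i - F x i) w =
              hom_induced (int n) E (topspace E - D) E (topspace E - {\<lambda>i. 0}) id z [^]\<^bsub>H0\<^esub> k))"

text \<open>A compact finite-dimensional absolute neighbourhood retract \<open>X\<close>, in particular a compact
  surface, is a retract \<open>\<rho> : V \<rightarrow> X\<close> of an open set \<open>V\<close> of some \<open>\<real>\<^sup>n\<close>, via an embedding \<open>e\<close>. The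
  index of \<open>g\<close> on \<open>U\<close> is that of \<open>e \<circ> g \<circ> \<rho>\<close> on \<open>\<rho>\<^sup>-\<^sup>1(U)\<close>; it does not depend on \<open>n\<close>, \<open>e\<close>, \<open>V\<close>
  and \<open>\<rho>\<close>.\<close>

definition fixed_point_index :: "'a topology \<Rightarrow> ('a \<Rightarrow> 'a) \<Rightarrow> 'a set \<Rightarrow> int" where
  "fixed_point_index X g U = (THE k. \<exists>n e V \<rho>.
     embedding_map X (Euclidean_space n) e \<and> openin (Euclidean_space n) V \<and> e ` topspace X \<subseteq> V \<and>
     continuous_map (subtopology (Euclidean_space n) V) X \<rho> \<and> (\<forall>x\<in>topspace X. \<rho> (e x) = x) \<and>
     has_Euclidean_index n {y \<in> V. \<rho> y \<in> U} (e \<circ> g \<circ> \<rho>) k)"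

section \<open>Relative Nielsen theory\<close>

definition Per :: "'a topology \<Rightarrow> ('a \<Rightarrow> 'a) \<Rightarrow> nat \<Rightarrow> 'a set" where
  "Per X g n = {x \<in> topspace X. (g ^^ n) x = x}"

definition is_code :: "'a set set \<Rightarrow> ('a \<Rightarrow> 'a) \<Rightarrow> 'a \<Rightarrow> 'a set list \<Rightarrow> bool" where
  "is_code RR g x w \<longleftrightarrow> set w \<subseteq> RR \<and> (\<forall>i<length w. (g ^^ i) x \<in> w ! i)"

definition homotopic_curves ::
    "'a topology \<Rightarrow> 'a set \<Rightarrow> real set \<Rightarrow> (real \<Rightarrow> 'a) \<Rightarrow> (real \<Rightarrow> 'a) \<Rightarrow> bool" where
  "homotopic_curves X Y J \<beta> \<gamma> \<longleftrightarrow>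
     homotopic_with (\<lambda>h. h ` J \<subseteq> Y \<and> h 0 = \<beta> 0 \<and> h 1 = \<beta> 1) (top_of_set {0..1}) X \<beta> \<gamma>"

definition relating_family ::
    "'a topology \<Rightarrow> 'a set \<Rightarrow> ('a \<Rightarrow> 'a) \<Rightarrow> nat \<Rightarrow> 'a \<Rightarrow> 'a \<Rightarrow> real set \<Rightarrow>
     (nat \<Rightarrow> real \<Rightarrow> 'a) \<Rightarrow> bool" where
  "relating_family X Y g n x1 x2 J \<alpha> \<longleftrightarrow> J \<subseteq> {0..1} \<and>
     (\<forall>j<n. exact_map_of_pairs (top_of_set {0..1}) J X Y (\<alpha> j) \<and>
        \<alpha> j 0 = (g ^^ j) x1 \<and> \<alpha> j 1 = (g ^^ j) x2 \<and>
        homotopic_curves X Y J (g \<circ> \<alpha> j) (\<alpha> (Suc j mod n)))"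

definition nielsen_relation ::
    "'a topology \<Rightarrow> 'a set \<Rightarrow> ('a \<Rightarrow> 'a) \<Rightarrow> nat \<Rightarrow> ('a \<times> 'a) set" where
  "nielsen_relation X Y g n =
     {(x1, x2). x1 \<in> Per X g n \<and> x2 \<in> Per X g n \<and> (\<exists>J \<alpha>. relating_family X Y g n x1 x2 J \<alpha>)}"

definition nielsen_classes ::
    "'a topology \<Rightarrow> 'a set \<Rightarrow> ('a \<Rightarrow> 'a) \<Rightarrow> nat \<Rightarrow> 'a set set" where
  "nielsen_classes X Y g n = Per X g n // nielsen_relation X Y g n"

definition nielsen_separated ::
    "'a topology \<Rightarrow> 'a set \<Rightarrow> ('a \<Rightarrow> 'a) \<Rightarrow> nat \<Rightarrow> 'a \<Rightarrow> bool" where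
  "nielsen_separated X Y g n x \<longleftrightarrow> \<not> (\<exists>J \<alpha>. J \<noteq> {} \<and> relating_family X Y g n x x J \<alpha>)"

definition essential_class :: "'a topology \<Rightarrow> ('a \<Rightarrow> 'a) \<Rightarrow> nat \<Rightarrow> 'a set \<Rightarrow> bool" where
  "essential_class X g n Q \<longleftrightarrow>
     (\<exists>U. openin X U \<and> Q \<subseteq> U \<and> (X closure_of U) \<inter> Per X g n = Q \<and>
          fixed_point_index X (g ^^ n) U \<noteq> 0)"

definition nielsen_number ::
    "'a topology \<Rightarrow> 'a set \<Rightarrow> 'a set set \<Rightarrow> ('a \<Rightarrow> 'a) \<Rightarrow> nat \<Rightarrow> nat" where
  "nielsen_number X Y RR g n = card {Q \<in> nielsen_classes X Y g n.
     essential_class X g n Q \<and> (\<forall>x\<in>Q. nielsen_separated X Y g n x) \<and>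
     (\<exists>w. length w = n \<and> (\<forall>x\<in>Q. is_code RR g x w))}"

text \<open>With the convention \<open>log 0 = -\<infinity>\<close>, whereas \<open>ln 0 = 0\<close> in HOL.\<close>

definition asymptotic_nielsen_number ::
    "'a topology \<Rightarrow> 'a set \<Rightarrow> 'a set set \<Rightarrow> ('a \<Rightarrow> 'a) \<Rightarrow> ereal" where
  "asymptotic_nielsen_number X Y RR g = limsup (\<lambda>n.
     if nielsen_number X Y RR g n = 0 then -\<infinity>
     else ereal (ln (real (nielsen_number X Y RR g n)) / real n))"

section \<open>Topological entropy\<close>

text \<open>The Adler--Konheim--McAndrew definition for compact spaces. The limit in the definition of the
  entropy of a cover exists by subadditivity, so it is the upper limit.\<close>

definition open_cover :: "'a topology \<Rightarrow> 'a set set \<Rightarrow> bool" where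
  "open_cover M \<U> \<longleftrightarrow> (\<forall>U\<in>\<U>. openin M U) \<and> \<Union>\<U> = topspace M"

definition min_subcover :: "'a topology \<Rightarrow> 'a set set \<Rightarrow> nat" where
  "min_subcover M \<U> = (LEAST k. \<exists>\<V>\<subseteq>\<U>. finite \<V> \<and> card \<V> = k \<and> \<Union>\<V> = topspace M)"

definition iterated_join :: "'a topology \<Rightarrow> ('a \<Rightarrow> 'a) \<Rightarrow> 'a set set \<Rightarrow> nat \<Rightarrow> 'a set set" where
  "iterated_join M f \<U> n =
     {{x \<in> topspace M. \<forall>i<n. (f ^^ i) x \<in> u i} | u. \<forall>i<n. u i \<in> \<U>}"

definition topological_entropy :: "'a topology \<Rightarrow> ('a \<Rightarrow> 'a) \<Rightarrow> ereal" where
  "topological_entropy M f = (SUP \<U>\<in>{\<U>. open_cover M \<U>}.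
     limsup (\<lambda>n. ereal (ln (real (min_subcover M (iterated_join M f \<U> n))) / real n)))"

end

theory Submission
  imports Defs "HOL-Complex_Analysis.Contour_Integration"
begin

text \<open>A Nielsen class with a code consists of points whose orbits avoid
  the stable set \<open>Y\<close>, and two such periodic points are Nielsen equivalent (with \<open>J = {}\<close>) as soon as
  corresponding orbit points are joined by short paths avoiding \<open>Y\<close>. Hence, for a point followed
  along an itinerary of small open sets of \<open>M\<close>, only the local sides of \<open>Y\<close> on which its orbit
  lies matter. An arc has at most two local sides, and a crossing of stable and unstable arcs at most
  four over both its lifts. The side at one time determines the side at the next, except where
  \<open>f\<close> maps points close by into \<open>Y\<close> which were not in \<open>Y\<close> before. An orbit meets such places
  at most twice: once on arriving at the stable arcs, and once at an endpoint of an arc that is mapped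
  to an interior point, after which it stays at interior points. So a block of \<open>N\<close>
  steps admits at most \<open>4^3\<close> patterns of sides, independently of \<open>N\<close>, and the number of classes
  grows at most at the rate of the entropy plus \<open>ln 64 / N\<close>.\<close>

section \<open>Charts of a compact surface\<close>

text \<open>The obstacle is that entropy is measured in \<open>M\<close>, while Nielsen classes live
  in the cut surface, where the preimage of an arbitrarily small open set of \<open>M\<close> falls
  apart into several pieces off the stable set. Recording a label at every step would cost a factor
  4 per step, so the resulting bound would exceed the entropy by \<open>ln 4\<close>, however fine
  the cover. Blocks remove this loss: the neighbourhoods are shrunk depending on the block length
  \<open>N\<close>, but \<open>N\<close> is fixed before \<open>n\<close> grows, so one open cover
  of \<open>M\<close> governs all \<open>n\<close>, and its entropy is one term of the supremum
  defining the entropy of \<open>f\<close>. The constant is 4 * 4^2: one label for the position at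
  the start of a block and one for each of at most two entry times. The count itself is an injection
  of classes into pairs formed by a member of a minimal subcover and a word of labels; all that
  labels have to do is to make points with equal labels close.\<close>

lemma surface_convex_chart:
  assumes X: "compact_surface X" and O: "openin X W" "x \<in> W"
  obtains S C \<phi> \<psi> where "openin X S" "x \<in> S" "S \<subseteq> W" "convex (C :: (real^2) set)"
    "openin (top_of_set half_plane) C" "C \<noteq> {}"
    "homeomorphic_maps (subtopology X S) (top_of_set C) \<phi> \<psi>"
proof -
  have x: "x \<in> topspace X" using O openin_subset by blast
  obtain U V where U: "openin X U" "x \<in> U" and V: "openin (top_of_set half_plane) V"
    and h: "subtopology X U homeomorphic_space top_of_set V"
    using X x unfolding compact_surface_def by blast
  then obtain \<phi> \<psi> where hom: "homeomorphic_maps (subtopology X U) (top_of_set V) \<phi> \<psi>"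
    unfolding homeomorphic_space_def by blast
  have tU: "topspace (subtopology X U) = U" using openin_subset[OF U(1)] by (simp add: Int_absorb1)
  have hm: "homeomorphic_map (subtopology X U) (top_of_set V) \<phi>"
    using hom homeomorphic_maps_map by blast
  have op: "openin (subtopology X U) (U \<inter> W)"
    using O U by (simp add: openin_open_subtopology openin_Int)
  then have "openin (top_of_set V) (\<phi> ` (U \<inter> W))"
    using homeomorphic_map_openness_eq[OF hm] by blast
  then have "openin (top_of_set half_plane) (\<phi> ` (U \<inter> W))"
    using V openin_trans by blast
  moreover have "\<phi> x \<in> \<phi> ` (U \<inter> W)" using U O by blast
  ultimately obtain e where e: "e > 0" "ball (\<phi> x) e \<inter> half_plane \<subseteq> \<phi> ` (U \<inter> W)"
    by (metis openin_contains_ball)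
  \<comment> \<open>Intersecting with the half-plane keeps the chart image convex at boundary points
    too.\<close>
  define C where "C = ball (\<phi> x) e \<inter> half_plane"
  define S where "S = {s \<in> U. \<phi> s \<in> C}"
  have hp: "convex half_plane"
    unfolding half_plane_def by (auto simp: convex_def)
  have cC: "convex C" unfolding C_def by (intro convex_Int convex_ball hp)
  have oC: "openin (top_of_set half_plane) C" unfolding C_def by (simp add: openin_open_Int Int_commute)
  have CV: "C \<subseteq> V" using e homeomorphic_imp_surjective_map[OF hm] tU unfolding C_def by auto
  have xV: "\<phi> x \<in> C" unfolding C_def using e V U homeomorphic_imp_surjective_map[OF hm] tU openin_imp_subset
    by fastforce
  have oS: "openin (subtopology X U) S"
  proof -
    have "openin (top_of_set V) C" using oC CV V by (metis openin_subset_trans openin_imp_subset)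
    then have "openin (subtopology X U) {s \<in> topspace (subtopology X U). \<phi> s \<in> C}"
      using hm homeomorphic_imp_continuous_map openin_continuous_map_preimage by blast
    then show ?thesis unfolding S_def tU .
  qed
  then have oXS: "openin X S" using U by (simp add: openin_open_subtopology)
  have SW: "S \<subseteq> W"
  proof
    fix s assume s: "s \<in> S"
    then obtain w where "w \<in> U \<inter> W" "\<phi> s = \<phi> w" using e unfolding S_def C_def by blast
    moreover have "inj_on \<phi> U" using homeomorphic_imp_injective_map[OF hm] tU by simp
    ultimately show "s \<in> W" using s unfolding S_def by (metis (no_types, lifting) IntD1 IntD2 inj_onD mem_Collect_eq)
  qed
  have "homeomorphic_maps (subtopology (subtopology X U) S) (subtopology (top_of_set V) C) \<phi> \<psi>"
    apply (rule homeomorphic_maps_subtopologies[OF hom])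
    using CV homeomorphic_imp_surjective_map[OF hm] tU by (auto simp: S_def)
  moreover have "subtopology (subtopology X U) S = subtopology X S"
    by (simp add: subtopology_subtopology S_def Int_absorb1 Collect_conj_eq)
  moreover have "subtopology (top_of_set V) C = top_of_set C" using CV by (simp add: subtopology_subtopology Int_absorb1)
  ultimately show thesis using that[of S C \<phi> \<psi>] oXS SW cC oC xV U unfolding S_def by auto
qed

text \<open>A relatively open piece of the half-plane contains planar open sets, found by moving up
  from the boundary line. Later this pushes points off the lifts of the unstable arcs, which lie in
  \<open>surface_boundary X\<close>.\<close>

lemma surface_interior_dense:
  assumes X: "compact_surface X" and W: "openin X W" "W \<noteq> {}"
  shows "W \<inter> surface_interior X \<noteq> {}"
proof -
  obtain x where x: "x \<in> W" using W by blast
  obtain S C \<phi> \<psi> where S: "openin X S" "S \<subseteq> W" and oC: "openin (top_of_set half_plane) C"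
    and z: "C \<noteq> {}" and hom: "homeomorphic_maps (subtopology X S) (top_of_set C) \<phi> \<psi>"
    using surface_convex_chart[OF X W(1) x] by metis
  have tS: "topspace (subtopology X S) = S" using openin_subset[OF S(1)] by (simp add: Int_absorb1)
  obtain z where z: "z \<in> C" using z by blast
  obtain e where e: "e > 0" "ball z e \<inter> half_plane \<subseteq> C"
    using oC z by (metis openin_contains_ball)
  define V where "V = ball z e \<inter> {w :: real^2. 0 < w $ 2}"
  have VC: "V \<subseteq> C" using e by (auto simp: V_def half_plane_def)
  have oV: "open V" unfolding V_def by (intro open_Int open_ball open_halfspace_component_gt_cart)
  \<comment> \<open>Shifting \<open>z\<close> upwards by \<open>e/2\<close> stays in the ball and
    makes the second coordinate positive.\<close>
  have "axis 2 (e/2) = (e/2) *\<^sub>R (axis 2 1 :: real^2)" by (simp add: axis_def vec_eq_iff)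
  then have "norm (axis 2 (e/2) :: real^2) < e" using e by (simp add: norm_axis_1)
  then have "z + axis 2 (e/2) \<in> V"
    using e z openin_imp_subset[OF oC] by (auto simp: V_def half_plane_def dist_norm)
  then have Vne: "V \<noteq> {}" by blast
  have hm: "homeomorphic_map (top_of_set C) (subtopology X S) \<psi>"
    using hom homeomorphic_maps_map homeomorphic_maps_sym by blast
  have "openin (top_of_set C) V" using oV VC by (simp add: open_subset)
  then have "openin (subtopology X S) (\<psi> ` V)" using hm homeomorphic_map_openness_eq by blast
  then have o: "openin X (\<psi> ` V)" using S by (simp add: openin_open_subtopology)
  have VS: "\<psi> ` V \<subseteq> S" using VC homeomorphic_imp_surjective_map[OF hm] tS by auto
  have "homeomorphic_map (subtopology (top_of_set C) V) (subtopology (subtopology X S) (\<psi> ` V)) \<psi>"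
    by (rule homeomorphic_map_subtopologies[OF hm]) (use VC VS tS in auto)
  moreover have "subtopology (subtopology X S) (\<psi> ` V) = subtopology X (\<psi> ` V)"
    using VS by (simp add: subtopology_subtopology Int_absorb1)
  moreover have "subtopology (top_of_set C) V = top_of_set V"
    using VC by (simp add: subtopology_subtopology Int_absorb1)
  ultimately have "subtopology X (\<psi> ` V) homeomorphic_space top_of_set V"
    using homeomorphic_space homeomorphic_space_sym by metis
  then have "\<psi> ` V \<subseteq> surface_interior X"
    using o oV openin_subset[OF o] unfolding surface_interior_def by blast
  then show ?thesis using VS S Vne by blast
qed

lemma path_component_of_chart:
  fixes C :: "'c::real_normed_vector set"
  assumes C: "convex C" and hom: "homeomorphic_maps (subtopology X S) (top_of_set C) \<phi> \<psi>"
    and S: "S \<subseteq> topspace X" "x \<in> S" "y \<in> S"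
  shows "path_component_of (subtopology X S) x y"
proof -
  have tS: "topspace (subtopology X S) = S" using S by (simp add: Int_absorb1)
  have "\<phi> x \<in> C" "\<phi> y \<in> C" using hom S tS unfolding homeomorphic_maps_def continuous_map_def by auto
  then have "path_component C (\<phi> x) (\<phi> y)"
    using C convex_imp_path_connected path_connected_component by blast
  then obtain p where p: "path p" "p ` {0..1} \<subseteq> C" "p 0 = \<phi> x" "p 1 = \<phi> y"
    unfolding path_component_def path_image_def pathstart_def pathfinish_def by auto
  then have "pathin (top_of_set C) p" by (simp add: pathin_canon_iff image_subset_iff_funcset)
  then have "pathin (subtopology X S) (\<psi> \<circ> p)"
    using hom pathin_compose unfolding homeomorphic_maps_def by blast
  moreover have "\<psi> (\<phi> x) = x" "\<psi> (\<phi> y) = y" using hom S tS unfolding homeomorphic_maps_def by auto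
  ultimately show ?thesis unfolding path_component_of_def using p by (intro exI[of _ "\<psi> \<circ> p"]) auto
qed

lemma surface_locally_path_connected:
  assumes X: "compact_surface X" and W: "openin X W" "x \<in> W"
  obtains S where "openin X S" "x \<in> S" "S \<subseteq> W"
    "\<And>y z. y \<in> S \<Longrightarrow> z \<in> S \<Longrightarrow> path_component_of (subtopology X S) y z"
  using surface_convex_chart[OF X W] path_component_of_chart openin_subset by (metis (no_types, lifting))

text \<open>The straight-line homotopy in the convex model is carried back by \<open>\<psi>\<close>.
  For empty \<open>J\<close> the condition on \<open>Y\<close> is vacuous, so the homotopy may cross
  \<open>Y\<close>.\<close>

lemma homotopic_curves_chart:
  fixes C :: "'c::real_normed_vector set"
  assumes C: "convex C" and hom: "homeomorphic_maps (subtopology X S) (top_of_set C) \<phi> \<psi>"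
    and c: "pathin X c" "c ` {0..1} \<subseteq> S" and d: "pathin X d" "d ` {0..1} \<subseteq> S"
    and e: "c 0 = d 0" "c 1 = d 1"
  shows "homotopic_curves X Y {} c d"
proof -
  have cS: "pathin (subtopology X S) c" "pathin (subtopology X S) d"
    using c d by (auto simp: pathin_subtopology image_subset_iff)
  have co: "pathin (top_of_set C) (\<phi> \<circ> c)" "pathin (top_of_set C) (\<phi> \<circ> d)"
    using cS hom pathin_compose unfolding homeomorphic_maps_def by blast+
  then have pc: "path (\<phi> \<circ> c)" "path_image (\<phi> \<circ> c) \<subseteq> C" "path (\<phi> \<circ> d)" "path_image (\<phi> \<circ> d) \<subseteq> C"
    by (auto simp: pathin_canon_iff path_image_def)
  have "homotopic_paths C (\<phi> \<circ> c) (\<phi> \<circ> d)"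
  proof (rule homotopic_paths_linear[OF pc(1,3)])
    show "closed_segment ((\<phi> \<circ> c) t) ((\<phi> \<circ> d) t) \<subseteq> C" if "t \<in> {0..1}" for t
      using pc that C by (intro closed_segment_subset) (auto simp: path_image_def)
  qed (use pc e in \<open>auto simp: pathstart_def pathfinish_def\<close>)
  then have h1: "homotopic_with (\<lambda>h. h ` {} \<subseteq> Y \<and> h 0 = c 0 \<and> h 1 = c 1) (top_of_set {0..1}) X
      (\<psi> \<circ> (\<phi> \<circ> c)) (\<psi> \<circ> (\<phi> \<circ> d))"
    unfolding homotopic_paths_def
  proof (rule homotopic_with_compose_continuous_map_left)
    show "continuous_map (top_of_set C) X \<psi>"
      using hom unfolding homeomorphic_maps_def continuous_map_in_subtopology by blast
    show "(\<psi> \<circ> j) ` {} \<subseteq> Y \<and> (\<psi> \<circ> j) 0 = c 0 \<and> (\<psi> \<circ> j) 1 = c 1"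
      if "pathstart j = pathstart (\<phi> \<circ> c) \<and> pathfinish j = pathfinish (\<phi> \<circ> c)" for j
      using that cS hom path_start_in_topspace[OF cS(1)] path_finish_in_topspace[OF cS(1)]
      unfolding homeomorphic_maps_def pathstart_def pathfinish_def by simp
  qed
  \<comment> \<open>Going to the model and back reproduces the curves only on the unit interval,
    whence the two further homotopies between curves that agree there.\<close>
  have inv: "\<psi> (\<phi> (c t)) = c t \<and> \<psi> (\<phi> (d t)) = d t" if "t \<in> {0..1}" for t
    using that hom cS path_image_subset_topspace unfolding homeomorphic_maps_def by blast
  have "homotopic_with (\<lambda>h. h ` {} \<subseteq> Y \<and> h 0 = c 0 \<and> h 1 = c 1) (top_of_set {0..1}) X c (\<psi> \<circ> (\<phi> \<circ> c))"
    by (rule homotopic_with_equal) (use inv c in \<open>auto simp: pathin_def\<close>)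
  moreover have "homotopic_with (\<lambda>h. h ` {} \<subseteq> Y \<and> h 0 = c 0 \<and> h 1 = c 1) (top_of_set {0..1}) X d (\<psi> \<circ> (\<phi> \<circ> d))"
    by (rule homotopic_with_equal) (use inv d e in \<open>auto simp: pathin_def\<close>)
  ultimately show ?thesis unfolding homotopic_curves_def
    using h1 homotopic_with_trans homotopic_with_symD by blast
qed

text \<open>The cover is a star refinement of a finite cover by convex charts: \<open>T x\<close> is contained in every
  chart \<open>S i\<close> such that \<open>T x\<close> meets the closed set \<open>F i \<subseteq> S i\<close>.\<close>

lemma good_cover:
  fixes X :: "'b topology"
  assumes X: "compact_surface X"
  obtains \<T> where "\<And>x. x \<in> topspace X \<Longrightarrow> \<exists>T\<in>\<T>. openin X T \<and> x \<in> T"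
    "\<And>T1 T2 c d Y. T1 \<in> \<T> \<Longrightarrow> T2 \<in> \<T> \<Longrightarrow> pathin X c \<Longrightarrow> pathin X d \<Longrightarrow> c ` {0..1} \<subseteq> T1 \<Longrightarrow> d ` {0..1} \<subseteq> T2
      \<Longrightarrow> c 0 = d 0 \<Longrightarrow> c 1 = d 1 \<Longrightarrow> homotopic_curves X Y {} c d"
proof -
  define good where "good S \<longleftrightarrow> openin X S \<and> (\<exists>(C :: (real^2) set) \<phi> \<psi>. convex C \<and>
     homeomorphic_maps (subtopology X S) (top_of_set C) \<phi> \<psi>)" for S
  have "compact_space X" "Hausdorff_space X" using X by (auto simp: compact_surface_def)
  then have reg: "regular_space X" using compact_Hausdorff_or_regular_imp_normal_space
      by (meson compact_Hausdorff_imp_regular_space)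
  have "\<exists>O' S. openin X O' \<and> x \<in> O' \<and> good S \<and> X closure_of O' \<subseteq> S" if xX: "x \<in> topspace X" for x
  proof -
    obtain S where S: "good S" "x \<in> S"
    proof -
      obtain S and C :: "(real^2) set" and \<phi> \<psi> where "openin X S" "x \<in> S" "convex C"
        "homeomorphic_maps (subtopology X S) (top_of_set C) \<phi> \<psi>"
        using surface_convex_chart[OF X openin_topspace[of X] xX] by metis
      then show thesis using that[of S] unfolding good_def by blast
    qed
    have "neighbourhood_base_of (closedin X) X" using reg neighbourhood_base_of_closedin by blast
    then obtain U V where "openin X U" "closedin X V" "x \<in> U" "U \<subseteq> V" "V \<subseteq> S"
      using S unfolding good_def neighbourhood_base_of by meson
    then show ?thesis using S closure_of_minimal by (metis order_trans)
  qed
  then obtain O' S where OS: "\<And>x. x \<in> topspace X \<Longrightarrow> openin X (O' x) \<and> x \<in> O' x \<and> good (S x) \<and>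
      X closure_of (O' x) \<subseteq> S x" by metis
  obtain \<F> where F: "finite \<F>" "\<F> \<subseteq> O' ` topspace X" "topspace X \<subseteq> \<Union>\<F>"
    using \<open>compact_space X\<close> OS unfolding compact_space_alt
    by (smt (verit, best) UN_I imageE subsetI)
  then obtain I where I: "finite I" "I \<subseteq> topspace X" "topspace X \<subseteq> \<Union> (O' ` I)"
    by (metis finite_subset_image)
  define F where "F i = X closure_of (O' i)" for i
  \<comment> \<open>The factor \<open>topspace X\<close> keeps \<open>T x\<close> inside the space
    when no \<open>F i\<close> contains \<open>x\<close> and the intersection is
    \<open>UNIV\<close>.\<close>
  define T where "T x = topspace X \<inter> (\<Inter>i\<in>{i\<in>I. x \<in> F i}. S i) - (\<Union>i\<in>{i\<in>I. x \<notin> F i}. F i)" for x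
  have Fc: "closedin X (F i)" for i unfolding F_def by simp
  have FS: "F i \<subseteq> S i" if "i \<in> I" for i using OS I that unfolding F_def by blast
  have oT: "openin X (T x)" for x
  proof -
    have "openin X (topspace X \<inter> (\<Inter>i\<in>{i\<in>I. x \<in> F i}. S i))"
    proof (cases "{i\<in>I. x \<in> F i} = {}")
      case False
      then show ?thesis using I OS unfolding good_def by (intro openin_Int openin_INT2 openin_topspace) auto
    next
      case True
      then show ?thesis by (simp only: True) simp
    qed
    moreover have "closedin X (\<Union>i\<in>{i\<in>I. x \<notin> F i}. F i)"
      using I Fc by (intro closedin_Union) auto
    ultimately show ?thesis unfolding T_def by (rule openin_diff)
  qed
  have xT: "x \<in> T x" if "x \<in> topspace X" for x using that FS unfolding T_def by blast
  show thesis
  proof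
    show "\<exists>U\<in>range T. openin X U \<and> x \<in> U" if "x \<in> topspace X" for x
      using oT xT that by blast
    fix T1 T2 c d Y
    assume T: "T1 \<in> range T" "T2 \<in> range T" and cd: "pathin X c" "pathin X d"
      "c ` {0..1} \<subseteq> T1" "d ` {0..1} \<subseteq> T2" "c 0 = d 0" "c 1 = d 1"
    then obtain x y where xy: "T1 = T x" "T2 = T y" by blast
    have "c 0 \<in> topspace X" using cd path_start_in_topspace by metis
    \<comment> \<open>The curves start at the same point. A set \<open>F i\<close> containing it
      meets both \<open>T x\<close> and \<open>T y\<close>, so both curves run in the one chart
      \<open>S i\<close>.\<close>
    then obtain i where i: "i \<in> I" "c 0 \<in> F i" using I closure_of_subset OS openin_subset unfolding F_def
      by (smt (verit, ccfv_threshold) UN_E subset_iff)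
    have "c 0 \<in> T1" "d 0 \<in> T2" using cd(3,4) by auto
    then have c0: "c 0 \<in> T x" "c 0 \<in> T y" using cd(5) xy by auto
    then have "x \<in> F i" "y \<in> F i" using i unfolding T_def by auto
    then have "T x \<subseteq> S i" "T y \<subseteq> S i" using i unfolding T_def by auto
    then have sub: "c ` {0..1} \<subseteq> S i" "d ` {0..1} \<subseteq> S i" using cd xy by auto
    have "good (S i)" using OS i I by blast
    then show "homotopic_curves X Y {} c d"
      unfolding good_def using homotopic_curves_chart cd sub by metis
  qed
qed

section \<open>Relating families\<close>

text \<open>The homotopies fit together at 1/2 because each keeps its endpoints fixed.
  \<open>J1\<close> and \<open>J2\<close> are rescaled along with the curves, as transitivity of the
  Nielsen relation requires.\<close>

lemma homotopic_curves_join: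
  assumes h: "homotopic_curves X Y J1 b1 c1" "homotopic_curves X Y J2 b2 c2"
    and J: "J1 \<subseteq> {0..1}" "J2 \<subseteq> {0..1}" and e: "b1 1 = b2 0"
  defines "b \<equiv> \<lambda>t. if t \<le> 1/2 then b1 (2*t) else b2 (2*t - 1)"
    and "c \<equiv> \<lambda>t. if t \<le> 1/2 then c1 (2*t) else c2 (2*t - 1)"
  shows "homotopic_curves X Y ((\<lambda>t. t/2) ` J1 \<union> (\<lambda>t. (1+t)/2) ` J2) b c"
proof -
  define I where "I = {0..1::real}"
  obtain h1 where h1: "continuous_map (prod_topology (top_of_set I) (top_of_set I)) X h1"
    "\<And>x. h1 (0,x) = b1 x" "\<And>x. h1 (1,x) = c1 x"
    "\<And>t. t \<in> I \<Longrightarrow> (\<lambda>x. h1 (t,x)) ` J1 \<subseteq> Y \<and> h1 (t,0) = b1 0 \<and> h1 (t,1) = b1 1"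
    using h(1) unfolding homotopic_curves_def homotopic_with_def I_def by auto
  obtain h2 where h2: "continuous_map (prod_topology (top_of_set I) (top_of_set I)) X h2"
    "\<And>x. h2 (0,x) = b2 x" "\<And>x. h2 (1,x) = c2 x"
    "\<And>t. t \<in> I \<Longrightarrow> (\<lambda>x. h2 (t,x)) ` J2 \<subseteq> Y \<and> h2 (t,0) = b2 0 \<and> h2 (t,1) = b2 1"
    using h(2) unfolding homotopic_curves_def homotopic_with_def I_def by auto
  define k where "k = (\<lambda>z::real\<times>real. if snd z \<le> 1/2 then h1 (fst z, 2 * snd z) else h2 (fst z, 2 * snd z - 1))"
  have kc: "continuous_map (prod_topology (top_of_set I) (top_of_set I)) X k"
    unfolding k_def
  proof (rule continuous_map_cases_le)
    let ?P = "prod_topology (top_of_set I) (top_of_set I)"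
    show "continuous_map ?P euclideanreal snd" "continuous_map ?P euclideanreal (\<lambda>x. 1/2)"
      by (rule continuous_map_into_fulltopology[OF continuous_map_snd]) simp
    have "continuous_map (subtopology ?P {x \<in> topspace ?P. snd x \<le> 1/2}) ?P (\<lambda>z. (fst z, 2 * snd z))"
      by (auto simp: prod_topology_subtopology subtopology_subtopology I_def
           intro!: continuous_intros)
    from continuous_map_compose[OF this h1(1)]
    show "continuous_map (subtopology ?P {x \<in> topspace ?P. snd x \<le> 1/2}) X (\<lambda>z. h1 (fst z, 2 * snd z))"
      by (simp add: o_def)
    have "continuous_map (subtopology ?P {x \<in> topspace ?P. 1/2 \<le> snd x}) ?P (\<lambda>z. (fst z, 2 * snd z - 1))"
      by (auto simp: prod_topology_subtopology subtopology_subtopology I_def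
           intro!: continuous_intros)
    from continuous_map_compose[OF this h2(1)]
    show "continuous_map (subtopology ?P {x \<in> topspace ?P. 1/2 \<le> snd x}) X (\<lambda>z. h2 (fst z, 2 * snd z - 1))"
      by (simp add: o_def)
    show "h1 (fst z, 2 * snd z) = h2 (fst z, 2 * snd z - 1)" if z: "z \<in> topspace ?P" "snd z = 1/2" for z
    proof -
      have "2 * snd z = 1" "2 * snd z - 1 = 0" "fst z \<in> I" using z by auto
      then show ?thesis using h1(4) h2(4) e by simp
    qed
  qed
  show ?thesis
    unfolding homotopic_curves_def homotopic_with_def
  proof (intro exI conjI allI ballI)
    show "continuous_map (prod_topology (top_of_set {0..1}) (top_of_set {0..1})) X k"
      using kc unfolding I_def .
    show "k (0, x) = b x" "k (1, x) = c x" for x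
      unfolding k_def b_def c_def using h1 h2 by auto
    fix t :: real assume "t \<in> {0..1}"
    then have t: "t \<in> I" unfolding I_def .
    show "k (t, 0) = b 0" "k (t, 1) = b 1" unfolding k_def b_def using h1(4)[OF t] h2(4)[OF t] by auto
    have "k (t, s/2) \<in> Y" if "s \<in> J1" for s
      using that J h1(4)[OF t] unfolding k_def by auto
    moreover have "k (t, (1+s)/2) \<in> Y" if "s \<in> J2" for s
    \<comment> \<open>For \<open>s = 0\<close> the parameter is 1/2, where \<open>k\<close> is given
      by \<open>h1\<close>; its value there equals that of \<open>h2\<close> since
      \<open>b1 1 = b2 0\<close>.\<close>
    proof (cases "s = 0")
      case True
      then show ?thesis using that h1(4)[OF t] h2(4)[OF t] e unfolding k_def by auto
    next
      case False
      then have "\<not> (1+s)/2 \<le> 1/2" "2 * ((1+s)/2) - 1 = s" using that J by (auto simp: field_simps)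
      then show ?thesis using that h2(4)[OF t] unfolding k_def by auto
    qed
    ultimately show "(\<lambda>x. k (t, x)) ` ((\<lambda>t. t/2) ` J1 \<union> (\<lambda>t. (1+t)/2) ` J2) \<subseteq> Y" by auto
  qed
qed

lemma pathin_join:
  assumes "pathin X b1" "pathin X b2" "b1 1 = b2 0"
  shows "pathin X (\<lambda>t. if t \<le> 1/2 then b1 (2*t) else b2 (2*t - 1))"
  unfolding pathin_def
proof (rule continuous_map_cases_le)
  let ?I = "top_of_set {0..1::real}"
  show "continuous_map ?I euclideanreal (\<lambda>x. x)" "continuous_map ?I euclideanreal (\<lambda>x. 1/2)"
    by (auto simp: continuous_map_from_subtopology)
  have "continuous_map (subtopology ?I {x \<in> topspace ?I. x \<le> 1/2}) ?I (\<lambda>z. 2*z)"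
    by (auto simp: subtopology_subtopology intro!: continuous_intros)
  from continuous_map_compose[OF this assms(1)[unfolded pathin_def]]
  show "continuous_map (subtopology ?I {x \<in> topspace ?I. x \<le> 1/2}) X (\<lambda>z. b1 (2*z))"
    by (simp add: o_def)
  have "continuous_map (subtopology ?I {x \<in> topspace ?I. 1/2 \<le> x}) ?I (\<lambda>z. 2*z-1)"
    by (auto simp: subtopology_subtopology intro!: continuous_intros)
  from continuous_map_compose[OF this assms(2)[unfolded pathin_def]]
  show "continuous_map (subtopology ?I {x \<in> topspace ?I. 1/2 \<le> x}) X (\<lambda>z. b2 (2*z-1))"
    by (simp add: o_def)
  show "b1 (2*t) = b2 (2*t-1)" if "t = 1/2" for t :: real
  proof -
    have "2*t = 1" "2*t-1 = 0" using that by auto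
    then show ?thesis using assms(3) by (simp only:)
  qed
qed

text \<open>Concatenation at every index works because \<open>g\<close> commutes with it, and
  because the preimage of \<open>Y\<close> under each joined curve is the same union of rescaled
  sets.\<close>

lemma relating_family_trans:
  assumes a: "relating_family X Y g n x y J1 \<alpha>" and b: "relating_family X Y g n y z J2 \<beta>"
  shows "\<exists>J \<gamma>. relating_family X Y g n x z J \<gamma>"
proof -
  define \<gamma> where "\<gamma> j = (\<lambda>t::real. if t \<le> 1/2 then \<alpha> j (2*t) else \<beta> j (2*t - 1))" for j
  define J where "J = (\<lambda>t. t/2) ` J1 \<union> (\<lambda>t. (1+t)/2) ` J2"
  have J12: "J1 \<subseteq> {0..1}" "J2 \<subseteq> {0..1}" using a b unfolding relating_family_def by auto
  have "relating_family X Y g n x z J \<gamma>"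
    unfolding relating_family_def
  proof (intro conjI allI impI)
    show "J \<subseteq> {0..1}" using J12 unfolding J_def by force
    fix j assume j: "j < n"
    have A: "exact_map_of_pairs (top_of_set {0..1}) J1 X Y (\<alpha> j)" "\<alpha> j 0 = (g ^^ j) x" "\<alpha> j 1 = (g ^^ j) y"
      "homotopic_curves X Y J1 (g \<circ> \<alpha> j) (\<alpha> (Suc j mod n))"
      using a j unfolding relating_family_def by auto
    have B: "exact_map_of_pairs (top_of_set {0..1}) J2 X Y (\<beta> j)" "\<beta> j 0 = (g ^^ j) y" "\<beta> j 1 = (g ^^ j) z"
      "homotopic_curves X Y J2 (g \<circ> \<beta> j) (\<beta> (Suc j mod n))"
      using b j unfolding relating_family_def by auto
    show "\<gamma> j 0 = (g ^^ j) x" "\<gamma> j 1 = (g ^^ j) z" using A B unfolding \<gamma>_def by auto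
    have eq: "g \<circ> \<gamma> j = (\<lambda>t. if t \<le> 1/2 then (g \<circ> \<alpha> j) (2*t) else (g \<circ> \<beta> j) (2*t - 1))"
      unfolding \<gamma>_def by (auto simp: fun_eq_iff)
    show "homotopic_curves X Y J (g \<circ> \<gamma> j) (\<gamma> (Suc j mod n))"
      unfolding eq J_def unfolding \<gamma>_def
      by (rule homotopic_curves_join[OF A(4) B(4) J12]) (use A B in auto)
    have "pathin X (\<gamma> j)" unfolding \<gamma>_def
      by (rule pathin_join) (use A B in \<open>auto simp: exact_map_of_pairs_def map_of_pairs_def pathin_def\<close>)
    moreover have "\<gamma> j ` J \<subseteq> Y"
    proof -
      have aY: "\<alpha> j s \<in> Y" if "s \<in> J1" for s using that A unfolding exact_map_of_pairs_def map_of_pairs_def by auto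
      have bY: "\<beta> j s \<in> Y" if "s \<in> J2" for s using that B unfolding exact_map_of_pairs_def map_of_pairs_def by auto
      have "\<gamma> j (s/2) \<in> Y" if "s \<in> J1" for s
        using that J12 aY unfolding \<gamma>_def by auto
      moreover have "\<gamma> j ((1+s)/2) \<in> Y" if "s \<in> J2" for s
      proof (cases "s = 0")
        case True
        then show ?thesis using that bY[of 0] A(3) B(2) unfolding \<gamma>_def by auto
      next
        case False
        then have "\<not> (1+s)/2 \<le> 1/2" "2 * ((1+s)/2) - 1 = s" using that J12 by (auto simp: field_simps)
        then show ?thesis using that bY unfolding \<gamma>_def by auto
      qed
      ultimately show ?thesis unfolding J_def by auto
    qed
    moreover have "t \<in> J" if t: "t \<in> {0..1}" "\<gamma> j t \<in> Y" for t
    proof (cases "t \<le> 1/2")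
      case True
      then have "2*t \<in> J1" using t A unfolding exact_map_of_pairs_def \<gamma>_def by auto
      then show ?thesis unfolding J_def by (intro UnI1 image_eqI[of _ _ "2*t"]) auto
    next
      case False
      then have "2*t-1 \<in> J2" using t B unfolding exact_map_of_pairs_def \<gamma>_def by auto
      then show ?thesis unfolding J_def by (intro UnI2 image_eqI[of _ _ "2*t-1"]) auto
    qed
    ultimately show "exact_map_of_pairs (top_of_set {0..1}) J X Y (\<gamma> j)"
      unfolding exact_map_of_pairs_def map_of_pairs_def pathin_def by auto
  qed
  then show ?thesis by blast
qed

lemma funpow_in_topspace:
  assumes "continuous_map X X g" "x \<in> topspace X"
  shows "(g ^^ j) x \<in> topspace X"
  using assms by (induction j) (auto simp: continuous_map_def Pi_iff)

text \<open>Constant curves need one set \<open>J\<close> for all indices. As \<open>Y\<close> is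
  forward invariant and the orbit periodic, the orbit lies entirely in \<open>Y\<close> or entirely
  outside it, so \<open>J\<close> is the whole interval or empty. Reflexivity puts a representative
  into its own class.\<close>

lemma nielsen_relation_refl:
  assumes g: "map_of_pairs X Y X Y g" and x: "x \<in> Per X g n"
  shows "(x, x) \<in> nielsen_relation X Y g n"
proof -
  have gY: "(g ^^ j) y \<in> Y" if "y \<in> Y" for y j
    using that g by (induction j) (auto simp: map_of_pairs_def)
  have px: "(g ^^ n) x = x" and xt: "x \<in> topspace X" using x by (auto simp: Per_def)
  have gc: "continuous_map X X g" using g by (simp add: map_of_pairs_def)
  have iff: "(g ^^ j) x \<in> Y \<longleftrightarrow> x \<in> Y" if "j < n" for j
  proof
    assume "(g ^^ j) x \<in> Y"
    then have "(g ^^ (n - j)) ((g ^^ j) x) \<in> Y" by (rule gY)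
    also have "(g ^^ (n - j)) ((g ^^ j) x) = (g ^^ n) x"
      using that by (metis funpow_add le_add_diff_inverse2 less_imp_le o_apply)
    finally show "x \<in> Y" using px by simp
  qed (rule gY)
  define J where "J = (if x \<in> Y then {0..1::real} else {})"
  have "relating_family X Y g n x x J (\<lambda>j t. (g ^^ j) x)"
    unfolding relating_family_def
  proof (intro conjI allI impI)
    show "J \<subseteq> {0..1}" by (auto simp: J_def)
    fix j assume j: "j < n"
    have t: "(g ^^ i) x \<in> topspace X" for i using funpow_in_topspace[OF gc xt] .
    show "exact_map_of_pairs (top_of_set {0..1}) J X Y (\<lambda>t. (g ^^ j) x)"
      using iff[OF j] t unfolding exact_map_of_pairs_def map_of_pairs_def J_def by auto
    have "(g ^^ (Suc j mod n)) x = g ((g ^^ j) x)"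
      using px j by (cases "Suc j = n") auto
    moreover have "g ((g ^^ j) x) \<in> Y" if "x \<in> Y" using gY[OF that, of "Suc j"] by simp
    ultimately show "homotopic_curves X Y J (g \<circ> (\<lambda>t. (g ^^ j) x)) (\<lambda>t. (g ^^ (Suc j mod n)) x)"
      using t[of "Suc j"] unfolding homotopic_curves_def by (auto simp: o_def J_def)
  qed auto
  then show ?thesis using x unfolding nielsen_relation_def by blast
qed

text \<open>Transitivity gives one inclusion; relations in both directions identify the classes of
  two points.\<close>

lemma nielsen_class_subset:
  assumes "(x1, x2) \<in> nielsen_relation X Y g n"
  shows "nielsen_relation X Y g n `` {x2} \<subseteq> nielsen_relation X Y g n `` {x1}"
  using assms relating_family_trans unfolding nielsen_relation_def by fast

section \<open>Local sides of an arc\<close>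

text \<open>Janiszewski: two points separated neither by \<open>K1\<close> nor by \<open>K2\<close>
  are not separated by the union if the intersection is connected. The circle belongs to the union
  and confines the joining set to the ball.\<close>

lemma path_component_ball_Diff:
  fixes p :: complex
  assumes K: "compact K1" "closed K2" "connected (K1 \<inter> K2)" "sphere p e \<subseteq> K1 \<union> K2"
    and a: "a \<in> ball p e" and cc: "connected_component (- K1) a b" "connected_component (- K2) a b"
  shows "path_component (ball p e - (K1 \<union> K2)) a b"
proof -
  have "connected_component (- (K1 \<union> K2)) a b" by (rule Janiszewski[OF K(1-3) cc])
  then obtain C where C: "connected C" "C \<subseteq> - (K1 \<union> K2)" "a \<in> C" "b \<in> C"
    unfolding connected_component_def by blast
  have "C \<subseteq> ball p e"
  proof (rule ccontr)
    assume "\<not> C \<subseteq> ball p e"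
    then have "C \<inter> frontier (ball p e) \<noteq> {}" using C a by (intro connected_Int_frontier) auto
    moreover have "frontier (ball p e) = sphere p e"
      using a by (intro frontier_ball) (metis dist_not_less_zero less_le_trans linorder_not_le mem_ball order_le_less_trans zero_le_dist)
    ultimately show False using C K(4) by auto
  qed
  then have "connected_component (ball p e - (K1 \<union> K2)) a b"
    unfolding connected_component_def using C by blast
  moreover have "open (ball p e - (K1 \<union> K2))" using K compact_imp_closed by (intro open_Diff closed_Un) auto
  ultimately show ?thesis using open_path_connected_component by metis
qed

text \<open>The exit time is the infimum of the closed set of times spent at distance at least
  \<open>e\<close>; the earlier times give the opposite inequality in the limit.\<close>

lemma arc_first_exit:
  fixes \<gamma> :: "real \<Rightarrow> complex"
  assumes g: "continuous_on {u..v} \<gamma>" and uv: "u \<le> v" "\<gamma> u = p" "dist p (\<gamma> v) \<ge> e" "e > 0"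
  obtains t where "u < t" "t \<le> v" "dist p (\<gamma> t) = e" "\<And>s. u \<le> s \<Longrightarrow> s < t \<Longrightarrow> dist p (\<gamma> s) < e"
proof -
  define T where "T = {t \<in> {u..v}. dist p (\<gamma> t) \<ge> e}"
  have "closed T" unfolding T_def
    by (intro continuous_on_closed_Collect_le continuous_intros g)
  moreover have "T \<noteq> {}" "bdd_below T" using uv unfolding T_def by auto
  ultimately have inT: "Inf T \<in> T" by (simp add: closed_contains_Inf)
  define t where "t = Inf T"
  have lt: "dist p (\<gamma> s) < e" if "u \<le> s" "s < t" for s
  proof (rule ccontr)
    assume "\<not> dist p (\<gamma> s) < e"
    then have "s \<in> T" using that inT unfolding T_def t_def by auto
    then show False using that \<open>bdd_below T\<close> cInf_lower unfolding t_def by fastforce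
  qed
  have ut: "u < t" "t \<le> v" using inT uv unfolding t_def T_def by (auto simp: order.order_iff_strict)
  have "dist p (\<gamma> t) \<le> e"
  proof -
    have "continuous_on {u..t} (\<lambda>s. dist p (\<gamma> s))" using g ut by (intro continuous_intros continuous_on_subset[OF g]) auto
    moreover have "dist p (\<gamma> u) \<le> e" using uv by simp
    ultimately show ?thesis
      using ut lt continuous_le_on_closure[of "{u..<t}" "\<lambda>s. dist p (\<gamma> s)" t e] by (force intro: less_imp_le)
  qed
  then have "dist p (\<gamma> t) = e" using inT unfolding t_def T_def by auto
  then show thesis using that ut lt by blast
qed

text \<open>Cutting the arc where it first leaves the ball gives two pieces to which Janiszewski's theorem
  applies; the piece outside cannot separate points close to \<open>p\<close>.\<close>

lemma arc_end_local_side: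
  fixes \<gamma> :: "real \<Rightarrow> complex"
  assumes g: "arc \<gamma>" and p: "\<gamma> 0 = p" and e: "e > 0"
  obtains d where "d > 0" "\<And>a b. a \<in> ball p d - path_image \<gamma> \<Longrightarrow> b \<in> ball p d - path_image \<gamma> \<Longrightarrow>
      path_component (ball p e - path_image \<gamma>) a b"
proof -
  have inj: "inj_on \<gamma> {0..1}" and cont: "continuous_on {0..1} \<gamma>" using g by (auto simp: arc_def path_def)
  have "\<gamma> 1 \<noteq> p" using inj p by (metis atLeastAtMost_iff inj_onD order_refl zero_le_one zero_neq_one)
  \<comment> \<open>The far end of the arc must not lie inside the ball, so that there is an
    exit.\<close>
  define r where "r = min e (dist p (\<gamma> 1))"
  have r: "r > 0" "r \<le> e" using e \<open>\<gamma> 1 \<noteq> p\<close> by (auto simp: r_def)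
  obtain t where t: "0 < t" "t \<le> 1" "dist p (\<gamma> t) = r" "\<And>s. 0 \<le> s \<Longrightarrow> s < t \<Longrightarrow> dist p (\<gamma> s) < r"
    using arc_first_exit[OF cont _ p, of r] r unfolding r_def by auto
  define K1 where "K1 = \<gamma> ` {0..t}"
  define K2 where "K2 = sphere p r \<union> \<gamma> ` {t..1}"
  have g01: "path_image \<gamma> = \<gamma> ` {0..t} \<union> \<gamma> ` {t..1}" unfolding path_image_def using t
    by (metis image_Un ivl_disj_un_two_touch(4) less_eq_real_def)
  have comp: "compact (\<gamma> ` {0..t})" "compact (\<gamma> ` {t..1})"
    using t by (intro compact_continuous_image continuous_on_subset[OF cont]; auto)+
  have "p \<notin> \<gamma> ` {t..1}" using inj t p by (auto simp: inj_on_def) (metis atLeastAtMost_iff less_eq_real_def less_le_not_le order_trans zero_le_one)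
  then obtain d0 where d0: "d0 > 0" "ball p d0 \<inter> \<gamma> ` {t..1} = {}"
    using compact_imp_closed[OF comp(2)]
    by (metis Compl_iff disjoint_eq_subset_Compl inf_commute open_Compl open_contains_ball)
  define d where "d = min d0 r"
  have d: "d > 0" "ball p d \<inter> K2 = {}" using d0 r by (auto simp: d_def K2_def)
  \<comment> \<open>Before the exit the arc stays strictly inside the circle, and by injectivity it
    misses its own later part. A single common point is connected.\<close>
  have int: "K1 \<inter> K2 = {\<gamma> t}"
  proof
    have "s = t" if sK: "s \<in> {0..t}" "\<gamma> s \<in> K2" for s
    proof (rule ccontr)
      assume "s \<noteq> t"
      then have "dist p (\<gamma> s) < r" using t sK by auto
      then obtain s' where "s' \<in> {t..1}" "\<gamma> s = \<gamma> s'" using sK unfolding K2_def by auto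
      then have "s = s'" using inj t sK by (auto simp: inj_on_def)
      then show False using \<open>s' \<in> {t..1}\<close> \<open>s \<noteq> t\<close> sK by auto
    qed
    then show "K1 \<inter> K2 \<subseteq> {\<gamma> t}" unfolding K1_def by blast
    show "{\<gamma> t} \<subseteq> K1 \<inter> K2" using t unfolding K1_def K2_def by auto
  qed
  have arcK1: "arc (subpath 0 t \<gamma>)" "path_image (subpath 0 t \<gamma>) = K1"
    using g t by (auto intro!: arc_subpath_arc simp: path_image_subpath K1_def)
  have "path_component (ball p e - path_image \<gamma>) a b"
    if ab: "a \<in> ball p d - path_image \<gamma>" "b \<in> ball p d - path_image \<gamma>" for a b
  proof -
    \<comment> \<open>An arc does not separate the plane.\<close>
    have "connected (- K1)" using connected_arc_complement[OF arcK1(1)] arcK1(2) by simp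
    moreover have "a \<in> - K1" "b \<in> - K1" using ab g01 K1_def by auto
    ultimately have c1: "connected_component (- K1) a b" unfolding connected_component_def by blast
    have c2: "connected_component (- K2) a b" unfolding connected_component_def
      by (rule exI[of _ "ball p d"]) (use d ab in auto)
    have "path_component (ball p r - (K1 \<union> K2)) a b"
      using comp ab int c1 c2 by (intro path_component_ball_Diff) (auto simp: K1_def K2_def d_def intro!: compact_imp_closed)
    then show ?thesis
      by (rule path_component_of_subset[rotated]) (use r in \<open>auto simp: g01 K1_def K2_def\<close>)
  qed
  then show thesis using that d by blast
qed

text \<open>The part of the arc between the last entry into the ball and the first exit is a crosscut. Together
  with the circle it forms a theta curve, whose two inner domains are the two sides.\<close>

lemma arc_interior_local_sides:
  fixes \<gamma> :: "real \<Rightarrow> complex"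
  assumes g: "arc \<gamma>" and p: "\<gamma> t0 = p" "0 < t0" "t0 < 1" and e: "e > 0"
  obtains d L where "d > 0" "\<And>a b. a \<in> ball p d - path_image \<gamma> \<Longrightarrow> b \<in> ball p d - path_image \<gamma> \<Longrightarrow>
      L a = (L b :: bool) \<Longrightarrow> path_component (ball p e - path_image \<gamma>) a b"
proof -
  have inj: "inj_on \<gamma> {0..1}" and cont: "continuous_on {0..1} \<gamma>" using g by (auto simp: arc_def path_def)
  have inj': "\<gamma> s = \<gamma> s' \<longleftrightarrow> s = s'" if "0 \<le> s" "s \<le> 1" "0 \<le> s'" "s' \<le> 1" for s s'
    using inj that by (auto simp: inj_on_def)
  have ne: "\<gamma> 1 \<noteq> p" "\<gamma> 0 \<noteq> p" using inj' p by auto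
  define r where "r = min e (min (dist p (\<gamma> 0)) (dist p (\<gamma> 1)))"
  have r: "r > 0" "r \<le> e" "r \<le> dist p (\<gamma> 0)" "r \<le> dist p (\<gamma> 1)" using e ne by (auto simp: r_def)
  obtain v where v: "t0 < v" "v \<le> 1" "dist p (\<gamma> v) = r" "\<And>s. t0 \<le> s \<Longrightarrow> s < v \<Longrightarrow> dist p (\<gamma> s) < r"
    using arc_first_exit[of t0 1 \<gamma> p r] continuous_on_subset[OF cont, of "{t0..1}"] p r by auto
  \<comment> \<open>The last entry before \<open>t0\<close> is the first exit of the reversed
    arc.\<close>
  have "continuous_on {1-t0..1} (\<lambda>s. \<gamma> (1-s))"
    using p by (intro continuous_on_compose2[OF cont] continuous_intros) auto
  then obtain u' where u': "1-t0 < u'" "u' \<le> 1" "dist p (\<gamma> (1-u')) = r"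
      "\<And>s. 1-t0 \<le> s \<Longrightarrow> s < u' \<Longrightarrow> dist p (\<gamma> (1-s)) < r"
    using arc_first_exit[of "1-t0" 1 "\<lambda>s. \<gamma> (1-s)" p r] p r by auto
  define u where "u = 1 - u'"
  have u: "u < t0" "0 \<le> u" "dist p (\<gamma> u) = r" using u' unfolding u_def by auto
  have in': "dist p (\<gamma> s) < r" if "u < s" "s < v" for s
    using v(4)[of s] u'(4)[of "1-s"] that unfolding u_def by (cases "t0 \<le> s") auto
  define c where "c = subpath u v \<gamma>"
  define C where "C = \<gamma> ` {u..v}"
  define K1 where "K1 = C \<union> sphere p r"
  define D where "D = \<gamma> ` {0..u} \<union> \<gamma> ` {v..1}"
  define K2 where "K2 = sphere p r \<union> D"
  have arcc: "arc c" "path_image c = C" "pathstart c = \<gamma> u" "pathfinish c = \<gamma> v"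
    using g u v by (auto intro!: arc_subpath_arc simp: path_image_subpath C_def c_def)
  have g01: "path_image \<gamma> = C \<union> D"
  proof -
    have "{0..1} = {0..u} \<union> {u..v} \<union> {v..1::real}" using u v by auto
    then show ?thesis unfolding path_image_def C_def D_def by (metis image_Un sup_assoc sup_commute)
  qed
  have compD: "compact D" unfolding D_def
    using u v by (intro compact_Un compact_continuous_image continuous_on_subset[OF cont]; auto)
  have compC: "compact C" unfolding C_def
    using u v by (intro compact_continuous_image continuous_on_subset[OF cont]; auto)
  have "p \<notin> D" using inj' u v p unfolding D_def by fastforce
  then obtain d0 where d0: "d0 > 0" "ball p d0 \<inter> D = {}"
    using compact_imp_closed[OF compD]
    by (metis Compl_iff disjoint_eq_subset_Compl inf_commute open_Compl open_contains_ball)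
  define d where "d = min d0 r"
  have d: "d > 0" "ball p d \<inter> K2 = {}" using d0 r by (auto simp: d_def K2_def)
  have CD: "C \<inter> D \<subseteq> sphere p r"
  proof
    fix x assume "x \<in> C \<inter> D"
    then have "x \<in> C" "x \<in> D" by auto
    then obtain s s' where "x = \<gamma> s" "x = \<gamma> s'" "s \<in> {u..v}" "s' \<in> {0..u} \<union> {v..1}"
      unfolding C_def D_def by blast
    then have "s = u \<or> s = v" using inj' u v by auto
    then show "x \<in> sphere p r" using \<open>x = \<gamma> s\<close> u v by auto
  qed
  \<comment> \<open>With the circle in both sets their intersection is exactly the circle, which is
    connected: the outer pieces of the arc meet the crosscut only there.\<close>
  have int: "K1 \<inter> K2 = sphere p r" using CD unfolding K1_def K2_def by blast
  have Csph: "C \<inter> sphere p r = {\<gamma> u, \<gamma> v}"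
  proof -
    have "s = u \<or> s = v" if "s \<in> {u..v}" "dist p (\<gamma> s) = r" for s
      using in'[of s] that by fastforce
    then have "C \<inter> sphere p r \<subseteq> {\<gamma> u, \<gamma> v}" unfolding C_def by force
    then show ?thesis unfolding C_def using u v by auto
  qed
  have uv: "\<gamma> u \<noteq> \<gamma> v" using inj'[of u v] u v by auto
  \<comment> \<open>The ends of the crosscut divide the circle into the two outer arcs of the theta
    curve.\<close>
  obtain k1 k2 where k: "arc k1" "arc k2" "pathstart k1 = \<gamma> u" "pathfinish k1 = \<gamma> v"
      "pathstart k2 = \<gamma> v" "pathfinish k2 = \<gamma> u" "path_image k1 \<inter> path_image k2 = {\<gamma> u, \<gamma> v}"
      "path_image k1 \<union> path_image k2 = path_image (circlepath p r)"
  proof (rule exists_double_arc)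
    show "simple_path (circlepath p r)" using r by (simp add: simple_path_circlepath)
    show "\<gamma> u \<in> path_image (circlepath p r)" "\<gamma> v \<in> path_image (circlepath p r)" using u v r by auto
  qed (use uv in auto)
  have pk: "path_image k1 \<union> path_image k2 = sphere p r" using k r by simp
  have ins: "inside (sphere p r) = ball p r"
    using inside_frontier_eq_interior[of "cball p r"] by simp
  define Q1 where "Q1 = inside (path_image k1 \<union> C)"
  define Q2 where "Q2 = inside (path_image k2 \<union> C)"
  have Q: "Q1 \<union> Q2 \<union> (C - {\<gamma> u, \<gamma> v}) = ball p r"
  proof (rule split_inside_simple_closed_curve[of k1 "\<gamma> u" "\<gamma> v" "reversepath k2" c])
    show "path_image c \<inter> inside (path_image k1 \<union> path_image (reversepath k2)) \<noteq> {}"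
    proof -
      have "p \<in> C" unfolding C_def using p u v by auto
      then show ?thesis using pk ins r arcc by auto
    qed
  next
    assume "inside (path_image k1 \<union> path_image c) \<union> inside (path_image (reversepath k2) \<union> path_image c)
      \<union> (path_image c - {\<gamma> u, \<gamma> v}) = inside (path_image k1 \<union> path_image (reversepath k2))"
    then show ?thesis unfolding Q1_def Q2_def using arcc pk ins by simp
  qed (use k arcc uv Csph pk arc_imp_simple_path[OF arc_reversepath[OF k(2)]] in \<open>auto simp: arc_imp_simple_path\<close>)
  \<comment> \<open>Each circle arc, closed up by the crosscut, is a Jordan curve, so its inside is
    connected.\<close>
  have sides: "connected (inside (path_image k \<union> C)) \<and> inside (path_image k \<union> C) \<inter> C = {}"
    if "k = k1 \<or> k = reversepath k2" for k
  proof -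
    have kk: "arc k" "pathstart k = \<gamma> u" "pathfinish k = \<gamma> v" "path_image k \<subseteq> sphere p r"
      using that k arc_reversepath[OF k(2)] pk by auto
    have "simple_path (k +++ reversepath c)"
      using kk arcc Csph arc_reversepath[OF arcc(1)] by (intro simple_path_join_loop) auto
    moreover have "path_image (k +++ reversepath c) = path_image k \<union> C"
      using kk arcc by (simp add: path_image_join)
    ultimately have "connected (inside (path_image k \<union> C))"
      using Jordan_inside_outside[of "k +++ reversepath c"] kk arcc by simp
    then show ?thesis using inside_no_overlap[of "path_image k \<union> C"] by blast
  qed
  have Qp: "connected Q1" "connected Q2" "Q1 \<subseteq> - K1" "Q2 \<subseteq> - K1"
  proof -
    have "Q1 \<inter> sphere p r = {}" "Q2 \<inter> sphere p r = {}" using Q by (force simp: dist_norm)+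
    then show "connected Q1" "connected Q2" "Q1 \<subseteq> - K1" "Q2 \<subseteq> - K1"
      using sides[of k1] sides[of "reversepath k2"] unfolding Q1_def Q2_def K1_def by auto
  qed
  have "path_component (ball p e - path_image \<gamma>) a b"
    if ab: "a \<in> ball p d - path_image \<gamma>" "b \<in> ball p d - path_image \<gamma>" and L: "(a \<in> Q1) = (b \<in> Q1)" for a b
  proof -
    have "a \<in> ball p r - C" "b \<in> ball p r - C" using ab g01 unfolding d_def by auto
    then have "a \<in> Q1 \<union> Q2" "b \<in> Q1 \<union> Q2" using Q by blast+
    then have c1: "connected_component (- K1) a b"
      using L Qp unfolding connected_component_def by blast
    have c2: "connected_component (- K2) a b" unfolding connected_component_def
      by (rule exI[of _ "ball p d"]) (use d ab in auto)
    have "path_component (ball p r - (K1 \<union> K2)) a b"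
    proof (rule path_component_ball_Diff)
      show "connected (K1 \<inter> K2)" unfolding int by (rule connected_sphere) simp
    qed (use compC compD ab c1 c2 in \<open>auto simp: K1_def K2_def d_def intro!: compact_Un compact_imp_closed\<close>)
    then show ?thesis
      by (rule path_component_of_subset[rotated]) (use r in \<open>auto simp: g01 K1_def K2_def\<close>)
  qed
  \<comment> \<open>Points near \<open>p\<close> and off the arc lie in \<open>Q1\<close> or
    \<open>Q2\<close>, so membership in \<open>Q1\<close> tells the sides apart.\<close>
  then show thesis using that[of d "\<lambda>a. a \<in> Q1"] d by blast
qed

text \<open>At an end of the arc there is only one side, so a constant label serves; the end at
  parameter 1 becomes the end at 0 by reversing the arc.\<close>

lemma arc_local_sides:
  fixes \<gamma> :: "real \<Rightarrow> complex"
  assumes g: "arc \<gamma>" and p: "p \<in> path_image \<gamma>" and e: "e > 0"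
  obtains d L where "d > 0" "\<And>a b. a \<in> ball p d - path_image \<gamma> \<Longrightarrow> b \<in> ball p d - path_image \<gamma> \<Longrightarrow>
      L a = (L b :: bool) \<Longrightarrow> path_component (ball p e - path_image \<gamma>) a b"
proof -
  obtain t where t: "\<gamma> t = p" "0 \<le> t" "t \<le> 1" using p unfolding path_image_def by auto
  consider "t = 0" | "t = 1" | "0 < t" "t < 1" using t by fastforce
  then show thesis
  proof cases
    case 1
    then show ?thesis using arc_end_local_side[OF g _ e] t that[of _ "\<lambda>_. True"] by metis
  next
    case 2
    have "reversepath \<gamma> 0 = p" using 2 t by (simp add: reversepath_def)
    then show ?thesis
      using arc_end_local_side[of "reversepath \<gamma>", OF _ _ e] g t that[of _ "\<lambda>_. True"]
      by (metis arc_reversepath path_image_reversepath)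
  next
    case 3
    then show ?thesis using arc_interior_local_sides[OF g t(1) _ _ e] that by blast
  qed
qed

section \<open>Local sides of embedded branches in a surface\<close>

definition complex_of_vec :: "real^2 \<Rightarrow> complex" where
  "complex_of_vec z = Complex (z $ 1) (z $ 2)"

definition vec_of_complex :: "complex \<Rightarrow> real^2" where
  "vec_of_complex w = vector [Re w, Im w]"

text \<open>Charts take values in \<open>real^2\<close>, whereas the separation results behind
  \<open>arc_local_sides\<close> concern arcs in \<open>complex\<close>.\<close>

lemma homeomorphic_maps_complex_of_vec:
  "homeomorphic_maps euclidean euclidean complex_of_vec vec_of_complex"
proof -
  have "continuous_on UNIV complex_of_vec" unfolding complex_of_vec_def by (intro continuous_intros)
  moreover have "continuous_on UNIV vec_of_complex"
    by (rule iffD2[OF continuous_on_componentwise])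
       (auto simp: vec_of_complex_def Basis_vec_def inner_axis forall_2 intro!: continuous_intros)
  ultimately show ?thesis
    by (auto simp: homeomorphic_maps_def complex_of_vec_def vec_of_complex_def vec_eq_iff forall_2 vector_2)
qed

lemma surface_interior_complex_chart:
  assumes y: "y \<in> surface_interior M" and W: "openin M W" "y \<in> W"
  obtains S e H K where "openin M S" "y \<in> S" "S \<subseteq> W" "e > (0::real)"
    "homeomorphic_maps (subtopology M S) (top_of_set (ball (H y :: complex) e)) H K"
proof -
  obtain U V where U: "openin M U" "y \<in> U" and V: "open (V :: (real^2) set)"
    and h: "subtopology M U homeomorphic_space top_of_set V"
    using y unfolding surface_interior_def by blast
  then obtain h k where hk: "homeomorphic_maps (subtopology M U) (top_of_set V) h k"
    unfolding homeomorphic_space_def by blast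
  define H where "H = complex_of_vec \<circ> h"
  define K where "K = k \<circ> vec_of_complex"
  have hm0: "homeomorphic_map euclidean euclidean complex_of_vec"
    using homeomorphic_maps_complex_of_vec homeomorphic_maps_map by blast
  have oV: "open (complex_of_vec ` V)"
    using hm0 V homeomorphic_map_openness_eq by (metis open_openin)
  have hom: "homeomorphic_maps (subtopology M U) (top_of_set (complex_of_vec ` V)) H K"
    unfolding H_def K_def
    by (rule homeomorphic_maps_compose[OF conjI[OF hk homeomorphic_maps_subtopologies[OF homeomorphic_maps_complex_of_vec]]]) auto
  have tU: "topspace (subtopology M U) = U" using openin_subset[OF U(1)] by (simp add: Int_absorb1)
  have hm: "homeomorphic_map (subtopology M U) (top_of_set (complex_of_vec ` V)) H"
    using hom homeomorphic_maps_map by blast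
  have "openin (subtopology M U) (U \<inter> W)"
    using W U by (simp add: openin_open_subtopology openin_Int)
  then have "openin (top_of_set (complex_of_vec ` V)) (H ` (U \<inter> W))"
    using homeomorphic_map_openness_eq[OF hm] by blast
  then have "open (H ` (U \<inter> W))" using oV openin_open_eq by blast
  moreover have "H y \<in> H ` (U \<inter> W)" using U W by blast
  ultimately obtain e where e: "e > 0" "ball (H y) e \<subseteq> H ` (U \<inter> W)"
    by (metis open_contains_ball)
  define S where "S = {s \<in> U. H s \<in> ball (H y) e}"
  have sur: "H ` U = complex_of_vec ` V" using homeomorphic_imp_surjective_map[OF hm] tU by simp
  have bV: "ball (H y) e \<subseteq> complex_of_vec ` V" using e(2) sur by blast
  have oS: "openin (subtopology M U) S"
  proof -
    have "openin (top_of_set (complex_of_vec ` V)) (ball (H y) e)" using bV by (intro open_subset) auto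
    then have "openin (subtopology M U) {s \<in> topspace (subtopology M U). H s \<in> ball (H y) e}"
      using hm homeomorphic_imp_continuous_map openin_continuous_map_preimage by blast
    then show ?thesis unfolding S_def tU .
  qed
  then have oXS: "openin M S" using U by (simp add: openin_open_subtopology)
  have SW: "S \<subseteq> W"
  proof
    fix s assume s: "s \<in> S"
    then obtain w where "w \<in> U \<inter> W" "H s = H w" using e unfolding S_def by blast
    moreover have "inj_on H U" using homeomorphic_imp_injective_map[OF hm] tU by simp
    ultimately show "s \<in> W" using s unfolding S_def by (metis (no_types, lifting) IntD1 IntD2 inj_onD mem_Collect_eq)
  qed
  have "homeomorphic_maps (subtopology (subtopology M U) S) (subtopology (top_of_set (complex_of_vec ` V)) (ball (H y) e)) H K"
  proof (rule homeomorphic_maps_subtopologies[OF hom])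
    have "H ` (U \<inter> S) = H ` U \<inter> ball (H y) e" unfolding S_def by blast
    then show "H ` (topspace (subtopology M U) \<inter> S) = topspace (top_of_set (complex_of_vec ` V)) \<inter> ball (H y) e"
      using sur tU by simp
  qed
  moreover have "subtopology (subtopology M U) S = subtopology M S"
    by (simp add: subtopology_subtopology S_def Int_absorb1 Collect_conj_eq)
  moreover have "subtopology (top_of_set (complex_of_vec ` V)) (ball (H y) e) = top_of_set (ball (H y) e)"
    using bV by (simp add: subtopology_subtopology Int_absorb1)
  ultimately show thesis using that[of S e H K] oXS SW e U unfolding S_def by auto
qed

text \<open>Near \<open>y\<close> the set \<open>B\<close> is a single arc, since the rest of the
  branches is the image of a compact set missing \<open>y\<close> and can be removed. In a planar
  chart the claim becomes \<open>arc_local_sides\<close>.\<close>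

lemma embedded_branches_local_sides:
  assumes M: "Hausdorff_space M" and P: "finite P" and B: "embedded_branches M P B" "B \<subseteq> surface_interior M"
    and y: "y \<in> B" and W: "openin M W" "y \<in> W"
  obtains W' L where "openin M W'" "y \<in> W'" "W' \<subseteq> W"
    "\<And>z z'. z \<in> W' - B \<Longrightarrow> z' \<in> W' - B \<Longrightarrow> L z = (L z' :: bool) \<Longrightarrow>
       path_component_of (subtopology M (W - B)) z z'"
proof -
  let ?PI = "prod_topology (discrete_topology P) (top_of_set {0..1::real})"
  obtain \<phi> where emb: "embedding_map ?PI M \<phi>" and im: "\<phi> ` (P \<times> {0..1}) = B"
    using B unfolding embedded_branches_def by blast
  have inj: "inj_on \<phi> (P \<times> {0..1})" and con: "continuous_map ?PI M \<phi>"
    using emb unfolding embedding_map_def homeomorphic_eq_everything_map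
    by (auto simp: continuous_map_in_subtopology)
  have cl: "closed_map ?PI M \<phi>"
    using con M P by (intro continuous_imp_closed_map)
      (auto simp: compact_space_prod_topology compact_space_discrete_topology compact_space_subtopology)
  obtain p t where pt: "p \<in> P" "t \<in> {0..1}" "y = \<phi> (p,t)" using y im by auto
  obtain S e H K where S: "openin M S" "y \<in> S" "S \<subseteq> W" and e: "e > (0::real)"
    and hom: "homeomorphic_maps (subtopology M S) (top_of_set (ball (H y :: complex) e)) H K"
    using surface_interior_complex_chart[OF _ W] y B by blast
  have tS: "topspace (subtopology M S) = S" using openin_subset[OF S(1)] by (simp add: Int_absorb1)
  have hm: "homeomorphic_map (subtopology M S) (top_of_set (ball (H y) e)) H" using hom homeomorphic_maps_map by blast
  have pa: "continuous_map (top_of_set {0..1}) M (\<lambda>s. \<phi> (p,s))"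
    using continuous_map_compose[OF _ con, of "top_of_set {0..1}" "\<lambda>s. (p,s)"] pt
    by (simp add: o_def continuous_map_pairwise continuous_map_from_subtopology)
  have "openin (top_of_set {0..1}) {s \<in> {0..1}. \<phi> (p,s) \<in> S}"
    using openin_continuous_map_preimage[OF pa S(1)] by simp
  then have "\<forall>s\<in>{s \<in> {0..1}. \<phi> (p,s) \<in> S}. \<exists>\<delta>>0. ball s \<delta> \<inter> {0..1} \<subseteq> {s \<in> {0..1}. \<phi> (p,s) \<in> S}"
    by (simp add: openin_contains_ball)
  moreover have "t \<in> {s \<in> {0..1}. \<phi> (p,s) \<in> S}" using pt S by simp
  ultimately obtain \<delta> where \<delta>: "\<delta> > 0" "ball t \<delta> \<inter> {0..1} \<subseteq> {s \<in> {0..1}. \<phi> (p,s) \<in> S}"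
    by blast
  \<comment> \<open>A closed window of half-width \<delta>/2 around \<open>t\<close>, truncated at 0
    and 1. At an end of the branch it is one-sided but still nondegenerate.\<close>
  define u where "u = max 0 (t - \<delta>/2)"
  define v where "v = min 1 (t + \<delta>/2)"
  have uv: "u < v" "0 \<le> u" "v \<le> 1" "u \<le> t" "t \<le> v" using pt(2) \<delta>(1) unfolding u_def v_def by auto
  have uvS: "\<phi> (p,s) \<in> S" if "s \<in> {u..v}" for s
  proof -
    have "\<bar>t - s\<bar> < \<delta>" "s \<in> {0..1}" using that \<delta>(1) uv(2,3) unfolding u_def v_def by auto
    then have "s \<in> ball t \<delta> \<inter> {0..1}" by (simp add: dist_real_def)
    then show ?thesis using \<delta>(2) by blast
  qed
  have nb: "s \<in> {u..v}" if "s \<in> {0..1} \<inter> ball t (\<delta>/2)" for s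
  proof -
    have "\<bar>t - s\<bar> < \<delta>/2" "0 \<le> s" "s \<le> 1" using that by (auto simp: dist_real_def)
    then show ?thesis
      unfolding u_def v_def atLeastAtMost_iff max.bounded_iff min.bounded_iff by linarith
  qed
  \<comment> \<open>All of \<open>B\<close> except the part parametrised close to \<open>t\<close>;
    it is closed because there are finitely many compact branches.\<close>
  define B0 where "B0 = \<phi> ` (P \<times> {0..1} - {p} \<times> ({0..1} \<inter> ball t (\<delta>/2)))"
  have "closedin ?PI (P \<times> {0..1} - {p} \<times> ({0..1} \<inter> ball t (\<delta>/2)))"
  proof -
    have "openin ?PI ({p} \<times> ({0..1} \<inter> ball t (\<delta>/2)))"
      using pt by (simp add: openin_prod_Times_iff openin_open_Int)
    moreover have "closedin ?PI (P \<times> {0..1})" using closedin_topspace[of ?PI] by simp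
    ultimately show ?thesis by (rule closedin_diff[rotated])
  qed
  then have B0: "closedin M B0" using cl unfolding closed_map_def B0_def by blast
  have yB0: "y \<notin> B0"
  proof
    assume "y \<in> B0"
    then obtain z where z0: "y = \<phi> z" "z \<in> P \<times> {0..1} - {p} \<times> ({0..1} \<inter> ball t (\<delta>/2))"
      unfolding B0_def by (rule imageE)
    have z: "z \<in> P \<times> {0..1} - {p} \<times> ({0..1} \<inter> ball t (\<delta>/2))" "\<phi> z = \<phi> (p,t)"
      using z0 pt(3) by simp_all
    then have "z = (p,t)" using inj_onD[OF inj z(2)] pt by blast
    then show False using z(1) pt(2) \<delta>(1) by auto
  qed
  define S1 where "S1 = S - B0"
  have S1: "openin M S1" "y \<in> S1" "S1 \<subseteq> S" using S B0 yB0 by (auto simp: S1_def openin_diff)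
  have BS1: "b \<in> (\<lambda>s. \<phi> (p,s)) ` {u..v}" if "b \<in> B" "b \<in> S1" for b
  proof -
    obtain p' s where "p' \<in> P" "s \<in> {0..1}" "b = \<phi> (p',s)" using \<open>b \<in> B\<close> im by auto
    then show ?thesis using \<open>b \<in> S1\<close> nb[of s] unfolding S1_def B0_def by auto
  qed
  define \<gamma> where "\<gamma> = (\<lambda>s. H (\<phi> (p, u + s * (v-u))))"
  have rng: "u + s * (v-u) \<in> {u..v}" if "s \<in> {0..1}" for s
  proof -
    have "s * (v-u) \<le> v-u" "0 \<le> s * (v-u)" using that uv mult_left_le_one_le[of "v-u" s] by auto
    then show ?thesis by simp
  qed
  have pimg: "path_image \<gamma> = H ` (\<lambda>s. \<phi> (p,s)) ` {u..v}"
  proof -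
    have "(\<lambda>s. u + s * (v-u)) ` {0..1} = {u..v}"
    proof
      have "s \<in> (\<lambda>s. u + s * (v-u)) ` {0..1}" if "s \<in> {u..v}" for s
        using that uv by (intro image_eqI[of _ _ "(s-u)/(v-u)"]) (auto simp: divide_simps)
      then show "{u..v} \<subseteq> (\<lambda>s. u + s * (v-u)) ` {0..1}" by blast
    qed (use rng in auto)
    from this[symmetric] show ?thesis by (simp only: path_image_def \<gamma>_def image_image)
  qed
  have arc: "arc \<gamma>"
    unfolding arc_def path_def
  proof
    have "continuous_map (top_of_set {0..1}) (top_of_set {0..1}) (\<lambda>s. u + s * (v-u))"
      using rng uv by (auto intro!: continuous_intros simp: continuous_map_in_subtopology)
         (meson atLeastAtMost_iff order_trans)+
    from continuous_map_compose[OF this pa]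
    have "continuous_map (top_of_set {0..1}) (subtopology M S) (\<lambda>s. \<phi> (p, u + s * (v-u)))"
      using rng uvS by (auto simp: continuous_map_in_subtopology o_def)
    from continuous_map_compose[OF this homeomorphic_imp_continuous_map[OF hm]]
    show "continuous_on {0..1} \<gamma>" unfolding \<gamma>_def by (simp add: o_def continuous_map_in_subtopology)
    show "inj_on \<gamma> {0..1}"
    proof (rule inj_onI)
      fix a b assume ab: "a \<in> {0..1}" "b \<in> {0..1}" "\<gamma> a = \<gamma> b"
      then have "\<phi> (p, u + a * (v-u)) = \<phi> (p, u + b * (v-u))"
        using homeomorphic_imp_injective_map[OF hm] rng uvS tS unfolding \<gamma>_def by (auto simp: inj_on_def)
      moreover have "u + a * (v-u) \<in> {0..1}" "u + b * (v-u) \<in> {0..1}" using rng[OF ab(1)] rng[OF ab(2)] uv by auto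
      ultimately have "(p, u + a * (v-u)) = (p, u + b * (v-u))"
        by (intro inj_onD[OF inj]) (simp_all add: pt(1))
      then show "a = b" using uv by simp
    qed
  qed
  have Hy: "H y \<in> path_image \<gamma>" unfolding pimg using pt uv by auto
  have "openin (subtopology M S) S1" using S S1 by (simp add: openin_open_subtopology)
  then have "openin (top_of_set (ball (H y) e)) (H ` S1)" using homeomorphic_map_openness_eq[OF hm] by blast
  then have "open (H ` S1)" using openin_open_eq open_ball by blast
  \<comment> \<open>This ball avoids the image of \<open>B0\<close>, so within it the only part of
    \<open>B\<close> is the chosen arc, and a path avoiding \<open>\<gamma>\<close> avoids
    \<open>B\<close>.\<close>
  then obtain e1 where e1: "e1 > 0" "ball (H y) e1 \<subseteq> H ` S1" using S1 by (meson imageI open_contains_ball)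
  obtain d L where d: "d > 0" and L: "\<And>a b. a \<in> ball (H y) d - path_image \<gamma> \<Longrightarrow> b \<in> ball (H y) d - path_image \<gamma> \<Longrightarrow>
      L a = (L b :: bool) \<Longrightarrow> path_component (ball (H y) e1 - path_image \<gamma>) a b"
    using arc_local_sides[OF arc Hy e1(1)] by metis
  define W' where "W' = {z \<in> S. H z \<in> ball (H y) d}"
  have KH: "K (H z) = z" if "z \<in> S" for z using hom that tS unfolding homeomorphic_maps_def by simp
  have "openin (top_of_set (ball (H y) e)) (ball (H y) e \<inter> ball (H y) d)" by (simp add: openin_open_Int)
  then have "openin (subtopology M S) {z \<in> topspace (subtopology M S). H z \<in> ball (H y) e \<inter> ball (H y) d}"
    using hm homeomorphic_imp_continuous_map openin_continuous_map_preimage by blast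
  moreover have "{z \<in> topspace (subtopology M S). H z \<in> ball (H y) e \<inter> ball (H y) d} = W'"
    using homeomorphic_imp_surjective_map[OF hm] unfolding W'_def tS by auto
  ultimately have "openin M W'" using S by (simp add: openin_open_subtopology)
  moreover have "y \<in> W'" using S d by (simp add: W'_def)
  moreover have "W' \<subseteq> W" using S by (auto simp: W'_def)
  moreover have "path_component_of (subtopology M (W - B)) z z'"
    if z: "z \<in> W' - B" "z' \<in> W' - B" and LL: "L (H z) = L (H z')" for z z'
  proof -
    have nin: "H x \<notin> path_image \<gamma>" if "x \<in> W' - B" for x
    proof
      assume "H x \<in> path_image \<gamma>"
      then obtain s where s: "s \<in> {u..v}" "H x = H (\<phi> (p,s))" unfolding pimg by auto
      then have "x = \<phi> (p,s)" using KH uvS that unfolding W'_def by (metis DiffD1 mem_Collect_eq)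
      then show False using that im s uv pt by auto
    qed
    have "path_component (ball (H y) e1 - path_image \<gamma>) (H z) (H z')"
      using L z LL nin[OF z(1)] nin[OF z(2)] unfolding W'_def by auto
    then obtain c where c: "path c" "path_image c \<subseteq> ball (H y) e1 - path_image \<gamma>" "pathstart c = H z" "pathfinish c = H z'"
      unfolding path_component_def by blast
    have sub: "ball (H y) e1 \<subseteq> ball (H y) e" using e1 S1 homeomorphic_imp_surjective_map[OF hm] tS by auto
    have "pathin (top_of_set (ball (H y) e)) c"
      using c sub by (auto simp: pathin_canon_iff path_image_def)
    then have pK: "pathin (subtopology M S) (K \<circ> c)"
      using hom pathin_compose unfolding homeomorphic_maps_def by blast
    moreover have "(K \<circ> c) s \<in> W - B" if "s \<in> {0..1}" for s
    proof -
      have "c s \<in> path_image c" using that unfolding path_image_def by blast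
      then have cs: "c s \<in> ball (H y) e1" "c s \<notin> path_image \<gamma>" using c(2) by blast+
      then obtain w where w: "w \<in> S1" "c s = H w" using e1 by blast
      then have "K (c s) = w" using KH S1 by auto
      moreover have "w \<notin> B" using BS1[of w] w cs pimg by auto
      ultimately show ?thesis using w S1 S by auto
    qed
    ultimately have "pathin (subtopology M (W - B)) (K \<circ> c)" by (auto simp: pathin_subtopology)
    moreover have "(K \<circ> c) 0 = z" "(K \<circ> c) 1 = z'" using c z KH unfolding pathstart_def pathfinish_def W'_def by auto
    ultimately show ?thesis unfolding path_component_of_def by blast
  qed
  ultimately show thesis using that[of W' "L \<circ> H"] by simp
qed

section \<open>The cut surface\<close>

locale cut_trellis =
  fixes M :: "'a topology" and f :: "'a \<Rightarrow> 'a" and T :: "'a trellis"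
    and X :: "'b topology" and q :: "'b \<Rightarrow> 'a" and g :: "'b \<Rightarrow> 'b"
  assumes M: "compact_surface M" and f: "homeomorphic_map M M f"
    and T: "trellis_for M T f" and transverse: "transverse_trellis M T"
    and cut: "cut_surface M (TU T) X q" and cut_map: "is_cut_map T f X q g"
begin

text \<open>Indexed by sets of \<open>M\<close>, so that open covers of \<open>M\<close> control
  positions, while path components are taken in the cut surface.\<close>

definition off_stable :: "'a set \<Rightarrow> 'b set" where
  "off_stable W = {x \<in> topspace X. q x \<in> W - TS T}"

section \<open>Fibres and lifting properties of the gluing map\<close>

lemma X_surface: "compact_surface X" using cut by (simp add: cut_surface_def)

lemma M_Hausdorff: "Hausdorff_space M" using M by (simp add: compact_surface_def)

lemma q_quotient: "quotient_map X M q" using cut by (simp add: cut_surface_def)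

lemma q_continuous: "continuous_map X M q" using q_quotient quotient_imp_continuous_map by blast

lemma q_in: "x \<in> topspace X \<Longrightarrow> q x \<in> topspace M"
  using q_continuous by (auto simp: continuous_map_def)

lemma q_surj: "q ` topspace X = topspace M" using q_quotient quotient_imp_surjective_map by blast

lemma q_closed: "closed_map X M q"
  using continuous_imp_closed_map[OF q_continuous _ M_Hausdorff] X_surface by (simp add: compact_surface_def)

lemma embedded_branches_closed:
  assumes P: "finite P" and B: "embedded_branches M P B"
  shows "closedin M B"
proof -
  let ?PI = "prod_topology (discrete_topology P) (top_of_set {0..1::real})"
  obtain \<phi> where emb: "embedding_map ?PI M \<phi>" and im: "\<phi> ` (P \<times> {0..1}) = B"
    using B unfolding embedded_branches_def by blast
  have con: "continuous_map ?PI M \<phi>"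
    using emb unfolding embedding_map_def homeomorphic_eq_everything_map
    by (auto simp: continuous_map_in_subtopology)
  have "closed_map ?PI M \<phi>"
    using con M_Hausdorff P by (intro continuous_imp_closed_map)
      (auto simp: compact_space_prod_topology compact_space_discrete_topology compact_space_subtopology)
  then have "closedin M (\<phi> ` topspace ?PI)" unfolding closed_map_def by blast
  then show ?thesis using im by simp
qed

lemma TP_finite: "finite (TP T)" using T by (simp add: trellis_for_def trellis_def)

lemma TS_closed: "closedin M (TS T)" and TU_closed: "closedin M (TU T)"
  using T TP_finite embedded_branches_closed by (auto simp: trellis_for_def trellis_def)

lemma cut_curves:
  obtains \<alpha> :: "'a set \<Rightarrow> real \<Rightarrow> 'a" and \<alpha>1 \<alpha>2 :: "'a set \<Rightarrow> real \<Rightarrow> 'b" where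
    "\<And>C. C \<in> connected_components_of (subtopology M (TU T)) \<Longrightarrow> inj_on (\<alpha> C) {0..1} \<and> \<alpha> C ` {0..1} = C"
    "\<And>C t. C \<in> connected_components_of (subtopology M (TU T)) \<Longrightarrow> t \<in> {0..1} \<Longrightarrow>
       q (\<alpha>1 C t) = \<alpha> C t \<and> q (\<alpha>2 C t) = \<alpha> C t \<and>
       \<alpha>1 C t \<in> surface_boundary X \<and> \<alpha>2 C t \<in> surface_boundary X"
    "\<And>x y. x \<in> topspace X \<Longrightarrow> y \<in> topspace X \<Longrightarrow> q x = q y \<Longrightarrow> x \<noteq> y \<Longrightarrow>
       \<exists>C\<in>connected_components_of (subtopology M (TU T)). \<exists>t\<in>{0..1}. {x, y} = {\<alpha>1 C t, \<alpha>2 C t}"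
proof -
  let ?CC = "connected_components_of (subtopology M (TU T))"
  have "\<exists>(\<alpha> :: 'a set \<Rightarrow> real \<Rightarrow> 'a) (\<alpha>1 :: 'a set \<Rightarrow> real \<Rightarrow> 'b) (\<alpha>2 :: 'a set \<Rightarrow> real \<Rightarrow> 'b).
        (\<forall>C\<in>?CC.
           embedding_map (top_of_set {0..1}) M (\<alpha> C) \<and> \<alpha> C ` {0..1} = C \<and>
           pathin X (\<alpha>1 C) \<and> \<alpha>1 C ` {0..1} \<subseteq> surface_boundary X \<and>
           pathin X (\<alpha>2 C) \<and> \<alpha>2 C ` {0..1} \<subseteq> surface_boundary X \<and>
           (\<forall>t\<in>{0..1}. q (\<alpha>1 C t) = \<alpha> C t \<and> q (\<alpha>2 C t) = \<alpha> C t) \<and>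
           \<alpha>1 C 0 = \<alpha>2 C 0 \<and> \<alpha>1 C 1 = \<alpha>2 C 1 \<and>
           \<alpha>1 C ` {0..1} \<inter> \<alpha>2 C ` {0..1} = {\<alpha>1 C 0, \<alpha>1 C 1}) \<and>
        (\<forall>x\<in>topspace X. \<forall>y\<in>topspace X. q x = q y \<longleftrightarrow>
           x = y \<or> (\<exists>C\<in>?CC. \<exists>t\<in>{0..1}. {x, y} = {\<alpha>1 C t, \<alpha>2 C t}))"
    using cut unfolding cut_surface_def by (elim conjE)
  then obtain \<alpha> \<alpha>1 \<alpha>2 where curves: "(\<forall>C\<in>?CC.
           embedding_map (top_of_set {0..1}) M (\<alpha> C) \<and> \<alpha> C ` {0..1} = C \<and>
           pathin X (\<alpha>1 C) \<and> \<alpha>1 C ` {0..1} \<subseteq> surface_boundary X \<and>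
           pathin X (\<alpha>2 C) \<and> \<alpha>2 C ` {0..1} \<subseteq> surface_boundary X \<and>
           (\<forall>t\<in>{0..1}. q (\<alpha>1 C t) = \<alpha> C t \<and> q (\<alpha>2 C t) = \<alpha> C t) \<and>
           \<alpha>1 C 0 = \<alpha>2 C 0 \<and> \<alpha>1 C 1 = \<alpha>2 C 1 \<and>
           \<alpha>1 C ` {0..1} \<inter> \<alpha>2 C ` {0..1} = {\<alpha>1 C 0, \<alpha>1 C 1}) \<and>
        (\<forall>x\<in>topspace X. \<forall>y\<in>topspace X. q x = q y \<longleftrightarrow>
           x = y \<or> (\<exists>C\<in>?CC. \<exists>t\<in>{0..1}. {x, y} = {\<alpha>1 C t, \<alpha>2 C t}))"
    by (elim exE)
  have al: "embedding_map (top_of_set {0..1}) M (\<alpha> C)" "\<alpha> C ` {0..1} = C"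
      "\<alpha>1 C ` {0..1} \<subseteq> surface_boundary X" "\<alpha>2 C ` {0..1} \<subseteq> surface_boundary X"
      "t \<in> {0..1} \<Longrightarrow> q (\<alpha>1 C t) = \<alpha> C t" "t \<in> {0..1} \<Longrightarrow> q (\<alpha>2 C t) = \<alpha> C t" if "C \<in> ?CC" for C t
    using bspec[OF conjunct1[OF curves] that] by simp_all
  have qq: "\<exists>C\<in>?CC. \<exists>t\<in>{0..1}. {x, y} = {\<alpha>1 C t, \<alpha>2 C t}"
    if "x \<in> topspace X" "y \<in> topspace X" "q x = q y" "x \<noteq> y" for x y
    using bspec[OF bspec[OF conjunct2[OF curves] that(1)] that(2)] that(3,4) by simp
  have inj: "inj_on (\<alpha> C) {0..1}" if "C \<in> ?CC" for C
    using al(1)[OF that] unfolding embedding_map_def homeomorphic_eq_everything_map by simp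
  show thesis
  proof (rule that[of \<alpha> \<alpha>1 \<alpha>2])
    show "q (\<alpha>1 C t) = \<alpha> C t \<and> q (\<alpha>2 C t) = \<alpha> C t \<and> \<alpha>1 C t \<in> surface_boundary X \<and> \<alpha>2 C t \<in> surface_boundary X"
      if "C \<in> ?CC" "t \<in> {0..1}" for C t
      using al(3-6)[OF that(1)] that(2) by blast
  qed (use al(2) inj qq in auto)
qed

text \<open>Three preimages would give two different pairs of copies of one arc point. But
  components are disjoint and \<open>\<alpha> C\<close> is injective, so the pairs coincide. For a
  one-point fibre \<open>a = b\<close>.\<close>

lemma q_fibre:
  assumes y: "y \<in> topspace M"
  obtains a b where "a \<in> topspace X" "b \<in> topspace X" "q a = y" "q b = y"
    "\<And>x. x \<in> topspace X \<Longrightarrow> q x = y \<Longrightarrow> x = a \<or> x = b"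
proof -
  let ?CC = "connected_components_of (subtopology M (TU T))"
  obtain \<alpha> :: "'a set \<Rightarrow> real \<Rightarrow> 'a" and \<alpha>1 \<alpha>2 where al: "\<And>C. C \<in> ?CC \<Longrightarrow> inj_on (\<alpha> C) {0..1} \<and> \<alpha> C ` {0..1} = C"
    "\<And>C t. C \<in> ?CC \<Longrightarrow> t \<in> {0..1} \<Longrightarrow> q (\<alpha>1 C t) = \<alpha> C t \<and> q (\<alpha>2 C t) = \<alpha> C t \<and>
       \<alpha>1 C t \<in> surface_boundary X \<and> \<alpha>2 C t \<in> surface_boundary X"
    and qq: "\<And>x y. x \<in> topspace X \<Longrightarrow> y \<in> topspace X \<Longrightarrow> q x = q y \<Longrightarrow> x \<noteq> y \<Longrightarrow>
       \<exists>C\<in>?CC. \<exists>t\<in>{0..1}. {x, y} = {\<alpha>1 C t, \<alpha>2 C t}"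
    by (rule cut_curves) (rule that)
  obtain a where a: "a \<in> topspace X" "q a = y" using y unfolding q_surj[symmetric] by auto
  show thesis
  proof (cases "\<exists>b\<in>topspace X. q b = y \<and> b \<noteq> a")
    case True
    then obtain b where b: "b \<in> topspace X" "q b = y" "b \<noteq> a" by blast
    then obtain C t where C: "C \<in> ?CC" "t \<in> {0..1}" "{a, b} = {\<alpha>1 C t, \<alpha>2 C t}"
      using qq[of a b] a by auto
    then have "a = \<alpha>1 C t \<or> a = \<alpha>2 C t" by blast
    then have yC: "y = \<alpha> C t" using al(2)[OF C(1,2)] a by auto
    have "x = a \<or> x = b" if x: "x \<in> topspace X" "q x = y" for x
    proof (rule ccontr)
      assume n: "\<not> (x = a \<or> x = b)"
      then obtain C' t' where C': "C' \<in> ?CC" "t' \<in> {0..1}" "{a, x} = {\<alpha>1 C' t', \<alpha>2 C' t'}"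
        using qq[of a x] a x by auto
      then have "a = \<alpha>1 C' t' \<or> a = \<alpha>2 C' t'" by blast
      then have yC': "y = \<alpha> C' t'" using al(2)[OF C'(1,2)] a by auto
      have "y \<in> C" "y \<in> C'" using yC yC' C(1,2) C'(1,2) al(1) by blast+
      then have CC: "C = C'" using C(1) C'(1) connected_components_of_overlap by fastforce
      have "t = t'" using yC yC' CC C(1,2) C'(2) al(1)[OF C(1)] inj_onD by metis
      then have "{a, b} = {a, x}" using C C' CC by simp
      then show False using n b by (auto simp: doubleton_eq_iff)
    qed
    then show ?thesis using that a b by blast
  next
    case False
    then show ?thesis using that a by blast
  qed
qed

lemma q_inj:
  assumes "x \<in> topspace X" "x' \<in> topspace X" "q x = q x'" "q x \<notin> TU T"
  shows "x = x'"
proof (rule ccontr)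
  assume "x \<noteq> x'"
  let ?CC = "connected_components_of (subtopology M (TU T))"
  obtain \<alpha> :: "'a set \<Rightarrow> real \<Rightarrow> 'a" and \<alpha>1 \<alpha>2 where al: "\<And>C. C \<in> ?CC \<Longrightarrow> inj_on (\<alpha> C) {0..1} \<and> \<alpha> C ` {0..1} = C"
    "\<And>C t. C \<in> ?CC \<Longrightarrow> t \<in> {0..1} \<Longrightarrow> q (\<alpha>1 C t) = \<alpha> C t \<and> q (\<alpha>2 C t) = \<alpha> C t \<and>
       \<alpha>1 C t \<in> surface_boundary X \<and> \<alpha>2 C t \<in> surface_boundary X"
    and qq: "\<And>x y. x \<in> topspace X \<Longrightarrow> y \<in> topspace X \<Longrightarrow> q x = q y \<Longrightarrow> x \<noteq> y \<Longrightarrow>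
       \<exists>C\<in>?CC. \<exists>t\<in>{0..1}. {x, y} = {\<alpha>1 C t, \<alpha>2 C t}"
    by (rule cut_curves) (rule that)
  obtain C t where C: "C \<in> ?CC" "t \<in> {0..1}" "{x, x'} = {\<alpha>1 C t, \<alpha>2 C t}"
    using qq[of x x'] assms \<open>x \<noteq> x'\<close> by auto
  then have "x = \<alpha>1 C t \<or> x = \<alpha>2 C t" by blast
  then have "q x = \<alpha> C t" using al(2)[OF C(1,2)] by auto
  then have "q x \<in> C" using C(1,2) al(1) by blast
  moreover have "C \<subseteq> TU T" using connected_components_of_subset[OF C(1)] by auto
  ultimately show False using assms by blast
qed

text \<open>The curves provide one preimage on the boundary; any other preimage is the partner of a
  point on such a curve and lies on the boundary as well.\<close>

lemma q_TU_boundary: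
  assumes x: "x \<in> topspace X" "q x \<in> TU T"
  shows "x \<in> surface_boundary X"
proof -
  let ?CC = "connected_components_of (subtopology M (TU T))"
  obtain \<alpha> :: "'a set \<Rightarrow> real \<Rightarrow> 'a" and \<alpha>1 \<alpha>2 where al: "\<And>C. C \<in> ?CC \<Longrightarrow> inj_on (\<alpha> C) {0..1} \<and> \<alpha> C ` {0..1} = C"
    "\<And>C t. C \<in> ?CC \<Longrightarrow> t \<in> {0..1} \<Longrightarrow> q (\<alpha>1 C t) = \<alpha> C t \<and> q (\<alpha>2 C t) = \<alpha> C t \<and>
       \<alpha>1 C t \<in> surface_boundary X \<and> \<alpha>2 C t \<in> surface_boundary X"
    and qq: "\<And>x y. x \<in> topspace X \<Longrightarrow> y \<in> topspace X \<Longrightarrow> q x = q y \<Longrightarrow> x \<noteq> y \<Longrightarrow>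
       \<exists>C\<in>?CC. \<exists>t\<in>{0..1}. {x, y} = {\<alpha>1 C t, \<alpha>2 C t}"
    by (rule cut_curves) (rule that)
  have "q x \<in> \<Union> ?CC" using x q_in Union_connected_components_of[of "subtopology M (TU T)"] by simp
  then obtain C where C: "C \<in> ?CC" "q x \<in> C" by blast
  then obtain t where t: "t \<in> {0..1}" "\<alpha> C t = q x" using al(1)[OF C(1)] by (metis imageE)
  define u where "u = \<alpha>1 C t"
  have u: "u \<in> surface_boundary X" "q u = q x" using al(2)[OF C(1) t(1)] t(2) unfolding u_def by auto
  then have "u \<in> topspace X" by (simp add: surface_boundary_def)
  then have "x = u \<or> (\<exists>C\<in>?CC. \<exists>t\<in>{0..1}. {x, u} = {\<alpha>1 C t, \<alpha>2 C t})" using qq[of x u] x u by auto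
  then show ?thesis
  proof
    assume "\<exists>C\<in>?CC. \<exists>t\<in>{0..1}. {x, u} = {\<alpha>1 C t, \<alpha>2 C t}"
    then obtain C' t' where "C' \<in> ?CC" "t' \<in> {0..1}" "{x, u} = {\<alpha>1 C' t', \<alpha>2 C' t'}" by blast
    then have "x = \<alpha>1 C' t' \<or> x = \<alpha>2 C' t'" by (auto simp: doubleton_eq_iff)
    then show ?thesis using al(2)[OF \<open>C' \<in> ?CC\<close> \<open>t' \<in> {0..1}\<close>] by auto
  qed (use u in simp)
qed

text \<open>The restriction of the closed map \<open>q\<close> to a full preimage stays closed, so
  injectivity off \<open>TU T\<close> makes it a homeomorphism.\<close>

lemma q_homeomorphic_off_TU:
  "homeomorphic_map (subtopology X {x \<in> topspace X. q x \<in> topspace M - TU T}) (subtopology M (topspace M - TU T)) q"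
  (is "homeomorphic_map ?A ?B q")
proof (rule bijective_closed_imp_homeomorphic_map)
  show "continuous_map ?A ?B q"
    using q_continuous by (auto simp: continuous_map_in_subtopology continuous_map_from_subtopology)
  show "closed_map ?A ?B q" by (rule closed_map_restriction[OF q_closed]) simp
  show "q ` topspace ?A = topspace ?B" using q_surj by fastforce
  show "inj_on q (topspace ?A)" using q_inj by (auto intro!: inj_onI)
qed

lemma path_lift:
  assumes C: "C \<subseteq> topspace M - TU T" and p: "path_component_of (subtopology M C) (q x) (q x')"
    and x: "x \<in> topspace X" "x' \<in> topspace X"
  shows "path_component_of (subtopology X {x \<in> topspace X. q x \<in> C}) x x'"
proof -
  obtain s where s: "homeomorphic_maps (subtopology X {x \<in> topspace X. q x \<in> topspace M - TU T})
      (subtopology M (topspace M - TU T)) q s"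
    using q_homeomorphic_off_TU homeomorphic_map_maps by blast
  obtain c where c: "pathin (subtopology M C) c" "c 0 = q x" "c 1 = q x'"
    using p unfolding path_component_of_def by blast
  have cC: "c t \<in> C" if "t \<in> {0..1}" for t using c that by (auto simp: pathin_subtopology)
  have "pathin (subtopology M (topspace M - TU T)) c"
    using c C by (auto simp: pathin_subtopology)
  then have "pathin (subtopology X {x \<in> topspace X. q x \<in> topspace M - TU T}) (s \<circ> c)"
    by (rule pathin_compose) (use s in \<open>simp add: homeomorphic_maps_def\<close>)
  then have sc: "pathin X (s \<circ> c)" by (simp add: pathin_subtopology)
  have qs: "q (s y) = y" if "y \<in> topspace M - TU T" for y using s that unfolding homeomorphic_maps_def by simp
  have sq: "s (q y) = y" if "y \<in> topspace X" "q y \<in> topspace M - TU T" for y using s that unfolding homeomorphic_maps_def by simp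
  have "c 0 \<in> C" "c 1 \<in> C" using cC by auto
  then have e: "(s \<circ> c) 0 = x" "(s \<circ> c) 1 = x'" using sq c x C by auto
  have "(s \<circ> c) t \<in> {x \<in> topspace X. q x \<in> C}" if "t \<in> {0..1}" for t
    using path_image_subset_topspace[OF sc] that cC[OF that] qs C by (auto simp: Pi_iff)
  then have "pathin (subtopology X {x \<in> topspace X. q x \<in> C}) (s \<circ> c)"
    using sc by (simp add: pathin_subtopology)
  then show ?thesis using e unfolding path_component_of_def by blast
qed

text \<open>A tube argument for the closed map \<open>q\<close>: the image of the complement of
  \<open>V\<close> is removed from \<open>M\<close>.\<close>

lemma fibre_neighbourhood:
  assumes V: "openin X V" "\<And>x. x \<in> topspace X \<Longrightarrow> q x = y \<Longrightarrow> x \<in> V" and y: "y \<in> topspace M"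
  obtains W where "openin M W" "y \<in> W" "\<And>x. x \<in> topspace X \<Longrightarrow> q x \<in> W \<Longrightarrow> x \<in> V"
proof -
  have "closedin M (q ` (topspace X - V))" using q_closed V unfolding closed_map_def by blast
  then have o: "openin M (topspace M - q ` (topspace X - V))" by blast
  have "y \<in> topspace M - q ` (topspace X - V)" using V y by blast
  then show thesis by (rule that[OF o]) auto
qed

section \<open>Local sides of the stable set in the cut surface\<close>

lemma off_stable_open:
  assumes "openin M W" shows "openin X (off_stable W)"
proof -
  have "openin M (W - TS T)" using assms TS_closed by (rule openin_diff)
  then show ?thesis unfolding off_stable_def using q_continuous openin_continuous_map_preimage by blast
qed

lemma off_stable_mono: "W \<subseteq> W' \<Longrightarrow> off_stable W \<subseteq> off_stable W'"
  by (auto simp: off_stable_def)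

text \<open>Away from the stable set only the choice of lift matters: each of the at most two lifts
  has a path-connected neighbourhood, and the label names it. The bound 4 is shared with the
  crossing case.\<close>

lemma sides_off_stable:
  assumes W: "openin M W" "y \<in> W" and y: "y \<notin> TS T"
  obtains W' and lab :: "'b \<Rightarrow> nat" where "openin M W'" "y \<in> W'" "W' \<subseteq> W" "\<And>x. lab x < 4"
    "\<And>x x'. x \<in> off_stable W' \<Longrightarrow> x' \<in> off_stable W' \<Longrightarrow> lab x = lab x' \<Longrightarrow>
       path_component_of (subtopology X (off_stable W)) x x'"
proof -
  have yM: "y \<in> topspace M" using openin_subset[OF W(1)] W(2) by blast
  obtain a b where ab: "a \<in> topspace X" "b \<in> topspace X" "q a = y" "q b = y"
    "\<And>x. x \<in> topspace X \<Longrightarrow> q x = y \<Longrightarrow> x = a \<or> x = b" by (rule q_fibre[OF yM]) (rule that)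
  have o: "openin X (off_stable W)" using off_stable_open[OF W(1)] .
  have "a \<in> off_stable W" "b \<in> off_stable W" using ab W y by (auto simp: off_stable_def)
  obtain A where A: "openin X A" "a \<in> A" "A \<subseteq> off_stable W"
    "\<And>y z. y \<in> A \<Longrightarrow> z \<in> A \<Longrightarrow> path_component_of (subtopology X A) y z"
    by (rule surface_locally_path_connected[OF X_surface o \<open>a \<in> off_stable W\<close>]) (rule that)
  obtain B where B: "openin X B" "b \<in> B" "B \<subseteq> off_stable W"
    "\<And>y z. y \<in> B \<Longrightarrow> z \<in> B \<Longrightarrow> path_component_of (subtopology X B) y z"
    by (rule surface_locally_path_connected[OF X_surface o \<open>b \<in> off_stable W\<close>]) (rule that)
  have "openin X (A \<union> B)" using A B by blast
  then obtain V where V: "openin M V" "y \<in> V" "\<And>x. x \<in> topspace X \<Longrightarrow> q x \<in> V \<Longrightarrow> x \<in> A \<union> B"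
    by (rule fibre_neighbourhood[OF _ _ yM]) (use ab(5) A(2) B(2) in blast, rule that)
  define lab where "lab x = (if x \<in> A then 0 else 1 :: nat)" for x
  show thesis
  proof (rule that[of "V \<inter> W" lab])
    show "openin M (V \<inter> W)" using V W by blast
    fix x x' assume x: "x \<in> off_stable (V \<inter> W)" "x' \<in> off_stable (V \<inter> W)" "lab x = lab x'"
    then have "x \<in> A \<union> B" "x' \<in> A \<union> B" using V(3) by (auto simp: off_stable_def)
    then have "(x \<in> A \<and> x' \<in> A) \<or> (x \<in> B \<and> x' \<in> B)" using x(3) unfolding lab_def by (auto split: if_splits)
    then show "path_component_of (subtopology X (off_stable W)) x x'"
      using A(3,4) B(3,4) path_component_of_mono by metis
  qed (use V W in \<open>auto simp: lab_def\<close>)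
qed

text \<open>Off the unstable set \<open>q\<close> is a homeomorphism onto its image, so the two
  sides of the stable arc in \<open>M\<close> serve upstairs as well: a path on one side
  lifts.\<close>

lemma sides_off_unstable:
  assumes W: "openin M W" "y \<in> W" and y: "y \<in> TS T" "y \<notin> TU T"
  obtains W' and lab :: "'b \<Rightarrow> nat" where "openin M W'" "y \<in> W'" "W' \<subseteq> W" "\<And>x. lab x < 4"
    "\<And>x x'. x \<in> off_stable W' \<Longrightarrow> x' \<in> off_stable W' \<Longrightarrow> lab x = lab x' \<Longrightarrow>
       path_component_of (subtopology X (off_stable W)) x x'"
proof -
  have B: "embedded_branches M (TP T) (TS T)" "TS T \<subseteq> surface_interior M"
    using T by (auto simp: trellis_for_def trellis_def)
  have o: "openin M (W - TU T)" using W TU_closed by (intro openin_diff)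
  obtain W' L where W': "openin M W'" "y \<in> W'" "W' \<subseteq> W - TU T"
    "\<And>z z'. z \<in> W' - TS T \<Longrightarrow> z' \<in> W' - TS T \<Longrightarrow> L z = (L z' :: bool) \<Longrightarrow>
       path_component_of (subtopology M (W - TU T - TS T)) z z'"
    using embedded_branches_local_sides[OF M_Hausdorff TP_finite B y(1) o] W y by blast
  show thesis
  proof (rule that[of W' "\<lambda>x. of_bool (L (q x))"])
    fix x x' assume x: "x \<in> off_stable W'" "x' \<in> off_stable W'" "(of_bool (L (q x)) :: nat) = of_bool (L (q x'))"
    have "path_component_of (subtopology M (W - TU T - TS T)) (q x) (q x')"
      using W'(4) x by (auto simp: off_stable_def of_bool_eq_iff)
    then have "path_component_of (subtopology X {x \<in> topspace X. q x \<in> W - TU T - TS T}) x x'"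
      using x openin_subset[OF W(1)] by (intro path_lift) (auto simp: off_stable_def)
    then show "path_component_of (subtopology X (off_stable W)) x x'"
      by (rule path_component_of_mono) (auto simp: off_stable_def)
  qed (use W' in \<open>auto simp: of_bool_def\<close>)
qed

text \<open>The axes of the transverse chart cut it into four quadrants. Every point near the crossing can be
  moved into one of them without meeting the stable set, because the lifts of the unstable set lie in
  the boundary of the cut surface.\<close>

lemma sides_crossing:
  assumes W: "openin M W" "y \<in> W" and y: "y \<in> TS T" "y \<in> TU T"
  obtains W' and lab :: "'b \<Rightarrow> nat" where "openin M W'" "y \<in> W'" "W' \<subseteq> W" "\<And>x. lab x < 4"
    "\<And>x x'. x \<in> off_stable W' \<Longrightarrow> x' \<in> off_stable W' \<Longrightarrow> lab x = lab x' \<Longrightarrow>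
       path_component_of (subtopology X (off_stable W)) x x'"
proof -
  have "y \<in> TV T" using T y by (auto simp: trellis_for_def trellis_def)
  obtain N and h :: "'a \<Rightarrow> real^2" where N: "openin M N" "y \<in> N"
    and h: "homeomorphic_map (subtopology M N) euclidean h" "h y = 0"
    and ax: "h ` (TU T \<inter> N) \<subseteq> {z. z $ 1 = 0}" "h ` (TS T \<inter> N) \<subseteq> {z. z $ 2 = 0}"
    using bspec[OF transverse[unfolded transverse_trellis_def] \<open>y \<in> TV T\<close>] by (elim exE conjE) (rule that)
  have tN: "topspace (subtopology M N) = N" using openin_subset[OF N(1)] by (simp add: Int_absorb1)
  obtain k where hk: "homeomorphic_maps (subtopology M N) euclidean h k"
    using h homeomorphic_map_maps by blast
  have kh: "k (h z) = z" if "z \<in> N" for z using hk that tN unfolding homeomorphic_maps_def by simp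
  have hk': "h (k v) = v" for v using hk unfolding homeomorphic_maps_def by simp
  have kc: "continuous_map euclidean (subtopology M N) k" using hk unfolding homeomorphic_maps_def by blast
  have kN: "k v \<in> N" for v using kc tN unfolding continuous_map_def by auto
  have hopen: "open (h ` U)" if "openin (subtopology M N) U" for U
    using conjunct2[OF iffD1[OF homeomorphic_map_openness_eq[OF h(1)] that]] by (simp only: open_openin)
  have "openin (subtopology M N) (N \<inter> W)" using W N by (simp add: openin_open_subtopology openin_Int)
  then have "open (h ` (N \<inter> W))" by (rule hopen)
  moreover have "0 \<in> h ` (N \<inter> W)" using h N W by force
  ultimately obtain e where e: "e > 0" "ball 0 e \<subseteq> h ` (N \<inter> W)"
    using open_contains_ball by blast
  define D :: "(real^2) set" where "D = ball 0 e"
  define W' where "W' = {z \<in> N. h z \<in> D}"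
  have oW': "openin M W'"
  proof -
    have "openin (subtopology M N) {z \<in> topspace (subtopology M N). h z \<in> D}"
      by (rule openin_continuous_map_preimage[OF homeomorphic_imp_continuous_map[OF h(1)]])
        (simp add: D_def flip: open_openin)
    then show ?thesis unfolding W'_def tN using N by (simp add: openin_open_subtopology)
  qed
  have W'W: "W' \<subseteq> W"
  proof
    fix z assume z: "z \<in> W'"
    then obtain w where "w \<in> N \<inter> W" "h z = h w" using e unfolding W'_def D_def by blast
    then have "z = w" using kh z unfolding W'_def by (metis IntD1 mem_Collect_eq)
    then show "z \<in> W" using \<open>w \<in> N \<inter> W\<close> by simp
  qed
  have yW': "y \<in> W'" using N h e by (simp add: W'_def D_def)
  \<comment> \<open>The open quadrants of a disc. Convexity joins points of one quadrant, and the
    joining path lifts because it misses both axes.\<close>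
  define Q where "Q a b = D \<inter> {z. if a then 0 < z $ 1 else z $ 1 < 0} \<inter> {z. if b then 0 < z $ 2 else z $ 2 < 0}" for a b
  have cQ: "convex (Q a b)" for a b
  proof -
    have "{z :: real^2. z $ i < 0} = {z. axis i 1 \<bullet> z < 0}" "{z :: real^2. 0 < z $ i} = {z. axis i 1 \<bullet> z > 0}" for i
      by (simp_all add: inner_axis')
    then have "convex {z :: real^2. z $ i < 0}" "convex {z :: real^2. 0 < z $ i}" for i
      by (simp_all only: convex_halfspace_lt convex_halfspace_gt)
    then show ?thesis unfolding Q_def D_def by (cases a; cases b) (simp_all add: convex_Int)
  qed
  have kQ: "k v \<in> W' - TU T - TS T" if "v \<in> Q a b" for v a b
    using that ax kN[of v] hk'[of v] unfolding Q_def W'_def by (auto split: if_splits; force)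
  have reach: "\<exists>ab x'. x' \<in> topspace X \<and> q x' \<in> k ` Q (fst ab) (snd ab) \<and> path_component_of (subtopology X (off_stable W')) x x'"
    if x: "x \<in> off_stable W'" for x
  proof -
    obtain S where S: "openin X S" "x \<in> S" "S \<subseteq> off_stable W'"
      "\<And>y z. y \<in> S \<Longrightarrow> z \<in> S \<Longrightarrow> path_component_of (subtopology X S) y z"
      by (rule surface_locally_path_connected[OF X_surface off_stable_open[OF oW'] x]) (rule that)
    \<comment> \<open>An interior point of the cut surface cannot lie over \<open>TU T\<close>, so
      moving within a small path-connected set off \<open>Y\<close> leaves the unstable
      lifts.\<close>
    obtain s where s: "s \<in> S" "s \<in> surface_interior X" using surface_interior_dense[OF X_surface S(1)] S(2) by blast
    then have sU: "q s \<notin> TU T" using q_TU_boundary[of s] S(3) by (auto simp: surface_boundary_def off_stable_def)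
    define S' where "S' = S \<inter> {x \<in> topspace X. q x \<in> topspace M - TU T}"
    have sS': "s \<in> S'" using s sU S(3) q_in unfolding S'_def off_stable_def by auto
    have tX: "topspace (subtopology X {x \<in> topspace X. q x \<in> topspace M - TU T}) = {x \<in> topspace X. q x \<in> topspace M - TU T}"
      by auto
    have "openin (subtopology X {x \<in> topspace X. q x \<in> topspace M - TU T}) S'"
      unfolding S'_def using S(1) by (simp add: openin_subtopology_Int2 openin_subtopology_Int Int_commute)
    then have "openin (subtopology M (topspace M - TU T)) (q ` S')"
      using homeomorphic_map_openness_eq[OF q_homeomorphic_off_TU] by blast
    then have oq: "openin M (q ` S')" using TU_closed by (simp add: openin_open_subtopology openin_diff)
    have qS': "q ` S' \<subseteq> W'" using S(3) unfolding S'_def off_stable_def by auto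
    then have qN: "q ` S' \<subseteq> N" by (auto simp: W'_def)
    then have "openin (subtopology M N) (q ` S')" using oq N by (simp add: openin_open_subtopology)
    then have oh: "open (h ` q ` S')" by (rule hopen)
    have "h (q s) \<in> h ` q ` S'" using sS' by blast
    then obtain \<epsilon> where \<epsilon>: "\<epsilon> > 0" "ball (h (q s)) \<epsilon> \<subseteq> h ` q ` S'"
      using oh open_contains_ball by blast
    define w where "w = h (q s)"
    have "\<exists>v \<in> ball w \<epsilon>. v $ 1 \<noteq> 0 \<and> v $ 2 \<noteq> 0"
    proof -
      \<comment> \<open>Moving each vanishing coordinate by \<epsilon>/3 changes the norm by at most
        2\<epsilon>/3, which is less than \<epsilon>.\<close>
      define v :: "real^2" where "v = w + (\<chi> i. if w $ i = 0 then \<epsilon>/3 else 0)"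
      have "norm (v - w) \<le> (\<Sum>i\<in>UNIV. \<bar>(v - w) $ i\<bar>)" by (rule norm_le_l1_cart)
      also have "\<dots> \<le> (\<Sum>i\<in>(UNIV::2 set). \<epsilon>/3)" using \<epsilon>(1) by (intro sum_mono) (auto simp: v_def)
      also have "\<dots> < \<epsilon>" using \<epsilon>(1) by simp
      finally have "v \<in> ball w \<epsilon>" by (simp add: dist_norm norm_minus_commute)
      moreover have "v $ i \<noteq> 0" for i using \<epsilon>(1) by (auto simp: v_def)
      ultimately show ?thesis by blast
    qed
    then obtain v where v: "v \<in> ball w \<epsilon>" "v $ 1 \<noteq> 0" "v $ 2 \<noteq> 0" by blast
    have "v \<in> h ` q ` S'" using v(1) \<epsilon>(2) unfolding w_def by blast
    then obtain x' where x': "x' \<in> S'" "h (q x') = v" by auto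
    have "v \<in> D" using x' qS' unfolding W'_def by blast
    then have "v \<in> Q (0 < v $ 1) (0 < v $ 2)" using v unfolding Q_def by auto
    moreover have "q x' = k v" using x' kh[of "q x'"] qN by auto
    moreover have "path_component_of (subtopology X (off_stable W')) x x'"
      using path_component_of_mono[OF S(4)[OF S(2)] S(3), of x'] x'(1) unfolding S'_def by blast
    moreover have "x' \<in> topspace X" using x' unfolding S'_def by blast
    ultimately show ?thesis by (intro exI[of _ "(0 < v $ 1, 0 < v $ 2)"] exI[of _ x']) auto
  qed
  \<comment> \<open>One reachable quadrant is chosen for each point. Two points with the same choice
    are joined by their paths into that quadrant and a path inside it, whatever the choice
    was.\<close>
  define sgn where "sgn x = (SOME ab. \<exists>x'. x' \<in> topspace X \<and> q x' \<in> k ` Q (fst ab) (snd ab) \<and>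
      path_component_of (subtopology X (off_stable W')) x x')" for x
  define lab where "lab x = of_bool (fst (sgn x)) + 2 * (of_bool (snd (sgn x)) :: nat)" for x
  show thesis
  proof (rule that[OF oW' yW' W'W, of lab])
    show "lab x < 4" for x by (auto simp: lab_def of_bool_def)
    fix x1 x2 assume x: "x1 \<in> off_stable W'" "x2 \<in> off_stable W'" "lab x1 = lab x2"
    then have e: "sgn x1 = sgn x2" unfolding lab_def by (auto simp: prod_eq_iff of_bool_def split: if_splits)
    obtain x1' where x1': "x1' \<in> topspace X" "q x1' \<in> k ` Q (fst (sgn x1)) (snd (sgn x1))"
        "path_component_of (subtopology X (off_stable W')) x1 x1'"
      using someI_ex[OF reach[OF x(1)]] unfolding sgn_def by blast
    obtain x2' where x2': "x2' \<in> topspace X" "q x2' \<in> k ` Q (fst (sgn x2)) (snd (sgn x2))"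
        "path_component_of (subtopology X (off_stable W')) x2 x2'"
      using someI_ex[OF reach[OF x(2)]] unfolding sgn_def by blast
    obtain a b where ab: "sgn x1 = (a, b)" by (cases "sgn x1")
    obtain v1 v2 where v: "v1 \<in> Q a b" "v2 \<in> Q a b" "q x1' = k v1" "q x2' = k v2"
    proof -
      have "q x1' \<in> k ` Q a b" "q x2' \<in> k ` Q a b" using x1'(2) x2'(2) unfolding e[symmetric] ab by simp_all
      then show thesis using that by auto
    qed
    have "path_component (Q a b) v1 v2"
      using v cQ convex_imp_path_connected path_connected_component by blast
    then obtain p where p: "path p" "path_image p \<subseteq> Q a b" "pathstart p = v1" "pathfinish p = v2"
      unfolding path_component_def by blast
    have "pathin (subtopology M N) (k \<circ> p)" using p(1) by (intro pathin_compose[OF _ kc]) (simp add: pathin_def path_def)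
    moreover have "(k \<circ> p) t \<in> k ` Q a b" if "t \<in> {0..1}" for t using p(2) that unfolding path_image_def by fastforce
    ultimately have "pathin (subtopology M (k ` Q a b)) (k \<circ> p)" by (simp add: pathin_subtopology)
    then have "path_component_of (subtopology M (k ` Q a b)) (q x1') (q x2')"
      unfolding path_component_of_def using p v by (intro exI[of _ "k \<circ> p"]) (auto simp: pathstart_def pathfinish_def)
    then have "path_component_of (subtopology X {x \<in> topspace X. q x \<in> k ` Q a b}) x1' x2'"
      using kQ openin_subset[OF oW'] x1' x2' by (intro path_lift) auto
    moreover have "{x \<in> topspace X. q x \<in> k ` Q a b} \<subseteq> off_stable W'" using kQ by (auto simp: off_stable_def)
    ultimately have "path_component_of (subtopology X (off_stable W')) x1' x2'"
      using path_component_of_mono by metis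
    then have "path_component_of (subtopology X (off_stable W')) x1 x2"
      using x1'(3) x2'(3) path_component_of_trans path_component_of_sym by metis
    then show "path_component_of (subtopology X (off_stable W)) x1 x2"
      using path_component_of_mono off_stable_mono[OF W'W] by metis
  qed
qed

lemma sides:
  assumes W: "openin M W" "y \<in> W"
  obtains W' and lab :: "'b \<Rightarrow> nat" where "openin M W'" "y \<in> W'" "W' \<subseteq> W" "\<And>x. lab x < 4"
    "\<And>x x'. x \<in> off_stable W' \<Longrightarrow> x' \<in> off_stable W' \<Longrightarrow> lab x = lab x' \<Longrightarrow>
       path_component_of (subtopology X (off_stable W)) x x'"
  by (cases "y \<in> TS T"; cases "y \<in> TU T")
     (rule sides_crossing[OF W] sides_off_unstable[OF W] sides_off_stable[OF W]; (assumption | rule that; assumption))+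

section \<open>Following the stable arcs\<close>

text \<open>Away from this set, \<open>f\<close> locally maps the complement of the stable set into itself.\<close>

definition entry_set :: "'a set" where
  "entry_set = M closure_of ({x \<in> topspace M. f x \<in> TS T} - TS T)"

lemma f_continuous: "continuous_map M M f" using f homeomorphic_imp_continuous_map by blast

lemma f_inj: "inj_on f (topspace M)" using f homeomorphic_imp_injective_map by blast

lemma f_in: "x \<in> topspace M \<Longrightarrow> f x \<in> topspace M"
  using f_continuous by (auto simp: continuous_map_def)

lemma f_TS: "x \<in> TS T \<Longrightarrow> f x \<in> TS T" using T by (auto simp: trellis_for_def)

lemma funpow_f_TS: "x \<in> TS T \<Longrightarrow> (f ^^ i) x \<in> TS T"
  by (induction i) (auto simp: f_TS)

text \<open>The preimage of \<open>TS T\<close> is closed, so taking the closure adds no point with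
  image elsewhere.\<close>

lemma entry_set_image:
  assumes "z \<in> entry_set" shows "f z \<in> TS T"
proof -
  have "closedin M {x \<in> topspace M. f x \<in> TS T}"
    using closedin_continuous_map_preimage[OF f_continuous TS_closed] .
  then have "entry_set \<subseteq> {x \<in> topspace M. f x \<in> TS T}"
    unfolding entry_set_def by (intro closure_of_minimal) auto
  then show ?thesis using assms by blast
qed

text \<open>The set \<open>inn\<close> is the stable set without the endpoints of its arcs. A point of the entry set lying
  on the stable set is an endpoint of an arc whose image is not an endpoint, because \<open>f\<close> maps arcs
  homeomorphically onto subarcs.\<close>

lemma stable_interior:
  obtains inn where "inn \<subseteq> TS T" "\<And>z. z \<in> inn \<Longrightarrow> f z \<in> inn" "inn \<inter> entry_set = {}"
    "\<And>z. z \<in> TS T \<Longrightarrow> z \<in> entry_set \<Longrightarrow> f z \<in> inn"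
proof -
  let ?P = "TP T"
  let ?I = "top_of_set {0..1::real}"
  let ?PI = "prod_topology (discrete_topology ?P) ?I"
  have branches: "embedded_branches M ?P (TS T)" using T by (simp add: trellis_for_def trellis_def)
  obtain \<phi> where emb: "embedding_map ?PI M \<phi>" and im: "\<phi> ` (?P \<times> {0..1}) = TS T"
    using branches unfolding embedded_branches_def by (elim conjE exE) (rule that)
  have hm: "homeomorphic_map ?PI (subtopology M (TS T)) \<phi>" using emb im unfolding embedding_map_def by simp
  have tS: "topspace (subtopology M (TS T)) = TS T" using closedin_subset[OF TS_closed] by (simp add: Int_absorb1)
  have TSM: "TS T \<subseteq> topspace M" using closedin_subset[OF TS_closed] .
  obtain \<psi> where hms: "homeomorphic_maps ?PI (subtopology M (TS T)) \<phi> \<psi>"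
    using hm homeomorphic_map_maps by blast
  have \<psi>\<phi>: "\<psi> (\<phi> z) = z" if "z \<in> ?P \<times> {0..1}" for z using hms that unfolding homeomorphic_maps_def by auto
  have \<phi>\<psi>: "\<phi> (\<psi> z) = z" if "z \<in> TS T" for z
    using hms that tS unfolding homeomorphic_maps_def by blast
  have \<phi>c: "continuous_map ?PI (subtopology M (TS T)) \<phi>" and \<psi>c: "continuous_map (subtopology M (TS T)) ?PI \<psi>"
    using hms unfolding homeomorphic_maps_def by auto
  have \<phi>inj: "z = z'" if "\<phi> z = \<phi> z'" "z \<in> ?P \<times> {0..1}" "z' \<in> ?P \<times> {0..1}" for z z'
    using \<psi>\<phi>[OF that(2)] \<psi>\<phi>[OF that(3)] that(1) by metis
  have fc: "continuous_map (subtopology M (TS T)) (subtopology M (TS T)) f"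
    using f_continuous f_TS by (auto simp: continuous_map_in_subtopology continuous_map_from_subtopology)
  \<comment> \<open>Connectedness puts the image of a branch into one branch; in parameters
    \<open>f\<close> becomes a continuous injective function \<open>r\<close>, hence strictly
    monotone.\<close>
  have branch: "\<exists>p' r. p' \<in> ?P \<and> continuous_on {0..1} r \<and> inj_on r {0..1} \<and> r ` {0..1} \<subseteq> {0..1::real} \<and>
      (\<forall>t\<in>{0..1}. f (\<phi> (p,t)) = \<phi> (p', r t))" if p: "p \<in> ?P" for p
  proof -
    define R where "R = (\<lambda>t::real. \<psi> (f (\<phi> (p,t))))"
    have "continuous_map ?I ?PI (\<lambda>t. (p,t))"
      using p by (simp add: continuous_map_pairwise o_def)
    from continuous_map_compose[OF this continuous_map_compose[OF \<phi>c continuous_map_compose[OF fc \<psi>c]]]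
    have Rc: "continuous_map ?I ?PI R" by (simp add: R_def o_def)
    then have "continuous_map ?I (discrete_topology ?P) (\<lambda>t. fst (R t))" and rc: "continuous_map ?I ?I (\<lambda>t. snd (R t))"
      by (simp_all add: continuous_map_pairwise o_def)
    moreover have "connectedin ?I {0..1}" by (simp add: connectedin_subtopology)
    ultimately have "connectedin (discrete_topology ?P) ((\<lambda>t. fst (R t)) ` {0..1})"
      using connectedin_continuous_map_image by blast
    then obtain p' where p': "(\<lambda>t. fst (R t)) ` {0..1} \<subseteq> {p'}" "(\<lambda>t. fst (R t)) ` {0..1} \<subseteq> ?P"
      by (auto simp: connectedin_discrete_topology)
    have "fst (R 0) \<in> (\<lambda>t. fst (R t)) ` {0..1}" by simp
    then have p'P: "p' \<in> ?P" using p' by blast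
    define r where "r = (\<lambda>t. snd (R t))"
    have eq: "f (\<phi> (p,t)) = \<phi> (p', r t)" if "t \<in> {0..1}" for t
    proof -
      have "fst (R t) \<in> {p'}" using p'(1) that by (rule subsetD[OF _ imageI])
      then have "R t = (p', r t)" unfolding r_def by (simp add: prod_eq_iff)
      moreover have "\<phi> (p,t) \<in> TS T" using im p that by blast
      then have "\<phi> (R t) = f (\<phi> (p,t))" unfolding R_def using \<phi>\<psi> f_TS by blast
      ultimately show ?thesis by simp
    qed
    have r01: "r ` {0..1} \<subseteq> {0..1}" using rc unfolding r_def continuous_map_def by auto
    have "inj_on r {0..1}"
    proof (rule inj_onI)
      fix a b assume ab: "a \<in> {0..1}" "b \<in> {0..1}" "r a = r b"
      then have "f (\<phi> (p,a)) = f (\<phi> (p,b))" using eq by simp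
      moreover have "\<phi> (p,a) \<in> topspace M" "\<phi> (p,b) \<in> topspace M" using im p ab TSM by blast+
      ultimately have "\<phi> (p,a) = \<phi> (p,b)" using f_inj by (meson inj_onD)
      then have "(p,a) = (p,b)" by (rule \<phi>inj) (use p ab in auto)
      then show "a = b" by simp
    qed
    moreover have "continuous_on {0..1} r" using rc unfolding r_def by (simp add: continuous_map_in_subtopology)
    ultimately show ?thesis using p'P r01 eq by blast
  qed
  define inn where "inn = \<phi> ` (?P \<times> {0<..<1})"
  have inn1: "inn \<subseteq> TS T" using im unfolding inn_def by auto
  have inn2: "f z \<in> inn" if z: "z \<in> inn" for z
  proof -
    obtain p t where pt: "p \<in> ?P" "0 < t" "t < 1" "z = \<phi> (p,t)" using z unfolding inn_def by auto
    obtain p' r where r: "p' \<in> ?P" "continuous_on {0..1} r" "inj_on r {0..1}" "r ` {0..1} \<subseteq> {0..1}"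
      "\<forall>t\<in>{0..1}. f (\<phi> (p,t)) = \<phi> (p', r t)" using branch[OF pt(1)] by blast
    have "r 0 \<in> {0..1}" "r 1 \<in> {0..1}" by (rule subsetD[OF r(4) imageI], simp)+
    then have "r t \<in> {0<..<1}"
      using continuous_inj_imp_mono[OF pt(2,3) r(2,3)] by auto
    then show ?thesis using r pt unfolding inn_def by auto
  qed
  \<comment> \<open>If the image of the branch fills a neighbourhood of \<open>f z\<close> in the
    stable set, then by injectivity of \<open>f\<close> every point near \<open>z\<close> with image
    in the stable set is already on the branch. So \<open>z\<close> is not in the closure defining
    \<open>entry_set\<close>.\<close>
  have interior_contra: False
    if z: "z \<in> entry_set" "z = \<phi> (p,t)" "p \<in> ?P" "t \<in> {0..1}" and p': "p' \<in> ?P"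
      and r: "\<forall>t\<in>{0..1}. f (\<phi> (p,t)) = \<phi> (p', r t)" "r ` {0..1} \<subseteq> {0..1}"
      and V: "open V" "r t \<in> V" "{0..1} \<inter> V \<subseteq> r ` {0..1}" for z p t p' r and V :: "real set"
  proof -
    have "openin ?PI ({p'} \<times> ({0..1} \<inter> V))" using p' V(1) by (simp add: openin_prod_Times_iff openin_open_Int)
    then have "openin (subtopology M (TS T)) (\<phi> ` ({p'} \<times> ({0..1} \<inter> V)))"
      using homeomorphic_map_openness_eq[OF hm] by blast
    then obtain G where G: "openin M G" "\<phi> ` ({p'} \<times> ({0..1} \<inter> V)) = G \<inter> TS T"
      unfolding openin_subtopology by blast
    have "r t \<in> {0..1} \<inter> V" using r(2) z(4) V(2) by blast
    then have "f z \<in> G" using G(2) r(1) z by auto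
    moreover have zM: "z \<in> topspace M" using z(1) in_closure_of unfolding entry_set_def by fast
    ultimately have "z \<in> {x \<in> topspace M. f x \<in> G}" by simp
    moreover have "openin M {x \<in> topspace M. f x \<in> G}" using openin_continuous_map_preimage[OF f_continuous G(1)] .
    moreover have "\<forall>U. z \<in> U \<and> openin M U \<longrightarrow> (\<exists>w. w \<in> {x \<in> topspace M. f x \<in> TS T} - TS T \<and> w \<in> U)"
      using z(1) unfolding entry_set_def in_closure_of by (rule conjunct2)
    ultimately obtain w where "w \<in> {x \<in> topspace M. f x \<in> TS T} - TS T" "w \<in> {x \<in> topspace M. f x \<in> G}"
      by meson
    then have w: "w \<in> topspace M" "f w \<in> G" "f w \<in> TS T" "w \<notin> TS T" by auto
    then have "f w \<in> \<phi> ` ({p'} \<times> ({0..1} \<inter> V))" using G(2) by blast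
    then obtain v where v: "f w = \<phi> (p', v)" "v \<in> {0..1} \<inter> V" by blast
    then obtain s where s: "s \<in> {0..1}" "v = r s" using V(3) by blast
    then have "f w = f (\<phi> (p,s))" using v r(1) by simp
    moreover have pTS: "\<phi> (p,s) \<in> TS T" using im z(3) s(1) by blast
    ultimately have "w = \<phi> (p,s)" using f_inj w(1) TSM by (meson inj_onD subsetD)
    then show False using w(4) pTS by simp
  qed
  have seg: "{a..b} \<subseteq> r ` {0..1}" if "continuous_on {0..1} r" "a \<in> r ` {0..1}" "b \<in> r ` {0..1}" for a b and r :: "real \<Rightarrow> real"
    using connected_contains_Icc[OF connected_continuous_image[OF that(1)] that(2,3)] by simp
  have inn3: "inn \<inter> entry_set = {}"
  proof (rule ccontr)
    assume "inn \<inter> entry_set \<noteq> {}"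
    then obtain p t where pt: "p \<in> ?P" "0 < t" "t < 1" "\<phi> (p,t) \<in> entry_set" unfolding inn_def by auto
    obtain p' r where r: "p' \<in> ?P" "continuous_on {0..1} r" "inj_on r {0..1}" "r ` {0..1} \<subseteq> {0..1}"
      "\<forall>t\<in>{0..1}. f (\<phi> (p,t)) = \<phi> (p', r t)" using branch[OF pt(1)] by blast
    \<comment> \<open>By monotonicity \<open>r\<close> takes an interior parameter strictly between
      its end values, and its image contains everything between them.\<close>
    define V where "V = {min (r 0) (r 1)<..<max (r 0) (r 1)}"
    have rt: "r t \<in> V" using continuous_inj_imp_mono[OF pt(2,3) r(2,3)] unfolding V_def by auto
    have "{r 0..r 1} \<subseteq> r ` {0..1}" "{r 1..r 0} \<subseteq> r ` {0..1}" by (intro seg r(2); simp)+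
    then have "V \<subseteq> r ` {0..1}" unfolding V_def by (cases "r 0 \<le> r 1") auto
    then show False using interior_contra[OF pt(4) refl pt(1) _ r(1,5,4) _ rt] pt(2,3) unfolding V_def by auto
  qed
  have inn4: "f z \<in> inn" if z: "z \<in> TS T" "z \<in> entry_set" for z
  proof (rule ccontr)
    assume n: "f z \<notin> inn"
    obtain p t where pt: "p \<in> ?P" "t \<in> {0..1}" "z = \<phi> (p,t)"
      using z(1) unfolding im[symmetric] by auto
    obtain p' r where r: "p' \<in> ?P" "continuous_on {0..1} r" "inj_on r {0..1}" "r ` {0..1} \<subseteq> {0..1}"
      "\<forall>t\<in>{0..1}. f (\<phi> (p,t)) = \<phi> (p', r t)" using branch[OF pt(1)] by blast
    have "z \<notin> inn" using inn3 z by blast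
    then have t: "t = 0 \<or> t = 1" using pt unfolding inn_def by force
    have rt01: "r t \<in> {0..1}" using r(4) pt(2) by blast
    have "r t \<notin> {0<..<1}" using n r(1,5) pt unfolding inn_def by auto
    then have rt: "r t = 0 \<or> r t = 1" using rt01 by auto
    \<comment> \<open>Both \<open>t\<close> and \<open>r t\<close> are now ends of the unit
      interval. The opposite value \<open>r (1-t)\<close> bounds a half-line containing
      \<open>r t\<close>, and \<open>r\<close> fills the part of it in the unit interval.\<close>
    have t': "1 - t \<in> {0..1}" "1 - t \<noteq> t" using t by auto
    have r': "r (1-t) \<in> {0..1}" "r (1-t) \<noteq> r t"
      using subsetD[OF r(4) imageI[OF t'(1)]] inj_onD[OF r(3) _ t'(1) pt(2)] t'(2) by blast+
    have im': "r t \<in> r ` {0..1}" "r (1-t) \<in> r ` {0..1}" using pt(2) t'(1) by blast+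
    show False
    proof (cases "r t = 0")
      case True
      have "{0..1} \<inter> {..<r (1-t)} \<subseteq> r ` {0..1}" using seg[OF r(2) im'] True by auto
      then show False using interior_contra[OF z(2) pt(3,1,2) r(1,5,4), of "{..<r (1-t)}"] True r' by auto
    next
      case False
      then have "r t = 1" using rt by blast
      moreover have "{0..1} \<inter> {r (1-t)<..} \<subseteq> r ` {0..1}" using seg[OF r(2) im'(2,1)] calculation by auto
      ultimately show False using interior_contra[OF z(2) pt(3,1,2) r(1,5,4), of "{r (1-t)<..}"] r' by auto
    qed
  qed
  show thesis by (rule that[OF inn1 inn2 inn3 inn4])
qed

lemma card_entry_times: "card {i. i < n \<and> (f ^^ i) y \<in> entry_set} \<le> 2"
proof (rule ccontr)
  obtain inn where inn: "inn \<subseteq> TS T" "\<And>z. z \<in> inn \<Longrightarrow> f z \<in> inn" "inn \<inter> entry_set = {}"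
    "\<And>z. z \<in> TS T \<Longrightarrow> z \<in> entry_set \<Longrightarrow> f z \<in> inn" by (rule stable_interior) (rule that)
  have inn_pow: "(f ^^ m) z \<in> inn" if "z \<in> inn" for m z using that inn(2) by (induction m) auto
  \<comment> \<open>At the second entry time the orbit is already in the stable set, so the next
    point is in \<open>inn\<close>, which is forward invariant and disjoint from
    \<open>entry_set\<close>.\<close>
  have no3: False if ijk: "i < j" "j < k" and E: "(f ^^ i) y \<in> entry_set" "(f ^^ j) y \<in> entry_set" "(f ^^ k) y \<in> entry_set" for i j k
  proof -
    have "(f ^^ (j - Suc i)) (f ((f ^^ i) y)) \<in> TS T" using entry_set_image[OF E(1)] funpow_f_TS by blast
    also have "(f ^^ (j - Suc i)) (f ((f ^^ i) y)) = (f ^^ j) y"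
      using ijk(1) by (metis Suc_leI comp_apply funpow.simps(2) funpow_add le_add_diff_inverse2)
    finally have "f ((f ^^ j) y) \<in> inn" using inn(4) E(2) by blast
    then have "(f ^^ (k - Suc j)) (f ((f ^^ j) y)) \<in> inn" by (rule inn_pow)
    also have "(f ^^ (k - Suc j)) (f ((f ^^ j) y)) = (f ^^ k) y"
      using ijk(2) by (metis Suc_leI comp_apply funpow.simps(2) funpow_add le_add_diff_inverse2)
    finally show False using inn(3) E(3) by blast
  qed
  assume "\<not> card {i. i < n \<and> (f ^^ i) y \<in> entry_set} \<le> 2"
  then have "3 \<le> card {i. i < n \<and> (f ^^ i) y \<in> entry_set}" by simp
  then obtain B where B: "B \<subseteq> {i. i < n \<and> (f ^^ i) y \<in> entry_set}" "card B = 3"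
    by (rule obtain_subset_with_card_n) (rule that)
  then obtain a b c where abc: "B = {a, b, c}" "a \<noteq> b" "b \<noteq> c" "a \<noteq> c" by (auto simp: card_3_iff)
  then have E: "(f ^^ a) y \<in> entry_set" "(f ^^ b) y \<in> entry_set" "(f ^^ c) y \<in> entry_set" using B by auto
  consider "a < b" "b < c" | "a < c" "c < b" | "b < a" "a < c" | "b < c" "c < a" | "c < a" "a < b" | "c < b" "b < a"
    using abc by linarith
  then show False
    using no3[of a b c] no3[of a c b] no3[of b a c] no3[of b c a] no3[of c a b] no3[of c b a] E
    by cases simp_all
qed

section \<open>Orbits of the cut map and their labels\<close>

abbreviation Y :: "'b set" where "Y \<equiv> cut_stable T X q"

lemma g_continuous: "continuous_map X X g" and g_Y: "map_of_pairs X Y X Y g"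
  using cut_map by (auto simp: is_cut_map_def map_of_pairs_def)

lemma q_g: "x \<in> topspace X \<Longrightarrow> q (g x) = f (q x)"
  using cut_map by (auto simp: is_cut_map_def)

lemma funpow_g_in: "x \<in> topspace X \<Longrightarrow> (g ^^ i) x \<in> topspace X"
  using funpow_in_topspace[OF g_continuous] .

lemma q_funpow_g: "x \<in> topspace X \<Longrightarrow> q ((g ^^ i) x) = (f ^^ i) (q x)"
  by (induction i) (auto simp: q_g funpow_g_in)

text \<open>The path must avoid the stable set, but the homotopy from its image to the next path need not,
  since in a relating family with empty \<open>J\<close> only the curves themselves have to be exact.\<close>

definition near :: "'b set set \<Rightarrow> 'b \<Rightarrow> 'b \<Rightarrow> bool" where
  "near \<T> x x' \<longleftrightarrow> (\<exists>c. pathin X c \<and> c 0 = x \<and> c 1 = x' \<and> (\<forall>t\<in>{0..1}. q (c t) \<notin> TS T) \<and>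
     (\<exists>U\<in>\<T>. c ` {0..1} \<subseteq> U) \<and> (\<exists>U\<in>\<T>. (g \<circ> c) ` {0..1} \<subseteq> U))"

text \<open>All iterates are included, since a block that starts before time \<open>n\<close> may
  run past it.\<close>

definition avoids :: "'b \<Rightarrow> bool" where
  "avoids x \<longleftrightarrow> x \<in> topspace X \<and> (\<forall>i. q ((g ^^ i) x) \<notin> TS T)"

lemma avoids_g: "avoids x \<Longrightarrow> avoids (g x)"
proof -
  assume x: "avoids x"
  have "q ((g ^^ i) (g x)) \<notin> TS T" for i
    using x[unfolded avoids_def, THEN conjunct2, THEN spec[of _ "Suc i"]] by (simp add: funpow_swap1)
  then show "avoids (g x)" using x funpow_g_in[of x 1] unfolding avoids_def by simp
qed

lemma avoids_funpow: "avoids x \<Longrightarrow> avoids ((g ^^ i) x)"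
  by (induction i) (auto simp: avoids_g)

text \<open>The points of the fibre get neighbourhoods which, like their images under
  \<open>g\<close>, fit into members of the cover. If there are two points the neighbourhoods are
  disjoint, and connectedness keeps a path in one of them.\<close>

lemma small_neighbourhood:
  assumes \<T>: "\<forall>x\<in>topspace X. \<exists>U\<in>\<T>. openin X U \<and> x \<in> U" and y: "y \<in> topspace M"
  obtains W where "openin M W" "y \<in> W"
    "\<And>W' x x'. W' \<subseteq> W \<Longrightarrow> path_component_of (subtopology X (off_stable W')) x x' \<Longrightarrow> near \<T> x x'"
proof -
  have nb: "\<exists>V. openin X V \<and> a \<in> V \<and> (\<exists>U\<in>\<T>. V \<subseteq> U) \<and> (\<exists>U\<in>\<T>. g ` V \<subseteq> U)" if a: "a \<in> topspace X" for a
  proof -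
    obtain U where U: "U \<in> \<T>" "openin X U" "a \<in> U" using \<T> a by blast
    have "g a \<in> topspace X" using funpow_g_in[OF a, of 1] by simp
    then obtain U' where U': "U' \<in> \<T>" "openin X U'" "g a \<in> U'" using \<T> by blast
    have "openin X {x \<in> topspace X. g x \<in> U'}" using openin_continuous_map_preimage[OF g_continuous U'(2)] .
    then have "openin X (U \<inter> {x \<in> topspace X. g x \<in> U'})" using U(2) by (rule openin_Int[rotated])
    moreover have "a \<in> U \<inter> {x \<in> topspace X. g x \<in> U'}" using a U U' by blast
    moreover have "U \<inter> {x \<in> topspace X. g x \<in> U'} \<subseteq> U" "g ` (U \<inter> {x \<in> topspace X. g x \<in> U'}) \<subseteq> U'" by auto
    ultimately show ?thesis using U(1) U'(1) by blast
  qed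
  obtain a b where ab: "a \<in> topspace X" "b \<in> topspace X" "q a = y" "q b = y"
    "\<And>x. x \<in> topspace X \<Longrightarrow> q x = y \<Longrightarrow> x = a \<or> x = b" by (rule q_fibre[OF y]) (rule that)
  obtain Va where Va: "openin X Va" "a \<in> Va" "\<exists>U\<in>\<T>. Va \<subseteq> U" "\<exists>U\<in>\<T>. g ` Va \<subseteq> U" using nb[OF ab(1)] by blast
  obtain Vb where Vb: "openin X Vb" "b \<in> Vb" "\<exists>U\<in>\<T>. Vb \<subseteq> U" "\<exists>U\<in>\<T>. g ` Vb \<subseteq> U" using nb[OF ab(2)] by blast
  have "\<exists>A B. openin X A \<and> openin X B \<and> a \<in> A \<and> b \<in> A \<union> B \<and> A \<inter> B = {} \<and> A \<subseteq> Va \<and> B \<subseteq> Vb"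
  proof (cases "a = b")
    case True
    then show ?thesis using Va by (intro exI[of _ Va] exI[of _ "{}"]) auto
  next
    case False
    have "Hausdorff_space X" using X_surface by (simp add: compact_surface_def)
    then obtain A B where "openin X A" "openin X B" "a \<in> A" "b \<in> B" "disjnt A B"
      using ab(1,2) False unfolding Hausdorff_space_def by blast
    then show ?thesis using Va Vb
      by (intro exI[of _ "A \<inter> Va"] exI[of _ "B \<inter> Vb"]) (auto simp: disjnt_def openin_Int)
  qed
  then obtain A B where AB: "openin X A" "openin X B" "a \<in> A" "b \<in> A \<union> B" "A \<inter> B = {}" "A \<subseteq> Va" "B \<subseteq> Vb" by blast
  have oAB: "openin X (A \<union> B)" using AB by blast
  obtain W where W: "openin M W" "y \<in> W" "\<And>x. x \<in> topspace X \<Longrightarrow> q x \<in> W \<Longrightarrow> x \<in> A \<union> B"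
    by (rule fibre_neighbourhood[OF oAB _ y]) (use ab(5) AB(3,4) in blast, rule that)
  show thesis
  proof (rule that[OF W(1,2)])
    fix W' x x' assume W': "W' \<subseteq> W" and p: "path_component_of (subtopology X (off_stable W')) x x'"
    then obtain c where c: "pathin X c" "\<forall>t\<in>{0..1}. c t \<in> off_stable W'" "c 0 = x" "c 1 = x'"
      unfolding path_component_of_def by (auto simp: pathin_subtopology)
    have cAB: "c ` {0..1} \<subseteq> A \<union> B" using c(2) W' W(3) unfolding off_stable_def by blast
    have con: "connectedin X (c ` {0..1})" using connectedin_path_image[OF c(1)] .
    have "c ` {0..1} \<subseteq> A \<or> c ` {0..1} \<subseteq> B"
    proof (rule ccontr)
      assume "\<not> (c ` {0..1} \<subseteq> A \<or> c ` {0..1} \<subseteq> B)"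
      then have "A \<inter> c ` {0..1} \<noteq> {}" "B \<inter> c ` {0..1} \<noteq> {}" using cAB by blast+
      then show False using con cAB AB(1,2,5) unfolding connectedin by blast
    qed
    then have "c ` {0..1} \<subseteq> Va \<or> c ` {0..1} \<subseteq> Vb" using AB(6,7) by blast
    then obtain V where Vab: "V = Va \<or> V = Vb" and cV: "c ` {0..1} \<subseteq> V" by blast
    have V: "\<exists>U\<in>\<T>. V \<subseteq> U" "\<exists>U\<in>\<T>. g ` V \<subseteq> U"
      using Vab Va(3,4) Vb(3,4) by (elim disjE; simp only:)+
    have gV: "(g \<circ> c) ` {0..1} \<subseteq> g ` V" using cV by auto
    have "(\<exists>U\<in>\<T>. c ` {0..1} \<subseteq> U) \<and> (\<exists>U\<in>\<T>. (g \<circ> c) ` {0..1} \<subseteq> U)"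
      using V order_trans[OF cV] order_trans[OF gV] by meson
    then show "near \<T> x x'" unfolding near_def using c by (intro exI[of _ c]) (auto simp: off_stable_def)
  qed
qed

text \<open>A point off the stable set whose image lies in it belongs to \<open>entry_set\<close>,
  so the image of a path avoiding both sets avoids \<open>Y\<close>.\<close>

lemma path_component_of_image:
  assumes p: "path_component_of (subtopology X (off_stable W)) x x'"
    and W: "\<And>z. z \<in> W \<Longrightarrow> f z \<in> W1" "W \<inter> entry_set = {}"
  shows "path_component_of (subtopology X (off_stable W1)) (g x) (g x')"
proof -
  obtain c where c: "pathin X c" "\<forall>t\<in>{0..1}. c t \<in> off_stable W" "c 0 = x" "c 1 = x'"
    using p unfolding path_component_of_def by (auto simp: pathin_subtopology)
  have "pathin X (g \<circ> c)" using pathin_compose[OF c(1) g_continuous] .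
  moreover have "(g \<circ> c) t \<in> off_stable W1" if "t \<in> {0..1}" for t
  proof -
    have ct: "c t \<in> topspace X" "q (c t) \<in> W" "q (c t) \<notin> TS T" using c(2) that by (auto simp: off_stable_def)
    have "f (q (c t)) \<notin> TS T"
    proof
      assume "f (q (c t)) \<in> TS T"
      then have "q (c t) \<in> {x \<in> topspace M. f x \<in> TS T} - TS T" using ct q_in by blast
      then have "q (c t) \<in> entry_set" unfolding entry_set_def
        using closure_of_subset[of "{x \<in> topspace M. f x \<in> TS T} - TS T" M] by blast
      then show False using W(2) ct(2) by blast
    qed
    then show ?thesis using ct W(1) q_g funpow_g_in[of "c t" 1] unfolding off_stable_def by auto
  qed
  ultimately have "pathin (subtopology X (off_stable W1)) (g \<circ> c)" by (simp add: pathin_subtopology)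
  then show ?thesis unfolding path_component_of_def using c(3,4) by (intro exI[of _ "g \<circ> c"]) auto
qed

text \<open>The side of the stable set on which a point lies determines the side on which its image lies,
  except at the times when the orbit of \<open>y\<close> is in the entry set; there a new label is recorded.\<close>

lemma chain_sides:
  assumes \<T>: "\<forall>x\<in>topspace X. \<exists>U\<in>\<T>. openin X U \<and> x \<in> U"
  shows "y \<in> topspace M \<Longrightarrow> \<exists>W (lab :: 'b \<Rightarrow> nat). openin M W \<and> y \<in> W \<and>
    (\<forall>x. lab x < 4 ^ card {i. i < n \<and> (f ^^ i) y \<in> entry_set}) \<and>
    (\<forall>x x'. avoids x \<longrightarrow> avoids x' \<longrightarrow> path_component_of (subtopology X (off_stable W)) x x' \<longrightarrow> lab x = lab x' \<longrightarrow>
       (\<forall>i<n. near \<T> ((g ^^ i) x) ((g ^^ i) x')))"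
proof (induction n arbitrary: y)
  case 0
  then show ?case by (intro exI[of _ "topspace M"] exI[of _ "\<lambda>_. 0"]) auto
next
  case (Suc n)
  define E where "E = {i. i < n \<and> (f ^^ i) (f y) \<in> entry_set}"
  obtain W1 and lab1 :: "'b \<Rightarrow> nat" where W1o: "openin M W1" "f y \<in> W1" and
    raw: "\<forall>x. lab1 x < 4 ^ card E" "\<forall>x x'. avoids x \<longrightarrow> avoids x' \<longrightarrow>
       path_component_of (subtopology X (off_stable W1)) x x' \<longrightarrow> lab1 x = lab1 x' \<longrightarrow>
       (\<forall>i<n. near \<T> ((g ^^ i) x) ((g ^^ i) x'))"
    using Suc.IH[OF f_in[OF Suc.prems]] unfolding E_def[symmetric] by (elim exE conjE) (rule that)
  have W1: "openin M W1" "f y \<in> W1" "\<And>x. lab1 x < 4 ^ card E"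
    "\<And>x x'. avoids x \<Longrightarrow> avoids x' \<Longrightarrow> path_component_of (subtopology X (off_stable W1)) x x' \<Longrightarrow> lab1 x = lab1 x' \<Longrightarrow>
       (\<forall>i<n. near \<T> ((g ^^ i) x) ((g ^^ i) x'))"
    using W1o raw by blast+
  obtain S where S: "openin M S" "y \<in> S"
    "\<And>W' x x'. W' \<subseteq> S \<Longrightarrow> path_component_of (subtopology X (off_stable W')) x x' \<Longrightarrow> near \<T> x x'"
    by (rule small_neighbourhood[OF \<T> Suc.prems]) (rule that)
  have tail: "near \<T> ((g ^^ i) x) ((g ^^ i) x')"
    if "near \<T> x x'" "\<forall>i<n. near \<T> ((g ^^ i) (g x)) ((g ^^ i) (g x'))" "i < Suc n" for i x x'
    using that by (cases i) (auto simp: funpow_swap1)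
  have cardE: "card {i. i < Suc n \<and> (f ^^ i) y \<in> entry_set} = (if y \<in> entry_set then Suc (card E) else card E)"
  proof -
    have "{i. i < Suc n \<and> (f ^^ i) y \<in> entry_set} = (if y \<in> entry_set then {0} else {}) \<union> Suc ` E"
    proof (rule Set.set_eqI)
      fix i show "i \<in> {i. i < Suc n \<and> (f ^^ i) y \<in> entry_set} \<longleftrightarrow> i \<in> (if y \<in> entry_set then {0} else {}) \<union> Suc ` E"
        unfolding E_def by (cases i) (auto simp: funpow_swap1)
    qed
    moreover have "finite E" unfolding E_def by simp
    ultimately show ?thesis by (simp add: card_image)
  qed
  show ?case
  proof (cases "y \<in> entry_set")
    case False
    have "closedin M entry_set" unfolding entry_set_def by simp
    \<comment> \<open>Away from the entry set the image path itself connects \<open>g x\<close> and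
      \<open>g x'\<close> in the next neighbourhood, so the label is inherited at no cost.\<close>
    define W where "W = S \<inter> {z \<in> topspace M. f z \<in> W1} - entry_set"
    have oW: "openin M W" unfolding W_def
      using S(1) openin_continuous_map_preimage[OF f_continuous W1(1)] \<open>closedin M entry_set\<close>
      by (intro openin_diff openin_Int)
    have yW: "y \<in> W" using S(2) W1(2) False Suc.prems unfolding W_def by blast
    have "\<forall>i<Suc n. near \<T> ((g ^^ i) x) ((g ^^ i) x')"
      if x: "avoids x" "avoids x'" and p: "path_component_of (subtopology X (off_stable W)) x x'"
        and l: "lab1 (g x) = lab1 (g x')" for x x'
    proof -
      have "path_component_of (subtopology X (off_stable W1)) (g x) (g x')"
        by (rule path_component_of_image[OF p]) (auto simp: W_def)
      then have "\<forall>i<n. near \<T> ((g ^^ i) (g x)) ((g ^^ i) (g x'))"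
        using W1(4) avoids_g x l by blast
      moreover have "near \<T> x x'" using S(3)[OF _ p] unfolding W_def by blast
      ultimately show ?thesis using tail by blast
    qed
    then show ?thesis using oW yW W1(3) False cardE
      by (intro exI[of _ W] exI[of _ "\<lambda>x. lab1 (g x)"]) auto
  next
    case True
    \<comment> \<open>Here the image path may meet \<open>Y\<close>. The connection between
      \<open>g x\<close> and \<open>g x'\<close> is rebuilt from a fresh label at
      \<open>f y\<close>, which only requires both points to be off \<open>Y\<close>.\<close>
    obtain W2 and lab2 :: "'b \<Rightarrow> nat" where W2: "openin M W2" "f y \<in> W2" "W2 \<subseteq> W1" "\<And>x. lab2 x < 4"
      "\<And>x x'. x \<in> off_stable W2 \<Longrightarrow> x' \<in> off_stable W2 \<Longrightarrow> lab2 x = lab2 x' \<Longrightarrow>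
         path_component_of (subtopology X (off_stable W1)) x x'"
      by (rule sides[OF W1(1,2)]) (rule that)
    define W where "W = S \<inter> {z \<in> topspace M. f z \<in> W2}"
    \<comment> \<open>The fresh label is the lowest digit in base 4, so equal values have equal
      components.\<close>
    define lab where "lab x = lab2 (g x) + 4 * lab1 (g x)" for x
    have oW: "openin M W" unfolding W_def
      using S(1) openin_continuous_map_preimage[OF f_continuous W2(1)] by (intro openin_Int)
    have yW: "y \<in> W" using S(2) W2(2) Suc.prems unfolding W_def by blast
    have bound: "lab x < 4 ^ Suc (card E)" for x
      using W2(4)[of "g x"] W1(3)[of "g x"] unfolding lab_def by simp
    have "\<forall>i<Suc n. near \<T> ((g ^^ i) x) ((g ^^ i) x')"
      if x: "avoids x" "avoids x'" and p: "path_component_of (subtopology X (off_stable W)) x x'"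
        and l: "lab x = lab x'" for x x'
    proof -
      have l2: "lab2 (g x) = lab2 (g x') \<and> lab1 (g x) = lab1 (g x')"
        using l W2(4)[of "g x"] W2(4)[of "g x'"] unfolding lab_def by presburger
      have tp: "x \<in> off_stable W" "x' \<in> off_stable W"
        using p unfolding path_component_of_def
        using path_start_in_topspace path_finish_in_topspace by fastforce+
      have "g z \<in> off_stable W2" if "avoids z" "z \<in> off_stable W" for z
      proof -
        have "g z \<in> topspace X" "q (g z) \<notin> TS T"
          using avoids_g[OF that(1)] unfolding avoids_def by (auto dest: spec[of _ 0])
        then show ?thesis using that q_g[of z] unfolding avoids_def off_stable_def W_def by auto
      qed
      then have "path_component_of (subtopology X (off_stable W1)) (g x) (g x')"
        using W2(5) x tp l2 by blast
      then have "\<forall>i<n. near \<T> ((g ^^ i) (g x)) ((g ^^ i) (g x'))"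
        using W1(4) avoids_g x l2 by blast
      moreover have "near \<T> x x'" using S(3)[OF _ p] unfolding W_def by blast
      ultimately show ?thesis using tail by blast
    qed
    then show ?thesis using oW yW bound True cardE
      by (intro exI[of _ W] exI[of _ lab]) auto
  qed
qed

text \<open>\<open>chain_sides\<close> presupposes a path between the starting points; one more
  label from \<open>sides\<close> supplies it. With at most two entry times the bound is 4 *
  16.\<close>

lemma block_sides:
  assumes \<T>: "\<forall>x\<in>topspace X. \<exists>U\<in>\<T>. openin X U \<and> x \<in> U" and y: "y \<in> topspace M"
  shows "\<exists>W (lab :: 'b \<Rightarrow> nat). openin M W \<and> y \<in> W \<and> (\<forall>x. lab x < 64) \<and>
    (\<forall>x x'. avoids x \<longrightarrow> avoids x' \<longrightarrow> q x \<in> W \<longrightarrow> q x' \<in> W \<longrightarrow> lab x = lab x' \<longrightarrow>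
       (\<forall>i<n. near \<T> ((g ^^ i) x) ((g ^^ i) x')))"
proof -
  define E where "E = {i. i < n \<and> (f ^^ i) y \<in> entry_set}"
  obtain W1 and lab1 :: "'b \<Rightarrow> nat" where W1o: "openin M W1" "y \<in> W1" and
    raw: "\<forall>x. lab1 x < 4 ^ card E" "\<forall>x x'. avoids x \<longrightarrow> avoids x' \<longrightarrow>
       path_component_of (subtopology X (off_stable W1)) x x' \<longrightarrow> lab1 x = lab1 x' \<longrightarrow>
       (\<forall>i<n. near \<T> ((g ^^ i) x) ((g ^^ i) x'))"
    using chain_sides[OF \<T> y, of n] unfolding E_def[symmetric] by (elim exE conjE) (rule that)
  have W1: "openin M W1" "y \<in> W1" "\<And>x. lab1 x < 4 ^ card E"
    "\<And>x x'. avoids x \<Longrightarrow> avoids x' \<Longrightarrow> path_component_of (subtopology X (off_stable W1)) x x' \<Longrightarrow> lab1 x = lab1 x' \<Longrightarrow>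
       (\<forall>i<n. near \<T> ((g ^^ i) x) ((g ^^ i) x'))"
    using W1o raw by blast+
  obtain W and lab :: "'b \<Rightarrow> nat" where W: "openin M W" "y \<in> W" "W \<subseteq> W1" "\<And>x. lab x < 4"
    "\<And>x x'. x \<in> off_stable W \<Longrightarrow> x' \<in> off_stable W \<Longrightarrow> lab x = lab x' \<Longrightarrow>
       path_component_of (subtopology X (off_stable W1)) x x'"
    by (rule sides[OF W1(1,2)]) (rule that)
  define L where "L x = lab x + 4 * lab1 x" for x
  have l16: "lab1 x < 16" for x
  proof -
    have "(4::nat) ^ card E \<le> 4 ^ 2" using card_entry_times[of n y] unfolding E_def by (intro power_increasing) auto
    then show ?thesis using W1(3)[of x] by simp
  qed
  have "L x < 64" for x using W(4)[of x] l16[of x] unfolding L_def by linarith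
  moreover have "\<forall>i<n. near \<T> ((g ^^ i) x) ((g ^^ i) x')"
    if x: "avoids x" "avoids x'" "q x \<in> W" "q x' \<in> W" "L x = L x'" for x x'
  proof -
    have l: "lab x = lab x' \<and> lab1 x = lab1 x'"
      using x(5) W(4)[of x] W(4)[of x'] unfolding L_def by presburger
    have "z \<in> off_stable W" if "avoids z" "q z \<in> W" for z
      using that unfolding avoids_def off_stable_def by (auto dest: spec[of _ 0])
    then show ?thesis using W(5) W1(4) x l by blast
  qed
  ultimately show ?thesis using W(1,2) by (intro exI[of _ W] exI[of _ L]) auto
qed

end

section \<open>Counting Nielsen classes\<close>

text \<open>Compactness shows that the condition under \<open>LEAST\<close> is satisfiable, so the
  minimum is attained.\<close>

lemma compact_min_subcover:
  assumes M: "compact_space M" and f: "continuous_map M M f" and U: "open_cover M \<U>"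
  obtains \<V> where "\<V> \<subseteq> iterated_join M f \<U> n" "finite \<V>" "\<Union>\<V> = topspace M"
    "card \<V> = min_subcover M (iterated_join M f \<U> n)"
proof -
  let ?J = "iterated_join M f \<U> n"
  have fi: "continuous_map M M (f ^^ i)" for i
  proof (induction i)
    case (Suc i)
    then show ?case using continuous_map_compose[OF Suc f] by (simp add: o_def)
  qed (simp add: id_def)
  have "openin M V" if VJ: "V \<in> ?J" for V
  proof -
    obtain u where u: "\<forall>i<n. u i \<in> \<U>" "V = {x \<in> topspace M. \<forall>i<n. (f ^^ i) x \<in> u i}"
      using VJ unfolding iterated_join_def by blast
    have "V = topspace M \<inter> (\<Inter>i\<in>{..<n}. {x \<in> topspace M. (f ^^ i) x \<in> u i})" using u(2) by auto
    moreover have "openin M \<dots>"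
    proof (cases "n = 0")
      case False
      have "openin M {x \<in> topspace M. (f ^^ i) x \<in> u i}" if "i < n" for i
        using openin_continuous_map_preimage[OF fi] u(1) U that unfolding open_cover_def by blast
      then show ?thesis using False by (intro openin_Int openin_INT2 openin_topspace) auto
    qed simp
    ultimately show ?thesis by simp
  qed
  moreover have "topspace M \<subseteq> \<Union>?J"
  proof
    fix x assume x: "x \<in> topspace M"
    have "(f ^^ i) x \<in> \<Union>\<U>" for i
      using fi[of i] x U unfolding open_cover_def continuous_map_def by auto
    then have "\<forall>i. \<exists>u. u \<in> \<U> \<and> (f ^^ i) x \<in> u" by blast
    from choice[OF this] obtain u where u: "\<forall>i. u i \<in> \<U> \<and> (f ^^ i) x \<in> u i" by blast
    then have "{x \<in> topspace M. \<forall>i<n. (f ^^ i) x \<in> u i} \<in> ?J" unfolding iterated_join_def by blast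
    then show "x \<in> \<Union>?J" using x u by blast
  qed
  ultimately have "\<exists>\<F>. finite \<F> \<and> \<F> \<subseteq> ?J \<and> topspace M \<subseteq> \<Union>\<F>"
    by (intro mp[OF spec[OF iffD1[OF compact_space_alt M]]] conjI ballI)
  then obtain \<F> where F: "finite \<F>" "\<F> \<subseteq> ?J" "topspace M \<subseteq> \<Union>\<F>"
    by (elim exE conjE) (rule that)
  have "v \<subseteq> topspace M" if "v \<in> ?J" for v using that unfolding iterated_join_def by blast
  then have "\<Union>\<F> = topspace M" using F(2,3) by (intro subset_antisym Union_least) auto
  then have "\<exists>\<V>\<subseteq>?J. finite \<V> \<and> card \<V> = card \<F> \<and> \<Union>\<V> = topspace M" using F by blast
  then have "\<exists>\<V>\<subseteq>?J. finite \<V> \<and> card \<V> = min_subcover M ?J \<and> \<Union>\<V> = topspace M"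
    unfolding min_subcover_def by (rule LeastI)
  then obtain \<V> where V: "\<V> \<subseteq> ?J" "finite \<V>" "card \<V> = min_subcover M ?J" "\<Union>\<V> = topspace M" by (elim exE conjE) (rule that)
  show thesis by (rule that[OF V(1,2,4,3)])
qed

section \<open>Encoding classes by itineraries and labels, and the growth rates\<close>

context cut_trellis
begin

text \<open>The witnessing paths form a relating family with \<open>J = {}\<close>: they miss
  \<open>Y\<close>, hence are exact, and \<open>g \<circ> c j\<close> and
  \<open>c (Suc j mod n)\<close> have equal endpoints and each fit into a member of the cover, so
  \<open>hom\<close> applies.\<close>

lemma near_imp_nielsen:
  assumes hom: "\<And>T1 T2 c d Y. T1 \<in> \<T> \<Longrightarrow> T2 \<in> \<T> \<Longrightarrow> pathin X c \<Longrightarrow> pathin X d \<Longrightarrow> c ` {0..1} \<subseteq> T1 \<Longrightarrow> d ` {0..1} \<subseteq> T2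
      \<Longrightarrow> c 0 = d 0 \<Longrightarrow> c 1 = d 1 \<Longrightarrow> homotopic_curves X Y {} c d"
    and x: "x1 \<in> Per X g n" "x2 \<in> Per X g n" and n: "\<forall>i<n. near \<T> ((g ^^ i) x1) ((g ^^ i) x2)"
  shows "(x1, x2) \<in> nielsen_relation X Y g n"
proof -
  have "\<forall>i\<in>{..<n}. \<exists>c. pathin X c \<and> c 0 = (g ^^ i) x1 \<and> c 1 = (g ^^ i) x2 \<and> (\<forall>t\<in>{0..1}. q (c t) \<notin> TS T) \<and>
     (\<exists>U\<in>\<T>. c ` {0..1} \<subseteq> U) \<and> (\<exists>U\<in>\<T>. (g \<circ> c) ` {0..1} \<subseteq> U)"
    using n unfolding near_def by simp
  from bchoice[OF this] obtain c where cc: "\<forall>i\<in>{..<n}. pathin X (c i) \<and> c i 0 = (g ^^ i) x1 \<and>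
     c i 1 = (g ^^ i) x2 \<and> (\<forall>t\<in>{0..1}. q (c i t) \<notin> TS T) \<and>
     (\<exists>U\<in>\<T>. c i ` {0..1} \<subseteq> U) \<and> (\<exists>U\<in>\<T>. (g \<circ> c i) ` {0..1} \<subseteq> U)"
    by (elim exE) (rule that)
  have c: "pathin X (c i)" "c i 0 = (g ^^ i) x1" "c i 1 = (g ^^ i) x2" "\<forall>t\<in>{0..1}. q (c i t) \<notin> TS T"
    "\<exists>U\<in>\<T>. c i ` {0..1} \<subseteq> U" "\<exists>U\<in>\<T>. (g \<circ> c i) ` {0..1} \<subseteq> U" if "i < n" for i
    using bspec[OF cc, of i] that by auto
  have px: "(g ^^ n) x1 = x1" "(g ^^ n) x2 = x2" using x by (auto simp: Per_def)
  have "relating_family X Y g n x1 x2 {} c"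
    unfolding relating_family_def
  proof (intro conjI allI impI)
    fix j assume j: "j < n"
    show "c j 0 = (g ^^ j) x1" "c j 1 = (g ^^ j) x2" using c j by auto
    show "exact_map_of_pairs (top_of_set {0..1}) {} X Y (c j)"
      using c(1,4)[OF j] unfolding exact_map_of_pairs_def map_of_pairs_def pathin_def cut_stable_def by auto
    have m: "Suc j mod n < n" using j by simp
    \<comment> \<open>For \<open>j = n - 1\<close> the index returns to 0, and periodicity
      identifies the endpoints.\<close>
    have wrap: "(g ^^ (Suc j mod n)) x = g ((g ^^ j) x)" if "(g ^^ n) x = x" for x
      using that j by (cases "Suc j = n") auto
    obtain U1 where U1: "U1 \<in> \<T>" "(g \<circ> c j) ` {0..1} \<subseteq> U1" using c(6)[OF j] by blast
    obtain U2 where U2: "U2 \<in> \<T>" "c (Suc j mod n) ` {0..1} \<subseteq> U2" using c(5)[OF m] by blast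
    show "homotopic_curves X Y {} (g \<circ> c j) (c (Suc j mod n))"
      by (rule hom[OF U1(1) U2(1) pathin_compose[OF c(1)[OF j] g_continuous] c(1)[OF m] U1(2) U2(2)])
        (use c(2,3)[OF j] c(2,3)[OF m] wrap px in auto)
  qed simp
  then show ?thesis using x unfolding nielsen_relation_def by blast
qed

text \<open>Regions lie outside \<open>Y\<close>, and a code of length \<open>n\<close> covers a
  full period, to which every time reduces modulo \<open>n\<close>.\<close>

lemma avoids_if_code:
  assumes RR: "\<forall>R\<in>RR. region X Y R" and x: "x \<in> Per X g n" and n: "n > 0"
    and w: "length w = n" "is_code RR g x w"
  shows "avoids x"
  unfolding avoids_def
proof (intro conjI allI)
  show xt: "x \<in> topspace X" using x by (simp add: Per_def)
  fix i
  have "(g ^^ i) x = (g ^^ (i mod n)) x"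
    using x by (simp add: Per_def funpow_mod_eq)
  moreover have "i mod n < n" using n by simp
  then have "(g ^^ (i mod n)) x \<in> w ! (i mod n)" "w ! (i mod n) \<in> RR" using w unfolding is_code_def by auto
  then have "(g ^^ (i mod n)) x \<in> topspace X - Y"
    using RR unfolding region_def by (meson DiffD1 openin_imp_subset subsetD)
  ultimately show "q ((g ^^ i) x) \<notin> TS T" by (auto simp: cut_stable_def)
qed

text \<open>A class is encoded by a member of a minimal subcover containing the projection of a
  representative, together with the labels read at multiples of \<open>N\<close>. Equal codes make
  the representatives near at all times below \<open>n\<close>, so the encoding is injective. The
  cover is chosen before \<open>n\<close>.\<close>

lemma nielsen_number_le:
  assumes RR: "\<forall>R\<in>RR. region X Y R" and N: "N > 0"
  obtains \<U> where "open_cover M \<U>"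
    "\<And>n. n > 0 \<Longrightarrow> nielsen_number X Y RR g n \<le> min_subcover M (iterated_join M f \<U> n) * 64 ^ (n div N + 1)"
proof -
  obtain \<T> where T1: "\<And>x. x \<in> topspace X \<Longrightarrow> \<exists>T\<in>\<T>. openin X T \<and> x \<in> T" and
    T2: "\<And>T1 T2 c d Y. T1 \<in> \<T> \<Longrightarrow> T2 \<in> \<T> \<Longrightarrow> pathin X c \<Longrightarrow> pathin X d \<Longrightarrow> c ` {0..1} \<subseteq> T1 \<Longrightarrow> d ` {0..1} \<subseteq> T2
      \<Longrightarrow> c 0 = d 0 \<Longrightarrow> c 1 = d 1 \<Longrightarrow> homotopic_curves X Y {} c d"
    by (rule good_cover[OF X_surface]) (rule that)
  have T1': "\<forall>x\<in>topspace X. \<exists>U\<in>\<T>. openin X U \<and> x \<in> U" using T1 by blast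
  have "\<forall>y\<in>topspace M. \<exists>W. \<exists>lab :: 'b \<Rightarrow> nat. openin M W \<and> y \<in> W \<and> (\<forall>x. lab x < 64) \<and>
    (\<forall>x x'. avoids x \<longrightarrow> avoids x' \<longrightarrow> q x \<in> W \<longrightarrow> q x' \<in> W \<longrightarrow> lab x = lab x' \<longrightarrow>
       (\<forall>i<N. near \<T> ((g ^^ i) x) ((g ^^ i) x')))"
    using block_sides[OF T1'] by (intro ballI)
  from bchoice[OF this] obtain W where "\<forall>y\<in>topspace M. \<exists>lab :: 'b \<Rightarrow> nat. openin M (W y) \<and> y \<in> W y \<and> (\<forall>x. lab x < 64) \<and>
    (\<forall>x x'. avoids x \<longrightarrow> avoids x' \<longrightarrow> q x \<in> W y \<longrightarrow> q x' \<in> W y \<longrightarrow> lab x = lab x' \<longrightarrow>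
       (\<forall>i<N. near \<T> ((g ^^ i) x) ((g ^^ i) x')))"
    by (elim exE) (rule that)
  from bchoice[OF this] obtain lab :: "'a \<Rightarrow> 'b \<Rightarrow> nat" where WL: "\<forall>y\<in>topspace M. openin M (W y) \<and> y \<in> W y \<and> (\<forall>x. lab y x < 64) \<and>
    (\<forall>x x'. avoids x \<longrightarrow> avoids x' \<longrightarrow> q x \<in> W y \<longrightarrow> q x' \<in> W y \<longrightarrow> lab y x = lab y x' \<longrightarrow>
       (\<forall>i<N. near \<T> ((g ^^ i) x) ((g ^^ i) x')))"
    by (elim exE) (rule that)
  define \<U> where "\<U> = W ` topspace M"
  have cover: "open_cover M \<U>" unfolding open_cover_def
  proof
    show "\<forall>U\<in>\<U>. openin M U" using WL unfolding \<U>_def by blast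
    then show "\<Union>\<U> = topspace M" using WL openin_subset unfolding \<U>_def by fast
  qed
  have "nielsen_number X Y RR g n \<le> min_subcover M (iterated_join M f \<U> n) * 64 ^ (n div N + 1)" if n: "n > 0" for n
  proof -
    define S where "S = {Q \<in> nielsen_classes X Y g n.
       essential_class X g n Q \<and> (\<forall>x\<in>Q. nielsen_separated X Y g n x) \<and>
       (\<exists>w. length w = n \<and> (\<forall>x\<in>Q. is_code RR g x w))}"
    have num: "nielsen_number X Y RR g n = card S" unfolding nielsen_number_def S_def ..
    have "\<exists>x. x \<in> Per X g n \<and> Q = nielsen_relation X Y g n `` {x} \<and> avoids x" if Q: "Q \<in> S" for Q
    proof -
      obtain x where x: "x \<in> Per X g n" "Q = nielsen_relation X Y g n `` {x}"
        using Q unfolding S_def nielsen_classes_def quotient_def by blast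
      obtain w where w: "length w = n" "\<forall>x\<in>Q. is_code RR g x w" using Q unfolding S_def by blast
      have "x \<in> Q" using nielsen_relation_refl[OF g_Y x(1)] x(2) by blast
      then have "avoids x" using avoids_if_code[OF RR x(1) n w(1)] w(2) by blast
      then show ?thesis using x by blast
    qed
    then have "\<forall>Q\<in>S. \<exists>x. x \<in> Per X g n \<and> Q = nielsen_relation X Y g n `` {x} \<and> avoids x" by blast
    from bchoice[OF this] obtain \<rho> where \<rho>: "\<forall>Q\<in>S. \<rho> Q \<in> Per X g n \<and> Q = nielsen_relation X Y g n `` {\<rho> Q} \<and> avoids (\<rho> Q)"
      by (elim exE) (rule that)
    have nr: "(x, x') \<in> nielsen_relation X Y g n"
      if "x \<in> Per X g n" "x' \<in> Per X g n" "\<forall>i<n. near \<T> ((g ^^ i) x) ((g ^^ i) x')" for x x'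
      by (rule near_imp_nielsen[OF _ that]) (rule T2; assumption)
    \<comment> \<open>Nearness is required in both directions because the classes are compared by
      two inclusions.\<close>
    have same: "Q = Q'" if Q: "Q \<in> S" "Q' \<in> S" "\<forall>i<n. near \<T> ((g ^^ i) (\<rho> Q)) ((g ^^ i) (\<rho> Q'))"
      "\<forall>i<n. near \<T> ((g ^^ i) (\<rho> Q')) ((g ^^ i) (\<rho> Q))" for Q Q'
    proof -
      have P: "\<rho> Q \<in> Per X g n" "\<rho> Q' \<in> Per X g n" using \<rho> Q by auto
      have "(\<rho> Q, \<rho> Q') \<in> nielsen_relation X Y g n" "(\<rho> Q', \<rho> Q) \<in> nielsen_relation X Y g n"
        using nr P Q(3,4) by blast+
      then have "nielsen_relation X Y g n `` {\<rho> Q} = nielsen_relation X Y g n `` {\<rho> Q'}"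
        using nielsen_class_subset by (metis subset_antisym)
      then show ?thesis using \<rho> Q by metis
    qed
    have cM: "compact_space M" using M by (simp add: compact_surface_def)
    obtain \<V> where V: "\<V> \<subseteq> iterated_join M f \<U> n" "finite \<V>" "\<Union>\<V> = topspace M"
      "card \<V> = min_subcover M (iterated_join M f \<U> n)"
      by (rule compact_min_subcover[OF cM f_continuous cover]) (rule that)
    \<comment> \<open>A member of the join is an itinerary of neighbourhoods; their centres
      determine which labelling is read at each time, so classes with the same member are compared
      by the same labellings.\<close>
    have "\<forall>v\<in>\<V>. \<exists>ctr. \<forall>i<n. ctr i \<in> topspace M \<and> (\<forall>x\<in>v. (f ^^ i) x \<in> W (ctr i))"
    proof
      fix v assume "v \<in> \<V>"
      then obtain u where u: "\<forall>i<n. u i \<in> \<U>" "v = {x \<in> topspace M. \<forall>i<n. (f ^^ i) x \<in> u i}"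
        using V(1) unfolding iterated_join_def by blast
      have "\<forall>i. \<exists>y. i < n \<longrightarrow> y \<in> topspace M \<and> u i = W y" using u(1) unfolding \<U>_def by blast
      then obtain ctr where "\<forall>i. i < n \<longrightarrow> ctr i \<in> topspace M \<and> u i = W (ctr i)" by metis
      then show "\<exists>ctr. \<forall>i<n. ctr i \<in> topspace M \<and> (\<forall>x\<in>v. (f ^^ i) x \<in> W (ctr i))"
        using u(2) by (intro exI[of _ ctr]) auto
    qed
    from bchoice[OF this] obtain ctr where ctr: "\<forall>v\<in>\<V>. \<forall>i<n. ctr v i \<in> topspace M \<and> (\<forall>x\<in>v. (f ^^ i) x \<in> W (ctr v i))"
      by (elim exE) (rule that)
    have "\<forall>Q\<in>S. \<exists>v. v \<in> \<V> \<and> q (\<rho> Q) \<in> v"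
    proof
      fix Q assume "Q \<in> S"
      then have "q (\<rho> Q) \<in> \<Union>\<V>" unfolding V(3) using \<rho> q_in unfolding Per_def by blast
      then show "\<exists>v. v \<in> \<V> \<and> q (\<rho> Q) \<in> v" by blast
    qed
    from bchoice[OF this] obtain \<nu> where \<nu>: "\<forall>Q\<in>S. \<nu> Q \<in> \<V> \<and> q (\<rho> Q) \<in> \<nu> Q"
      by (elim exE) (rule that)
    define m where "m = n div N + 1"
    \<comment> \<open>The value 0 is a filler: it occurs when \<open>N\<close> divides
      \<open>n\<close>, for the last index, whose block would start at time
      \<open>n\<close>.\<close>
    define \<omega> where "\<omega> Q = (\<lambda>j\<in>{..<m}. if j * N < n then lab (ctr (\<nu> Q) (j * N)) ((g ^^ (j * N)) (\<rho> Q)) else 0)" for Q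
    have \<omega>_in: "\<omega> Q \<in> {..<m} \<rightarrow>\<^sub>E {..<64}" if "Q \<in> S" for Q
    proof (rule PiE_I)
      fix j assume "j \<in> {..<m}"
      moreover have "lab (ctr (\<nu> Q) (j * N)) ((g ^^ (j * N)) (\<rho> Q)) < 64" if "j * N < n"
        using WL ctr \<nu> \<open>Q \<in> S\<close> that by blast
      ultimately show "\<omega> Q j \<in> {..<64}" unfolding \<omega>_def by auto
    qed (simp add: \<omega>_def)
    have near_all: "\<forall>i<n. near \<T> ((g ^^ i) (\<rho> Q)) ((g ^^ i) (\<rho> Q'))"
      if Q: "Q \<in> S" "Q' \<in> S" "\<nu> Q = \<nu> Q'" "\<omega> Q = \<omega> Q'" for Q Q'
    proof (intro allI impI)
      fix i assume i: "i < n"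
      define j where "j = i div N"
      have jm: "j < m" unfolding j_def m_def using i div_le_mono[of i n N] by simp
      have jn: "j * N < n" unfolding j_def using i div_times_less_eq_dividend[of i N] by linarith
      define y where "y = ctr (\<nu> Q) (j * N)"
      have y: "y \<in> topspace M" using ctr \<nu> Q(1) jn unfolding y_def by blast
      have inW: "q ((g ^^ (j * N)) (\<rho> R)) \<in> W y" if R: "R = Q \<or> R = Q'" for R
      proof -
        have RS: "R \<in> S" "\<nu> R = \<nu> Q" using R Q by auto
        then have "(f ^^ (j * N)) (q (\<rho> R)) \<in> W y" using ctr \<nu> jn unfolding y_def by metis
        then show ?thesis using q_funpow_g \<rho> RS(1) unfolding Per_def by auto
      qed
      have av: "avoids ((g ^^ (j * N)) (\<rho> Q))" "avoids ((g ^^ (j * N)) (\<rho> Q'))"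
        using avoids_funpow \<rho> Q(1,2) by blast+
      have "\<omega> Q j = \<omega> Q' j" using Q(4) by simp
      then have "lab y ((g ^^ (j * N)) (\<rho> Q)) = lab y ((g ^^ (j * N)) (\<rho> Q'))"
        using jm jn Q(3) unfolding \<omega>_def y_def by simp
      then have "\<forall>k<N. near \<T> ((g ^^ k) ((g ^^ (j * N)) (\<rho> Q))) ((g ^^ k) ((g ^^ (j * N)) (\<rho> Q')))"
        using WL y av inW by blast
      moreover have "i mod N < N" using N by simp
      moreover have "(g ^^ (i mod N)) ((g ^^ (j * N)) z) = (g ^^ i) z" for z
        unfolding j_def by (metis comp_apply funpow_add mod_div_mult_eq)
      ultimately show "near \<T> ((g ^^ i) (\<rho> Q)) ((g ^^ i) (\<rho> Q'))" by metis
    qed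
    have "inj_on (\<lambda>Q. (\<nu> Q, \<omega> Q)) S"
    proof (rule inj_onI)
      fix Q Q' assume Q: "Q \<in> S" "Q' \<in> S" "(\<nu> Q, \<omega> Q) = (\<nu> Q', \<omega> Q')"
      then show "Q = Q'" by (intro same near_all) auto
    qed
    moreover have "(\<lambda>Q. (\<nu> Q, \<omega> Q)) ` S \<subseteq> \<V> \<times> ({..<m} \<rightarrow>\<^sub>E {..<64})" using \<nu> \<omega>_in by blast
    moreover have "finite (\<V> \<times> ({..<m} \<rightarrow>\<^sub>E {..<64::nat}))" using V(2) by (intro finite_cartesian_product finite_PiE) auto
    ultimately have "card S \<le> card (\<V> \<times> ({..<m} \<rightarrow>\<^sub>E {..<64::nat}))" by (rule card_inj_on_le)
    also have "\<dots> = min_subcover M (iterated_join M f \<U> n) * 64 ^ m"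
      using V(4) by (simp add: card_cartesian_product card_PiE)
    finally show ?thesis unfolding num m_def .
  qed
  then show thesis by (rule that[OF cover])
qed

text \<open>For fixed \<open>N\<close> the labels cost \<open>ln 64 / N\<close> per step, plus
  \<open>ln 64 / n\<close> for the additional block. The latter vanishes in the limit, and the
  choice of \<open>N\<close> brings the former below any \<open>e\<close>.\<close>

lemma asymptotic_nielsen_number_le_entropy:
  assumes RR: "\<forall>R\<in>RR. region X Y R"
  shows "asymptotic_nielsen_number X Y RR g \<le> topological_entropy M f"
proof (rule ereal_le_epsilon2)
  fix e :: real assume e: "0 < e"
  obtain N where N: "N > 0" "ln 64 / real N < e"
  proof -
    obtain N where "ln 64 / e < real N" using reals_Archimedean2 by blast
    moreover have "0 < ln 64 / e" using e by simp
    ultimately have N: "N > 0" by (cases "N = 0") auto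
    moreover have "ln 64 / real N < e" using \<open>ln 64 / e < real N\<close> e N by (simp add: field_simps)
    ultimately show thesis by (rule that)
  qed
  obtain \<U> where U: "open_cover M \<U>"
    "\<And>n. n > 0 \<Longrightarrow> nielsen_number X Y RR g n \<le> min_subcover M (iterated_join M f \<U> n) * 64 ^ (n div N + 1)"
    by (rule nielsen_number_le[OF RR N(1)]) (rule that)
  define a where "a n = (if nielsen_number X Y RR g n = 0 then - \<infinity>
     else ereal (ln (real (nielsen_number X Y RR g n)) / real n))" for n
  define b where "b n = ln (real (min_subcover M (iterated_join M f \<U> n))) / real n" for n
  have le: "a n \<le> ereal (b n) + ereal (ln 64 / real N + ln 64 / real n)" if n: "n > 0" for n
  proof (cases "nielsen_number X Y RR g n = 0")
    case False
    let ?k = "min_subcover M (iterated_join M f \<U> n)"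
    have le1: "real (nielsen_number X Y RR g n) \<le> real ?k * 64 ^ (n div N + 1)"
      using U(2)[OF n] by (metis (mono_tags) of_nat_le_iff of_nat_mult of_nat_numeral of_nat_power)
    \<comment> \<open>A nonzero Nielsen number forces a nonempty subcover, so the logarithm of the
      product splits.\<close>
    then have kpos: "?k > 0" using False by (cases "?k = 0") auto
    have "ln (real (nielsen_number X Y RR g n)) \<le> ln (real ?k * 64 ^ (n div N + 1))"
      using le1 False by (intro ln_mono) auto
    also have "\<dots> = ln (real ?k) + real (n div N + 1) * ln 64"
      using kpos by (subst ln_mult) (simp_all add: ln_realpow del: power_Suc)
    also have "\<dots> \<le> ln (real ?k) + (real n / real N + 1) * ln 64"
      using of_nat_div_le_of_nat[of n N] by (intro add_left_mono mult_right_mono) auto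
    finally have "ln (real (nielsen_number X Y RR g n)) / real n \<le> (ln (real ?k) + (real n / real N + 1) * ln 64) / real n"
      by (rule divide_right_mono) simp
    also have "\<dots> = b n + (ln 64 / real N + ln 64 / real n)"
      using n N(1) unfolding b_def by (simp add: field_simps)
    finally show ?thesis using False unfolding a_def by simp
  qed (simp add: a_def)
  have lim: "(\<lambda>n. ereal (ln 64 / real N + ln 64 / real n)) \<longlonglongrightarrow> ereal (ln 64 / real N)"
  proof -
    have "(\<lambda>n. ln 64 / real n) \<longlonglongrightarrow> 0" by (rule lim_const_over_n)
    then have "(\<lambda>n. ln 64 / real N + ln 64 / real n) \<longlonglongrightarrow> ln 64 / real N + 0" by (intro tendsto_add tendsto_const)
    then show ?thesis by simp
  qed
  have "limsup a \<le> limsup (\<lambda>n. ereal (ln 64 / real N + ln 64 / real n) + ereal (b n))"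
    by (rule Limsup_mono) (use le in \<open>auto simp: eventually_sequentially add.commute intro!: exI[of _ 1]\<close>)
  \<comment> \<open>The correction term converges to a real number, so the upper limit of the sum
    splits with equality.\<close>
  also have "\<dots> = ereal (ln 64 / real N) + limsup (\<lambda>n. ereal (b n))"
    by (rule ereal_limsup_lim_add[OF lim]) simp
  also have "\<dots> \<le> ereal e + topological_entropy M f"
  proof (rule add_mono)
    show "ereal (ln 64 / real N) \<le> ereal e" using N(2) by simp
    show "limsup (\<lambda>n. ereal (b n)) \<le> topological_entropy M f"
      unfolding topological_entropy_def b_def by (rule SUP_upper) (use U(1) in simp)
  qed
  finally show "asymptotic_nielsen_number X Y RR g \<le> topological_entropy M f + ereal e"
    unfolding asymptotic_nielsen_number_def a_def by (simp add: add.commute)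
qed

end

theorem corollary3p17:
  fixes M :: "'a topology" and A :: "'a atlas" and f :: "'a \<Rightarrow> 'a" and T :: "'a trellis"
    and X :: "'b topology" and q :: "'b \<Rightarrow> 'a" and Cf :: "'b \<Rightarrow> 'b" and RR :: "'b set set"
  assumes "compact_surface M" and "C1_atlas M A"
    and "homeomorphic_map M M f"
    and "trellis_for M T f" and "transverse_trellis M T"
    and "\<forall>p\<in>TP T. hyperbolic_periodic_point M A f p"
    and "cut_surface M (TU T) X q"
    and "is_cut_map T f X q Cf"
    and "\<forall>R\<in>RR. region X (cut_stable T X q) R" and "pairwise disjnt RR"
  shows "topological_entropy M f \<ge> asymptotic_nielsen_number X (cut_stable T X q) RR Cf"
proof -
  interpret cut_trellis M f T X q Cf
    using assms by unfold_locales
  show ?thesis using asymptotic_nielsen_number_le_entropy assms(9) by blast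
qed

end
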